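(* Let $M$ be an $n$-dimensional manifold with $n\ge 3$, let $\alpha=\sqrt{a_{ij}(x)y^iy^j}$ be a Riemannian metric on $M$, let $\beta=b_i(x)y^i$ be a nowhere vanishing $1$-form on $M$ with length $b=\|\beta\|_\alpha$, and let $F=\frac{(b\alpha+\beta)^2}{\alpha}$ be the corresponding singular square metric. Then $F$ is a Douglas metric if and only if there exist scalar functions $c(x)$ and $d(x)$ on $M$ such that $$r_{ij}=c(x)a_{ij}+d(x)b_ib_j-\frac{3}{b^2}(s_ib_j+s_jb_i),$$ $$s_{ij}=\frac{1}{b^2}(b_is_j-b_js_i).$$
   Context: Let $b_{i|j}$ be the coefficients of the covariant derivative of $\beta$ with respect to the Levi-Civita connection of $\alpha$, $(a^{ij})=(a_{ij})^{-1}$, $b^i=a^{ij}b_j$, $b^2=b^ib_i$, and put $r_{ij}=\frac12(b_{i|j}+b_{j|i})$, $s_{ij}=\frac12(b_{i|j}-b_{j|i})$, $s_i=b^js_{ji}$. Here $(x^i,y^i)$ are the natural coordinates on $TM$. The spray coefficients of $F$ are $G^i=\frac14 g^{il}\{[F^2]_{x^ky^l}y^k-[F^2]_{x^l}\}$, where $(g^{ij})$ is the inverse of the fundamental tensor $g_{ij}=[\frac12F^2]_{y^iy^j}$. For a singular square metric the fundamental tensor is degenerate only in the directions with $b\alpha\pm\beta=0$, i.e. $y$ parallel to $(b^i)$; $G^i$ is considered on the complement of these directions in $TM\setminus\{0\}$. $F$ is a Douglas metric (has vanishing Douglas curvature) if in local coordinates $G^i=\frac12\Gamma^i_{jk}(x)y^jy^k+P(x,y)y^i$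 for some local functions $\Gamma^i_{jk}(x)$ on $M$ and some local function $P(x,y)$ positively homogeneous of degree one in $y$. *)

theory Defs
  imports "HOL-Analysis.Analysis"
begin

section \<open>Smooth functions and partial derivatives\<close>

text \<open>Only meaningful for open sets \<open>S\<close>.\<close>

primrec Ck_on :: "nat \<Rightarrow> 'a::euclidean_space set \<Rightarrow> ('a \<Rightarrow> 'b::real_normed_vector) \<Rightarrow> bool" where
  "Ck_on 0 S f \<longleftrightarrow> continuous_on S f"
| "Ck_on (Suc k) S f \<longleftrightarrow> f differentiable_on S \<and>
     (\<forall>v\<in>Basis. Ck_on k S (\<lambda>x. frechet_derivative f (at x) v))"

definition smooth_on :: "'a::euclidean_space set \<Rightarrow> ('a \<Rightarrow> 'b::real_normed_vector) \<Rightarrow> bool" where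
  "smooth_on S f \<longleftrightarrow> (\<forall>k. Ck_on k S f)"

definition partial :: "'n::finite \<Rightarrow> (real^'n \<Rightarrow> real) \<Rightarrow> real^'n \<Rightarrow> real" where
  "partial i f x = frechet_derivative f (at x) (axis i 1)"


section \<open>Smooth manifolds, given by an atlas\<close>

text \<open>A chart is a pair of its domain \<open>U\<close> and its coordinate map, which is only relevant on \<open>U\<close>.\<close>

type_synonym ('m, 'n) chart = "'m set \<times> ('m \<Rightarrow> real^'n)"

definition coord_dom :: "('m, 'n::finite) chart \<Rightarrow> (real^'n) set" where
  "coord_dom \<kappa> = snd \<kappa> ` fst \<kappa>"

definition transition :: "('m, 'n::finite) chart \<Rightarrow> ('m, 'n) chart \<Rightarrow> real^'n \<Rightarrow> real^'n" where
  "transition \<kappa> \<kappa>' x = snd \<kappa>' (inv_into (fst \<kappa>) (snd \<kappa>) x)"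

text \<open>The atlas \<open>A\<close> is not required to be maximal.\<close>

definition smooth_manifold :: "'m topology \<Rightarrow> ('m, 'n::finite) chart set \<Rightarrow> bool" where
  "smooth_manifold M A \<longleftrightarrow>
     Hausdorff_space M \<and> second_countable M \<and>
     (\<Union>\<kappa>\<in>A. fst \<kappa>) = topspace M \<and>
     (\<forall>\<kappa>\<in>A. openin M (fst \<kappa>) \<and> open (coord_dom \<kappa>) \<and>
        homeomorphic_map (subtopology M (fst \<kappa>)) (top_of_set (coord_dom \<kappa>)) (snd \<kappa>)) \<and>
     (\<forall>\<kappa>\<in>A. \<forall>\<kappa>'\<in>A. smooth_on (snd \<kappa> ` (fst \<kappa> \<inter> fst \<kappa>')) (transition \<kappa> \<kappa>'))"

definition smooth_scalar :: "('m, 'n::finite) chart set \<Rightarrow> ('m \<Rightarrow> real) \<Rightarrow> bool" where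
  "smooth_scalar A f \<longleftrightarrow>
     (\<forall>\<kappa>\<in>A. smooth_on (coord_dom \<kappa>) (\<lambda>x. f (inv_into (fst \<kappa>) (snd \<kappa>) x)))"

text \<open>
  Tensor fields are families of components: \<open>a \<kappa> x $ i $ j\<close> is the component \<open>a\<^sub>i\<^sub>j\<close> in the chart
  \<open>\<kappa>\<close> at the point with coordinates \<open>x\<close>, subject to the tensorial transformation law.
\<close>

definition riemannian_metric ::
    "('m, 'n::finite) chart set \<Rightarrow> (('m, 'n) chart \<Rightarrow> real^'n \<Rightarrow> real^'n^'n) \<Rightarrow> bool" where
  "riemannian_metric A a \<longleftrightarrow>
     (\<forall>\<kappa>\<in>A. smooth_on (coord_dom \<kappa>) (a \<kappa>) \<and>
        (\<forall>x\<in>coord_dom \<kappa>. (\<forall>i j. a \<kappa> x $ i $ j = a \<kappa> x $ j $ i) \<and>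
           (\<forall>y. y \<noteq> 0 \<longrightarrow> (\<Sum>i\<in>UNIV. \<Sum>j\<in>UNIV. a \<kappa> x $ i $ j * y $ i * y $ j) > 0))) \<and>
     (\<forall>\<kappa>\<in>A. \<forall>\<kappa>'\<in>A. \<forall>p\<in>fst \<kappa> \<inter> fst \<kappa>'. \<forall>i j.
        a \<kappa> (snd \<kappa> p) $ i $ j =
          (\<Sum>k\<in>UNIV. \<Sum>l\<in>UNIV. a \<kappa>' (snd \<kappa>' p) $ k $ l *
             partial i (\<lambda>x. transition \<kappa> \<kappa>' x $ k) (snd \<kappa> p) *
             partial j (\<lambda>x. transition \<kappa> \<kappa>' x $ l) (snd \<kappa> p)))"

definition one_form ::
    "('m, 'n::finite) chart set \<Rightarrow> (('m, 'n) chart \<Rightarrow> real^'n \<Rightarrow> real^'n) \<Rightarrow> bool" where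
  "one_form A b \<longleftrightarrow>
     (\<forall>\<kappa>\<in>A. smooth_on (coord_dom \<kappa>) (b \<kappa>)) \<and>
     (\<forall>\<kappa>\<in>A. \<forall>\<kappa>'\<in>A. \<forall>p\<in>fst \<kappa> \<inter> fst \<kappa>'. \<forall>i.
        b \<kappa> (snd \<kappa> p) $ i =
          (\<Sum>k\<in>UNIV. b \<kappa>' (snd \<kappa>' p) $ k *
             partial i (\<lambda>x. transition \<kappa> \<kappa>' x $ k) (snd \<kappa> p)))"

definition nowhere_vanishing ::
    "('m, 'n::finite) chart set \<Rightarrow> (('m, 'n) chart \<Rightarrow> real^'n \<Rightarrow> real^'n) \<Rightarrow> bool" where
  "nowhere_vanishing A b \<longleftrightarrow> (\<forall>\<kappa>\<in>A. \<forall>x\<in>coord_dom \<kappa>. b \<kappa> x \<noteq> 0)"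


section \<open>The metric and the 1-form in one chart\<close>

text \<open>From here on \<open>a\<close>, \<open>b\<close> are the components in a fixed chart, as functions of the coordinates.\<close>

type_synonym 'n metric_coeffs = "real^'n \<Rightarrow> real^'n^'n"
type_synonym 'n form_coeffs = "real^'n \<Rightarrow> real^'n"

definition christoffel :: "'n::finite metric_coeffs \<Rightarrow> real^'n \<Rightarrow> 'n \<Rightarrow> 'n \<Rightarrow> 'n \<Rightarrow> real" where
  "christoffel a x k i j =
     1/2 * (\<Sum>l\<in>UNIV. matrix_inv (a x) $ k $ l *
       (partial i (\<lambda>x. a x $ l $ j) x + partial j (\<lambda>x. a x $ l $ i) x
          - partial l (\<lambda>x. a x $ i $ j) x))"

text \<open>\<open>cov_deriv a b x i j\<close> is \<open>b\<^sub>i\<^sub>|\<^sub>j\<close>: the last index is the one of differentiation.\<close>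

definition cov_deriv ::
    "'n::finite metric_coeffs \<Rightarrow> 'n form_coeffs \<Rightarrow> real^'n \<Rightarrow> 'n \<Rightarrow> 'n \<Rightarrow> real" where
  "cov_deriv a b x i j =
     partial j (\<lambda>x. b x $ i) x - (\<Sum>k\<in>UNIV. christoffel a x k i j * b x $ k)"

definition b_up :: "'n::finite metric_coeffs \<Rightarrow> 'n form_coeffs \<Rightarrow> real^'n \<Rightarrow> 'n \<Rightarrow> real" where
  "b_up a b x i = (\<Sum>j\<in>UNIV. matrix_inv (a x) $ i $ j * b x $ j)"

definition b_sq :: "'n::finite metric_coeffs \<Rightarrow> 'n form_coeffs \<Rightarrow> real^'n \<Rightarrow> real" where
  "b_sq a b x = (\<Sum>i\<in>UNIV. b_up a b x i * b x $ i)"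

definition b_norm :: "'n::finite metric_coeffs \<Rightarrow> 'n form_coeffs \<Rightarrow> real^'n \<Rightarrow> real" where
  "b_norm a b x = sqrt (b_sq a b x)"

definition r_tensor ::
    "'n::finite metric_coeffs \<Rightarrow> 'n form_coeffs \<Rightarrow> real^'n \<Rightarrow> 'n \<Rightarrow> 'n \<Rightarrow> real" where
  "r_tensor a b x i j = 1/2 * (cov_deriv a b x i j + cov_deriv a b x j i)"

definition s_tensor ::
    "'n::finite metric_coeffs \<Rightarrow> 'n form_coeffs \<Rightarrow> real^'n \<Rightarrow> 'n \<Rightarrow> 'n \<Rightarrow> real" where
  "s_tensor a b x i j = 1/2 * (cov_deriv a b x i j - cov_deriv a b x j i)"

definition s_form ::
    "'n::finite metric_coeffs \<Rightarrow> 'n form_coeffs \<Rightarrow> real^'n \<Rightarrow> 'n \<Rightarrow> real" where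
  "s_form a b x i = (\<Sum>j\<in>UNIV. b_up a b x j * s_tensor a b x j i)"

definition alpha :: "'n::finite metric_coeffs \<Rightarrow> real^'n \<Rightarrow> real^'n \<Rightarrow> real" where
  "alpha a x y = sqrt (\<Sum>i\<in>UNIV. \<Sum>j\<in>UNIV. a x $ i $ j * y $ i * y $ j)"

definition beta :: "'n::finite form_coeffs \<Rightarrow> real^'n \<Rightarrow> real^'n \<Rightarrow> real" where
  "beta b x y = (\<Sum>i\<in>UNIV. b x $ i * y $ i)"

definition singular_square ::
    "'n::finite metric_coeffs \<Rightarrow> 'n form_coeffs \<Rightarrow> real^'n \<Rightarrow> real^'n \<Rightarrow> real" where
  "singular_square a b x y = (b_norm a b x * alpha a x y + beta b x y)\<^sup>2 / alpha a x y"

text \<open>The tangent vectors on which the spray of the singular square metric is considered.\<close>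

definition regular_dirs ::
    "'n::finite metric_coeffs \<Rightarrow> 'n form_coeffs \<Rightarrow> real^'n \<Rightarrow> (real^'n) set" where
  "regular_dirs a b x =
     {y. y \<noteq> 0 \<and> b_norm a b x * alpha a x y + beta b x y \<noteq> 0
               \<and> b_norm a b x * alpha a x y - beta b x y \<noteq> 0}"


section \<open>Sprays and Douglas metrics\<close>

definition fundamental_tensor ::
    "(real^'n \<Rightarrow> real^'n \<Rightarrow> real) \<Rightarrow> real^'n \<Rightarrow> real^'n \<Rightarrow> real^'n::finite^'n" where
  "fundamental_tensor F x y =
     (\<chi> i j. partial j (\<lambda>y. partial i (\<lambda>y. 1/2 * (F x y)\<^sup>2) y) y)"

definition spray_coeff ::
    "(real^'n \<Rightarrow> real^'n \<Rightarrow> real) \<Rightarrow> real^'n \<Rightarrow> real^'n \<Rightarrow> 'n::finite \<Rightarrow> real" where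
  "spray_coeff F x y i =
     1/4 * (\<Sum>l\<in>UNIV. matrix_inv (fundamental_tensor F x y) $ i $ l *
       ((\<Sum>k\<in>UNIV. partial l (\<lambda>y. partial k (\<lambda>x. (F x y)\<^sup>2) x) y * y $ k)
         - partial l (\<lambda>x. (F x y)\<^sup>2) x))"

text \<open>
  \<open>F \<kappa> x y\<close> is the metric in the natural coordinates \<open>(x, y)\<close> of the tangent bundle induced by
  \<open>\<kappa>\<close>, and \<open>D \<kappa> x\<close> is the (open) cone of those \<open>y\<close> for which the spray is considered.
\<close>

definition douglas_metric ::
    "('m, 'n::finite) chart set \<Rightarrow> (('m, 'n) chart \<Rightarrow> real^'n \<Rightarrow> real^'n \<Rightarrow> real) \<Rightarrow>
     (('m, 'n) chart \<Rightarrow> real^'n \<Rightarrow> (real^'n) set) \<Rightarrow> bool" where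
  "douglas_metric A F D \<longleftrightarrow>
     (\<forall>\<kappa>\<in>A. \<exists>(\<Gamma> :: real^'n \<Rightarrow> real^'n^'n^'n) (P :: real^'n \<Rightarrow> real^'n \<Rightarrow> real).
        smooth_on (coord_dom \<kappa>) \<Gamma> \<and>
        smooth_on (SIGMA x:coord_dom \<kappa>. D \<kappa> x) (\<lambda>(x, y). P x y) \<and>
        (\<forall>x\<in>coord_dom \<kappa>. \<forall>y\<in>D \<kappa> x.
           (\<forall>t>0. P x (t *\<^sub>R y) = t * P x y) \<and>
           (\<forall>i. spray_coeff (F \<kappa>) x y i =
              1/2 * (\<Sum>j\<in>UNIV. \<Sum>k\<in>UNIV. \<Gamma> x $ i $ j $ k * y $ j * y $ k) + P x y * y $ i)))"

end

(*
  At a point, the equation "spray = quadratic + P y" is equivalent to the Euler-Lagrange equation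
  of F for the quadratic spray.  Written relative to the spray of alpha, it only involves r, s and
  the deviation H(y) of the two sprays, besides alpha and beta.  As H is even and alpha is
  irrational in y, replacing y by -y splits it into two parts.  The odd part is linear in y and
  yields the formula for s together with r(e,.) = rho beta - 3 s(e,.), where e is the vector dual
  to beta.  In the even part, comparing powers of t for y = z + t e with z orthogonal to e shows
  that r is proportional to the metric on the complement of e, because the part of H that is linear
  in t maps z into the span of z and e.  Conversely, H(y) = alpha^2 (2/b^2 s^i - d/3 b^i) solves
  the equation.  The functions c and d are smooth as rational expressions in the trace of r and
  r(e,e), and they glue to global functions because r is a tensor.
*)
theory Submission
  imports Defs
begin

section \<open>Calculus of smooth functions\<close>

text \<open>The Euler-Lagrange equation of F is used instead of that of F^2 because F is homogeneous
  of degree one: its second y-derivative kills y, so the unknown term P y disappears. Conversely,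
  the fundamental tensor is positive definite off the line of e, so a solution Q determines the
  spray and P comes out as a closed formula, which makes its smoothness provable. The even equations
  carry the factor b^2 alpha^2 - beta^2, positive exactly off that line, and can be divided by it;
  multiples of e are treated by hand. The coefficient -3 arises because r(e,.) + s(e,.), half the
  differential of b^2, is forced to equal rho beta - 2 s(e,.). The constants of H are read off the
  even part: testing against w orthogonal to y and e gives 2/b^2, testing against e gives -d/3. All
  this concerns a single point, so it is carried out for abstract bilinear data; the analysis only
  supplies these data and their smooth dependence on (x, y).\<close>

lemma Ck_on_has_derivative:
  assumes "Ck_on (Suc k) S f" "open S" "x \<in> S"
  shows "(f has_derivative frechet_derivative f (at x)) (at x)"
  using assms by (metis Ck_on.simps(2) differentiable_on_eq_differentiable_at frechet_derivative_works)

text \<open>A derivative at a point depends only on nearby values, so on an open set the equality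
  passes to the derivatives of every order.\<close>

lemma Ck_on_cong:
  assumes "open S" "\<And>x. x \<in> S \<Longrightarrow> f x = g x" "Ck_on k S f"
  shows "Ck_on k S g"
  using assms(2,3)
proof (induction k arbitrary: f g)
  case 0
  then show ?case by (metis Ck_on.simps(1) continuous_on_cong)
next
  case (Suc k)
  have D: "(g has_derivative frechet_derivative f (at x)) (at x)" if "x \<in> S" for x
    using Ck_on_has_derivative[OF Suc.prems(2) assms(1) that] Suc.prems(1)
    by (rule has_derivative_transform_within_open[OF _ assms(1) that])
  then have "frechet_derivative g (at x) = frechet_derivative f (at x)" if "x \<in> S" for x
    by (metis frechet_derivative_at that)
  then have "Ck_on k S (\<lambda>x. frechet_derivative g (at x) v)" if "v \<in> Basis" for v
    using Suc.IH[of "\<lambda>x. frechet_derivative f (at x) v" "\<lambda>x. frechet_derivative g (at x) v"]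
      Suc.prems(2) that by simp
  moreover have "g differentiable_on S"
    using D by (meson differentiable_at_withinI differentiable_def differentiable_on_def)
  ultimately show ?case by simp
qed

lemma Ck_on_SucI:
  assumes "open S" "\<And>x. x \<in> S \<Longrightarrow> (f has_derivative f' x) (at x)"
    "\<And>v. v \<in> Basis \<Longrightarrow> Ck_on k S (\<lambda>x. f' x v)"
  shows "Ck_on (Suc k) S f"
proof -
  have "Ck_on k S (\<lambda>x. frechet_derivative f (at x) v)" if "v \<in> Basis" for v
    by (rule Ck_on_cong[OF assms(1) _ assms(3)[OF that]]) (metis assms(2) frechet_derivative_at)
  moreover have "f differentiable_on S"
    using assms(2) by (meson differentiable_at_withinI differentiable_def differentiable_on_def)
  ultimately show ?thesis by simp
qed

lemma Ck_on_SucD: "Ck_on (Suc k) S f \<Longrightarrow> Ck_on k S f"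
proof (induction k arbitrary: f)
  case 0
  then show ?case by (simp add: differentiable_imp_continuous_on)
qed auto

lemma Ck_on_const: "open S \<Longrightarrow> Ck_on k S (\<lambda>x. c)"
proof (induction k arbitrary: c)
  case (Suc k)
  then show ?case by (intro Ck_on_SucI[where f' = "\<lambda>x v. 0"]) auto
qed simp

lemma Ck_on_bounded_linear:
  assumes "bounded_linear h" "open S" "Ck_on k S f"
  shows "Ck_on k S (\<lambda>x. h (f x))"
  using assms(3)
proof (induction k arbitrary: f)
  case 0
  then show ?case
    using assms(1) by (simp add: bounded_linear.continuous_on)
next
  case (Suc k)
  show ?case
    using Suc Ck_on_has_derivative[OF Suc.prems assms(2)]
    by (intro Ck_on_SucI[OF assms(2), where f' = "\<lambda>x v. h (frechet_derivative f (at x) v)"])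
      (auto intro: bounded_linear.has_derivative[OF assms(1)])
qed

lemma Ck_on_linear:
  assumes "bounded_linear h" "open S"
  shows "Ck_on k S h"
proof (cases k)
  case 0
  then show ?thesis by (simp add: assms(1) linear_continuous_on)
next
  case (Suc n)
  then show ?thesis
    using Ck_on_SucI[OF assms(2) bounded_linear_imp_has_derivative[OF assms(1)]]
      Ck_on_const[OF assms(2)] by blast
qed

lemma Ck_on_add:
  assumes "open S" "Ck_on k S f" "Ck_on k S g"
  shows "Ck_on k S (\<lambda>x. f x + g x)"
  using assms(2,3)
proof (induction k arbitrary: f g)
  case 0
  then show ?case by (simp add: continuous_on_add)
next
  case (Suc k)
  show ?case
  proof (rule Ck_on_SucI[OF assms(1)])
    show "((\<lambda>x. f x + g x) has_derivative
        (\<lambda>v. frechet_derivative f (at x) v + frechet_derivative g (at x) v)) (at x)" if "x \<in> S" for x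
      using Suc.prems that by (intro has_derivative_add Ck_on_has_derivative[OF _ assms(1)])
    show "Ck_on k S (\<lambda>x. frechet_derivative f (at x) v + frechet_derivative g (at x) v)"
      if "v \<in> Basis" for v
      using Suc.prems that by (intro Suc.IH) auto
  qed
qed

text \<open>The product rule leaves one factor undifferentiated in each summand;
  \<open>Ck_on_SucD\<close> lowers the order of that factor so that the induction hypothesis applies
  to the pair.\<close>

lemma Ck_on_bilinear:
  assumes "bounded_bilinear h" "open S" "Ck_on k S f" "Ck_on k S g"
  shows "Ck_on k S (\<lambda>x. h (f x) (g x))"
  using assms(3,4)
proof (induction k arbitrary: f g)
  case 0
  then show ?case
    using assms(1) by (simp add: bounded_bilinear.continuous_on)
next
  case (Suc k)
  show ?case
  proof (rule Ck_on_SucI[OF assms(2)])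
    show "((\<lambda>x. h (f x) (g x)) has_derivative
        (\<lambda>v. h (f x) (frechet_derivative g (at x) v) + h (frechet_derivative f (at x) v) (g x))) (at x)"
      if "x \<in> S" for x
      using Suc.prems that
      by (intro bounded_bilinear.FDERIV[OF assms(1)] Ck_on_has_derivative[OF _ assms(2)])
    show "Ck_on k S (\<lambda>x. h (f x) (frechet_derivative g (at x) v) + h (frechet_derivative f (at x) v) (g x))"
      if "v \<in> Basis" for v
      using Suc.prems that Ck_on_SucD[OF Suc.prems(1)] Ck_on_SucD[OF Suc.prems(2)]
      by (intro Ck_on_add[OF assms(2)] Suc.IH) auto
  qed
qed

lemma Ck_on_sum:
  assumes "open S" "\<And>i. i \<in> I \<Longrightarrow> Ck_on k S (f i)"
  shows "Ck_on k S (\<lambda>x. \<Sum>i\<in>I. f i x)"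
  using assms(2)
  by (induction I rule: infinite_finite_induct) (simp_all add: Ck_on_const Ck_on_add assms(1))

text \<open>The chain rule differentiates \<open>g\<close> in a direction that varies with the
  point, whereas \<open>Ck_on\<close> controls basis directions only. Expanding the direction over
  the basis gives a sum of products within reach of the induction hypothesis.\<close>

lemma Ck_on_compose:
  fixes f :: "'a::euclidean_space \<Rightarrow> 'b::euclidean_space"
  assumes "open S" "open T" "f ` S \<subseteq> T" "Ck_on k S f" "Ck_on k T g"
  shows "Ck_on k S (\<lambda>x. g (f x))"
  using assms(4,5)
proof (induction k arbitrary: g)
  case 0
  then show ?case
    using assms(3) by (auto intro: continuous_on_compose2)
next
  case (Suc k)
  have ST: "x \<in> S \<Longrightarrow> f x \<in> T" for x using assms(3) by auto
  have Df: "(f has_derivative frechet_derivative f (at x)) (at x)" if "x \<in> S" for x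
    by (rule Ck_on_has_derivative[OF Suc.prems(1) assms(1) that])
  have Dg: "(g has_derivative frechet_derivative g (at x)) (at x)" if "x \<in> T" for x
    by (rule Ck_on_has_derivative[OF Suc.prems(2) assms(2) that])
  have *: "frechet_derivative g (at (f x)) (frechet_derivative f (at x) v) =
      (\<Sum>w\<in>Basis. (frechet_derivative f (at x) v \<bullet> w) *\<^sub>R frechet_derivative g (at (f x)) w)"
    if "x \<in> S" for x v
  proof -
    interpret linear "frechet_derivative g (at (f x))"
      by (rule has_derivative_linear[OF Dg[OF ST[OF that]]])
    show ?thesis
      by (subst euclidean_representation[of "frechet_derivative f (at x) v", symmetric]) (simp only: sum scaleR)
  qed
  show ?case
  proof (rule Ck_on_SucI[OF assms(1)])
    show "((\<lambda>x. g (f x)) has_derivative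
        (\<lambda>v. \<Sum>w\<in>Basis. (frechet_derivative f (at x) v \<bullet> w) *\<^sub>R frechet_derivative g (at (f x)) w)) (at x)"
      if "x \<in> S" for x
      using has_derivative_compose[OF Df[OF that] Dg[OF ST[OF that]]] *[OF that] by simp
  next
    fix v :: 'a assume v: "v \<in> Basis"
    show "Ck_on k S (\<lambda>x. \<Sum>w\<in>Basis. (frechet_derivative f (at x) v \<bullet> w) *\<^sub>R frechet_derivative g (at (f x)) w)"
    proof (intro Ck_on_sum assms(1) Ck_on_bilinear[OF bounded_bilinear_scaleR])
      fix w :: 'b assume w: "w \<in> Basis"
      show "Ck_on k S (\<lambda>x. frechet_derivative f (at x) v \<bullet> w)"
        using Suc.prems(1) v
        by (intro Ck_on_bounded_linear[OF bounded_linear_inner_left assms(1)]) simp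
      show "Ck_on k S (\<lambda>x. frechet_derivative g (at (f x)) w)"
        by (rule Suc.IH[OF Ck_on_SucD[OF Suc.prems(1)]]) (use Suc.prems(2) w in simp)
    qed
  qed
qed

text \<open>The derivative of the inverse is a polynomial in the inverse itself, which closes the
  induction. For \<open>sqrt\<close> below, the derivative is a multiple of
  \<open>inverse (sqrt x)\<close>, with the same effect.\<close>

lemma Ck_on_inverse: "Ck_on k (- {0}) (inverse :: real \<Rightarrow> real)"
proof (induction k)
  case 0
  then show ?case by (simp add: continuous_on_inverse)
next
  case (Suc k)
  have D: "Ck_on k (- {0}) (\<lambda>x::real. - (v * (inverse x * inverse x)))" for v
    using Suc
    by (intro Ck_on_bounded_linear[OF bounded_linear_minus[OF bounded_linear_ident]]
        Ck_on_bounded_linear[OF bounded_linear_mult_right]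
        Ck_on_bilinear[OF bounded_bilinear_mult]) auto
  show ?case
    by (rule Ck_on_SucI[OF _ _ D]) (auto intro!: derivative_eq_intros)
qed

lemma Ck_on_sqrt: "Ck_on k {0<..} sqrt"
proof (induction k)
  case 0
  then show ?case by (simp add: continuous_on_real_sqrt)
next
  case (Suc k)
  have "Ck_on k {0<..} (\<lambda>x. inverse (sqrt x))"
    by (rule Ck_on_compose[OF _ _ _ Suc Ck_on_inverse]) auto
  then have D: "Ck_on k {0<..} (\<lambda>x. (v / 2) * inverse (sqrt x))" for v
    by (intro Ck_on_bounded_linear[OF bounded_linear_mult_right]) auto
  show ?case
    by (rule Ck_on_SucI[OF _ _ D]) (auto intro!: derivative_eq_intros simp: field_simps)
qed

section \<open>Closure rules for smoothness\<close>

named_theorems smooth_intros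

lemma smooth_on_const [smooth_intros]: "open S \<Longrightarrow> smooth_on S (\<lambda>x. c)"
  by (simp add: smooth_on_def Ck_on_const)

lemma smooth_on_linear: "bounded_linear h \<Longrightarrow> open S \<Longrightarrow> smooth_on S h"
  by (simp add: smooth_on_def Ck_on_linear)

lemma smooth_on_bounded_linear:
  "bounded_linear h \<Longrightarrow> open S \<Longrightarrow> smooth_on S f \<Longrightarrow> smooth_on S (\<lambda>x. h (f x))"
  by (simp add: smooth_on_def Ck_on_bounded_linear)

lemma smooth_on_add [smooth_intros]:
  "open S \<Longrightarrow> smooth_on S f \<Longrightarrow> smooth_on S g \<Longrightarrow> smooth_on S (\<lambda>x. f x + g x)"
  by (simp add: smooth_on_def Ck_on_add)

lemma smooth_on_minus [smooth_intros]:
  "open S \<Longrightarrow> smooth_on S f \<Longrightarrow> smooth_on S (\<lambda>x. - f x)"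
  by (rule smooth_on_bounded_linear[OF bounded_linear_minus[OF bounded_linear_ident]])

lemma smooth_on_diff [smooth_intros]:
  "open S \<Longrightarrow> smooth_on S f \<Longrightarrow> smooth_on S g \<Longrightarrow> smooth_on S (\<lambda>x. f x - g x)"
  using smooth_on_add[OF _ _ smooth_on_minus] by fastforce

lemma smooth_on_scaleR [smooth_intros]:
  "open S \<Longrightarrow> smooth_on S f \<Longrightarrow> smooth_on S g \<Longrightarrow> smooth_on S (\<lambda>x. f x *\<^sub>R g x)"
  by (simp add: smooth_on_def Ck_on_bilinear[OF bounded_bilinear_scaleR])

lemma smooth_on_mult [smooth_intros]:
  fixes f g :: "_ \<Rightarrow> real"
  shows "open S \<Longrightarrow> smooth_on S f \<Longrightarrow> smooth_on S g \<Longrightarrow> smooth_on S (\<lambda>x. f x * g x)"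
  by (simp add: smooth_on_def Ck_on_bilinear[OF bounded_bilinear_mult])

lemma smooth_on_power [smooth_intros]:
  fixes f :: "_ \<Rightarrow> real"
  shows "open S \<Longrightarrow> smooth_on S f \<Longrightarrow> smooth_on S (\<lambda>x. f x ^ n)"
  by (induction n) (simp_all add: smooth_on_const smooth_on_mult)

lemma smooth_on_sum [smooth_intros]:
  "open S \<Longrightarrow> (\<And>i. i \<in> I \<Longrightarrow> smooth_on S (f i)) \<Longrightarrow> smooth_on S (\<lambda>x. \<Sum>i\<in>I. f i x)"
  by (simp add: smooth_on_def Ck_on_sum)

lemma smooth_on_prod [smooth_intros]:
  fixes f :: "_ \<Rightarrow> _ \<Rightarrow> real"
  shows "open S \<Longrightarrow> (\<And>i. i \<in> I \<Longrightarrow> smooth_on S (f i)) \<Longrightarrow> smooth_on S (\<lambda>x. \<Prod>i\<in>I. f i x)"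
  by (induction I rule: infinite_finite_induct) (simp_all add: smooth_on_const smooth_on_mult)

lemma smooth_on_cong:
  "open S \<Longrightarrow> (\<And>x. x \<in> S \<Longrightarrow> f x = g x) \<Longrightarrow> smooth_on S f \<Longrightarrow> smooth_on S g"
  using Ck_on_cong unfolding smooth_on_def by blast

lemma smooth_on_compose:
  fixes f :: "'a::euclidean_space \<Rightarrow> 'b::euclidean_space"
  shows "open S \<Longrightarrow> open T \<Longrightarrow> f ` S \<subseteq> T \<Longrightarrow> smooth_on S f \<Longrightarrow> smooth_on T g
    \<Longrightarrow> smooth_on S (\<lambda>x. g (f x))"
  using Ck_on_compose unfolding smooth_on_def by blast

lemma smooth_on_inverse:
  assumes "open S" "smooth_on S f" "\<And>x. x \<in> S \<Longrightarrow> f x \<noteq> (0::real)"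
  shows "smooth_on S (\<lambda>x. inverse (f x))"
  by (rule smooth_on_compose[where T = "- {0}", OF assms(1) _ _ assms(2)])
    (auto simp: smooth_on_def Ck_on_inverse assms(3))

lemma smooth_on_divide [smooth_intros]:
  assumes "open S" "smooth_on S f" "smooth_on S g" "\<And>x. x \<in> S \<Longrightarrow> g x \<noteq> (0::real)"
  shows "smooth_on S (\<lambda>x. f x / g x)"
  unfolding divide_inverse by (intro smooth_intros smooth_on_inverse assms)

lemma smooth_on_sqrt [smooth_intros]:
  assumes "open S" "smooth_on S f" "\<And>x. x \<in> S \<Longrightarrow> f x > 0"
  shows "smooth_on S (\<lambda>x. sqrt (f x))"
  by (rule smooth_on_compose[where T = "{0<..}", OF assms(1) _ _ assms(2)])
    (auto simp: smooth_on_def Ck_on_sqrt assms(3))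

lemma smooth_on_nth [smooth_intros]:
  "open S \<Longrightarrow> smooth_on S f \<Longrightarrow> smooth_on S (\<lambda>x. f x $ i)"
  by (rule smooth_on_bounded_linear[OF bounded_linear_vec_nth])

lemma smooth_on_componentwise:
  fixes f :: "'a::euclidean_space \<Rightarrow> 'b::euclidean_space"
  assumes "open S" "\<And>v. v \<in> Basis \<Longrightarrow> smooth_on S (\<lambda>x. f x \<bullet> v)"
  shows "smooth_on S f"
proof -
  have "smooth_on S (\<lambda>x. \<Sum>v\<in>Basis. (f x \<bullet> v) *\<^sub>R v)"
    by (intro smooth_intros assms)
  then show ?thesis by (simp add: euclidean_representation)
qed

lemma smooth_on_vec [smooth_intros]:
  fixes f :: "'a::euclidean_space \<Rightarrow> 'n::finite \<Rightarrow> 'b::euclidean_space"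
  assumes "open S" "\<And>i. smooth_on S (\<lambda>x. f x i)"
  shows "smooth_on S (\<lambda>x. \<chi> i. f x i)"
proof (rule smooth_on_componentwise[OF assms(1)])
  fix v :: "'b^'n" assume "v \<in> Basis"
  then obtain i u where "v = axis i u" by (auto simp: Basis_vec_def)
  then show "smooth_on S (\<lambda>x. (\<chi> i. f x i) \<bullet> v)"
    using smooth_on_bounded_linear[OF bounded_linear_inner_left assms] by (simp add: inner_axis)
qed

lemma smooth_on_frechet_derivative:
  "smooth_on S f \<Longrightarrow> v \<in> Basis \<Longrightarrow> smooth_on S (\<lambda>x. frechet_derivative f (at x) v)"
  using Ck_on.simps(2) unfolding smooth_on_def by blast

lemma smooth_on_partial [smooth_intros]:
  "smooth_on S f \<Longrightarrow> smooth_on S (partial i f)"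
  using smooth_on_frechet_derivative[of S f "axis i 1"]
  by (simp add: partial_def[abs_def] axis_in_Basis_iff)

lemma smooth_on_has_derivative:
  "smooth_on S f \<Longrightarrow> open S \<Longrightarrow> x \<in> S \<Longrightarrow> (f has_derivative frechet_derivative f (at x)) (at x)"
  by (meson Ck_on_has_derivative smooth_on_def)

lemma smooth_on_imp_continuous_on: "smooth_on S f \<Longrightarrow> continuous_on S f"
  unfolding smooth_on_def by (metis Ck_on.simps(1))

section \<open>Smooth dependence of the inverse matrix\<close>

lemma
  fixes A :: "real^'n^'n"
  assumes "invertible A"
  shows matrix_inv_right: "A ** matrix_inv A = mat 1"
    and matrix_inv_left: "matrix_inv A ** A = mat 1"
  using someI_ex[OF assms[unfolded invertible_def]] by (simp_all add: matrix_inv_def)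

text \<open>Cramer's rule for the j-th column of the inverse, the solution of
  \<open>A *v v = axis j 1\<close>. The entries of the inverse are thus rational in those of
  \<open>A\<close>, which is how their smoothness is obtained.\<close>

lemma matrix_inv_eq_det:
  fixes A :: "real^'n^'n"
  assumes "invertible A"
  shows "matrix_inv A $ i $ j = det (\<chi> k l. if l = i then axis j 1 $ k else A $ k $ l) / det A"
proof -
  have "A *v (matrix_inv A *v axis j 1) = axis j 1"
    by (metis assms matrix_inv_right matrix_vector_mul_assoc matrix_vector_mul_lid)
  moreover have "det A \<noteq> 0" using assms invertible_det_nz by blast
  ultimately have "matrix_inv A *v axis j 1 = (\<chi> k. det (\<chi> i l. if l = k then axis j 1 $ i else A $ i $ l) / det A)"
    using cramer by blast
  moreover have "(matrix_inv A *v axis j 1) $ i = matrix_inv A $ i $ j"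
    by (simp add: matrix_vector_mul_component inner_axis)
  ultimately show ?thesis by simp
qed

lemma smooth_on_det:
  fixes A :: "'a::euclidean_space \<Rightarrow> real^'n^'n"
  assumes "open S" "\<And>i j. smooth_on S (\<lambda>x. A x $ i $ j)"
  shows "smooth_on S (\<lambda>x. det (A x))"
  unfolding det_def by (intro smooth_intros assms)

lemma smooth_on_matrix_inv [smooth_intros]:
  fixes A :: "'a::euclidean_space \<Rightarrow> real^'n^'n"
  assumes "open S" "smooth_on S A" "\<And>x. x \<in> S \<Longrightarrow> invertible (A x)"
  shows "smooth_on S (\<lambda>x. matrix_inv (A x))"
proof -
  have "smooth_on S (\<lambda>x. A x $ i $ j)" for i j
    by (intro smooth_intros assms)
  then have "smooth_on S (\<lambda>x. if l = i then axis j 1 $ k else A x $ k $ l)" for i j k l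
    using smooth_on_const[OF assms(1)] by (cases "l = i") simp_all
  then have "smooth_on S (\<lambda>x. det (\<chi> k l. if l = i then axis j 1 $ k else A x $ k $ l) / det (A x))"
    for i j
    using assms invertible_det_nz[of "A _"] by (intro smooth_intros smooth_on_det) auto
  then have "smooth_on S (\<lambda>x. \<chi> i j. det (\<chi> k l. if l = i then axis j 1 $ k else A x $ k $ l) / det (A x))"
    by (intro smooth_on_vec assms(1))
  then show ?thesis
    by (rule smooth_on_cong[OF assms(1), rotated])
      (simp add: vec_eq_iff matrix_inv_eq_det assms(3))
qed

section \<open>Symmetry of second derivatives\<close>

text \<open>Both mixed second derivatives are limits of the second difference quotient
  \<open>(f (x + t u + t v) - f (x + t u) - f (x + t v) + f x) / t\<^sup>2\<close>.\<close>

lemma second_difference_limit: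
  fixes f :: "'a::real_normed_vector \<Rightarrow> real"
  assumes "open S" "x \<in> S"
    and f: "\<And>z. z \<in> S \<Longrightarrow> (f has_derivative f' z) (at z)"
    and f': "((\<lambda>z. f' z u) has_derivative f'') (at x)"
  shows "((\<lambda>t. (f (x + t *\<^sub>R u + t *\<^sub>R v) - f (x + t *\<^sub>R u) - f (x + t *\<^sub>R v) + f x) / t\<^sup>2)
    \<longlongrightarrow> f'' v) (at_right 0)"
proof (rule tendstoI)
  fix e :: real assume "e > 0"
  \<comment> \<open>\<open>t * C\<close> bounds every displacement \<open>s u + r v\<close> with
    steps up to \<open>t\<close>; the summand 1 keeps \<open>C\<close> positive even if both
    directions vanish.\<close>
  define C where "C = 2 * norm u + norm v + 1"
  have C: "C > 0" "norm u \<le> C" "norm u + norm v \<le> C" by (auto simp: C_def intro: add_nonneg_pos)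
  \<comment> \<open>Two approximation errors enter below, each at most \<open>t * (e / 3)\<close>,
    which leaves a margin below \<open>t * e\<close>.\<close>
  define \<epsilon> where "\<epsilon> = e / (3 * C)"
  have "\<epsilon> > 0" using \<open>e > 0\<close> C by (simp add: \<epsilon>_def)
  interpret f'': bounded_linear f'' using f' by (rule has_derivative_bounded_linear)
  obtain \<delta> where \<delta>: "\<delta> > 0"
    "\<And>z. norm (z - x) < \<delta> \<Longrightarrow> \<bar>f' z u - f' x u - f'' (z - x)\<bar> \<le> \<epsilon> * norm (z - x)"
    using f' \<open>\<epsilon> > 0\<close> unfolding has_derivative_at_alt by (metis real_norm_def)
  obtain \<eta> where \<eta>: "\<eta> > 0" "\<And>z. norm (z - x) < \<eta> \<Longrightarrow> z \<in> S"
    using assms(1,2) by (metis dist_norm open_dist)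
  define T where "T = min \<delta> \<eta> / C"
  have "T > 0" using \<delta>(1) \<eta>(1) C by (simp add: T_def)
  have "dist ((f (x + t *\<^sub>R u + t *\<^sub>R v) - f (x + t *\<^sub>R u) - f (x + t *\<^sub>R v) + f x) / t\<^sup>2) (f'' v) < e"
    if t: "0 < t" "t < T" for t
  proof -
    have small: "norm (s *\<^sub>R u + r *\<^sub>R v) < min \<delta> \<eta> \<and> norm (s *\<^sub>R u + r *\<^sub>R v) \<le> t * C"
      if "0 \<le> s" "s \<le> t" "0 \<le> r" "r \<le> t" for s r
    proof -
      have "norm (s *\<^sub>R u + r *\<^sub>R v) \<le> s * norm u + r * norm v"
        using that by (metis abs_of_nonneg norm_scaleR norm_triangle_ineq)
      also have "\<dots> \<le> t * norm u + t * norm v"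
        using that by (intro add_mono mult_right_mono) auto
      also have "\<dots> \<le> t * C" using C(3) t(1) by (metis distrib_left mult_left_mono less_imp_le)
      finally have *: "norm (s *\<^sub>R u + r *\<^sub>R v) \<le> t * C" .
      also have "t * C < min \<delta> \<eta>" using t C(1) by (simp add: T_def pos_less_divide_eq)
      finally show ?thesis using * by blast
    qed
    \<comment> \<open>The second difference is the increment of \<open>g\<close> from 0 to
      \<open>t\<close>. The mean value theorem turns it into a difference of first derivatives in
      direction \<open>u\<close>, to which the differentiability at the single point
      \<open>x\<close> applies.\<close>
    define g where "g s = f (x + s *\<^sub>R u + t *\<^sub>R v) - f (x + s *\<^sub>R u)" for s
    define g' where "g' s = f' (x + s *\<^sub>R u + t *\<^sub>R v) u - f' (x + s *\<^sub>R u) u" for s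
    have Dg: "(g has_real_derivative g' s) (at s)" if "0 \<le> s" "s \<le> t" for s
    proof -
      have *: "((\<lambda>s. f (x + s *\<^sub>R u + r *\<^sub>R v)) has_real_derivative f' (x + s *\<^sub>R u + r *\<^sub>R v) u) (at s)"
        if "0 \<le> r" "r \<le> t" for r
      proof -
        have "x + s *\<^sub>R u + r *\<^sub>R v \<in> S"
          using small[of s r] that \<open>0 \<le> s\<close> \<open>s \<le> t\<close> by (intro \<eta>(2)) (simp add: algebra_simps)
        then have D: "(f has_derivative f' (x + s *\<^sub>R u + r *\<^sub>R v)) (at (x + s *\<^sub>R u + r *\<^sub>R v))" by (rule f)
        have "((\<lambda>s. x + s *\<^sub>R u + r *\<^sub>R v) has_derivative (\<lambda>h. h *\<^sub>R u)) (at s)"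
          by (auto intro!: derivative_eq_intros)
        from has_derivative_compose[OF this D]
        have "((\<lambda>s. f (x + s *\<^sub>R u + r *\<^sub>R v)) has_derivative (\<lambda>h. f' (x + s *\<^sub>R u + r *\<^sub>R v) (h *\<^sub>R u))) (at s)" .
        then show ?thesis
          using linear_cmul[OF has_derivative_linear[OF D]]
          by (simp add: has_field_derivative_def mult.commute[of _ "f' _ u"] fun_eq_iff mult_commute_abs)
      qed
      show ?thesis unfolding g_def g'_def using *[of t] *[of 0] t by (auto intro: DERIV_diff)
    qed
    then obtain s where s: "0 < s" "s < t" "g t - g 0 = t * g' s"
      using MVT2[OF t(1), of g g'] by auto
    define z1 where "z1 = s *\<^sub>R u + t *\<^sub>R v"
    define z0 where "z0 = s *\<^sub>R u + 0 *\<^sub>R v"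
    have z: "norm z1 < \<delta>" "norm z0 < \<delta>" "norm z1 \<le> t * C" "norm z0 \<le> t * C"
      unfolding z0_def z1_def using small[of s t] small[of s 0] s t by auto
    have "\<bar>f' (x + z1) u - f' x u - f'' z1\<bar> \<le> \<epsilon> * norm z1" "\<bar>f' (x + z0) u - f' x u - f'' z0\<bar> \<le> \<epsilon> * norm z0"
      using \<delta>(2)[of "x + z1"] \<delta>(2)[of "x + z0"] z by auto
    moreover have "\<epsilon> * norm z1 \<le> \<epsilon> * (t * C)" "\<epsilon> * norm z0 \<le> \<epsilon> * (t * C)"
      using z \<open>\<epsilon> > 0\<close> by auto
    moreover have "f'' z1 - f'' z0 = t * f'' v"
      by (simp add: z0_def z1_def f''.add f''.scaleR)
    moreover have "g' s = f' (x + z1) u - f' (x + z0) u"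
      by (simp add: g'_def z0_def z1_def add.assoc)
    moreover have "\<epsilon> * (t * C) = t * (e / 3)" using C(1) by (simp add: \<epsilon>_def)
    ultimately have *: "\<bar>g' s - t * f'' v\<bar> \<le> 2 * (t * (e / 3))" by linarith
    have "(f (x + t *\<^sub>R u + t *\<^sub>R v) - f (x + t *\<^sub>R u) - f (x + t *\<^sub>R v) + f x) / t\<^sup>2 - f'' v
      = (g' s - t * f'' v) / t"
      using s(3) t(1) by (simp add: g_def field_simps power2_eq_square)
    moreover have "\<bar>(g' s - t * f'' v) / t\<bar> \<le> 2 * (e / 3)"
      using * t(1) by (simp add: abs_divide divide_le_eq mult.commute mult.left_commute)
    ultimately have "dist ((f (x + t *\<^sub>R u + t *\<^sub>R v) - f (x + t *\<^sub>R u) - f (x + t *\<^sub>R v) + f x) / t\<^sup>2) (f'' v) \<le> 2 * (e / 3)"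
      by (simp only: dist_real_def)
    then show ?thesis using \<open>e > 0\<close> by linarith
  qed
  then show "\<forall>\<^sub>F t in at_right 0. dist ((f (x + t *\<^sub>R u + t *\<^sub>R v) - f (x + t *\<^sub>R u) - f (x + t *\<^sub>R v) + f x) / t\<^sup>2) (f'' v) < e"
    using \<open>T > 0\<close> eventually_at_right by blast
qed

lemma second_derivative_symmetric:
  fixes f :: "'a::real_normed_vector \<Rightarrow> real"
  assumes "open S" "x \<in> S"
    and "\<And>z. z \<in> S \<Longrightarrow> (f has_derivative f' z) (at z)"
    and "((\<lambda>z. f' z u) has_derivative fu) (at x)"
    and "((\<lambda>z. f' z v) has_derivative fv) (at x)"
  shows "fu v = fv u"
proof -
  have "((\<lambda>t. (f (x + t *\<^sub>R u + t *\<^sub>R v) - f (x + t *\<^sub>R u) - f (x + t *\<^sub>R v) + f x) / t\<^sup>2)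
    \<longlongrightarrow> fv u) (at_right 0)"
    using second_difference_limit[OF assms(1-3) _, of v fv u] assms(5) by (simp add: algebra_simps)
  then show ?thesis
    using second_difference_limit[OF assms(1-3) _, of u fu v] assms(4)
    by (intro tendsto_unique[OF trivial_limit_at_right_real]) auto
qed

section \<open>Pointwise data of the metric and the 1-form\<close>

text \<open>Orthogonal vectors of equal length have orthogonal sum and difference; the vanishing of
  \<open>g\<close> on that pair says that \<open>g\<close> takes equal values on the two vectors.
  Hence the ratio of \<open>g\<close> to \<open>ip\<close> on the diagonal is one constant.\<close>

lemma form_proportional_to_metric:
  fixes g ip :: "'v::real_vector \<Rightarrow> 'v \<Rightarrow> real"
  assumes ip: "bilinear ip" "\<And>u v. ip u v = ip v u" "\<And>v. v \<noteq> 0 \<Longrightarrow> ip v v > 0"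
    and g: "bilinear g"
    and W: "subspace W"
    and orth: "\<And>u v. u \<in> W \<Longrightarrow> v \<in> W \<Longrightarrow> ip u v = 0 \<Longrightarrow> g u v = 0"
  shows "\<exists>\<tau>. \<forall>w\<in>W. g w w = \<tau> * ip w w"
proof (cases "\<exists>z\<in>W. z \<noteq> 0")
  case True
  then obtain z where z: "z \<in> W" "z \<noteq> 0" by blast
  then have zz: "ip z z > 0" by (simp add: ip)
  note bil = bilinear_ladd[OF ip(1)] bilinear_radd[OF ip(1)] bilinear_lsub[OF ip(1)] bilinear_rsub[OF ip(1)]
    bilinear_lmul[OF ip(1)] bilinear_rmul[OF ip(1)]
    bilinear_ladd[OF g] bilinear_radd[OF g] bilinear_lsub[OF g] bilinear_rsub[OF g]
    bilinear_lmul[OF g] bilinear_rmul[OF g]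
  have u: "g u u * ip z z = g z z * ip u u" if "u \<in> W" "ip z u = 0" for u
  proof (cases "u = 0")
    case True
    then show ?thesis by (simp add: bilinear_lzero[OF g] bilinear_lzero[OF ip(1)])
  next
    case False
    then have uu: "ip u u > 0" by (simp add: ip)
    define k where "k = sqrt (ip z z / ip u u)"
    have k: "k\<^sup>2 * ip u u = ip z z" using zz uu by (simp add: k_def)
    have gzu: "g z u = 0" "g u z = 0" using orth z that ip(2) by metis+
    have "g (z + k *\<^sub>R u) (z - k *\<^sub>R u) = 0"
    proof (rule orth)
      show "z + k *\<^sub>R u \<in> W" "z - k *\<^sub>R u \<in> W"
        using z that W by (simp_all add: subspace_add subspace_diff subspace_scale)
      show "ip (z + k *\<^sub>R u) (z - k *\<^sub>R u) = 0"
        using k that(2) by (simp add: bil ip(2)[of u z] algebra_simps power2_eq_square)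
    qed
    then have "g z z = k\<^sup>2 * g u u" by (simp add: bil gzu algebra_simps power2_eq_square)
    then show ?thesis using k by (simp add: algebra_simps)
  qed
  have "g w w = g z z / ip z z * ip w w" if "w \<in> W" for w
  proof -
    define l where "l = ip z w / ip z z"
    define u where "u = w - l *\<^sub>R z"
    have uW: "u \<in> W" using that z W by (simp add: u_def subspace_diff subspace_scale)
    have zu: "ip z u = 0" using zz by (simp add: u_def l_def bil)
    have gzu: "g z u = 0" "g u z = 0" using orth z zu uW ip(2) by metis+
    have w: "w = u + l *\<^sub>R z" by (simp add: u_def)
    have "g w w = g u u + l\<^sup>2 * g z z" "ip w w = ip u u + l\<^sup>2 * ip z z"
      unfolding w using gzu zu ip(2)[of u z] by (simp_all add: bil power2_eq_square)
    then show ?thesis using u[OF uW zu] zz by (simp add: field_simps)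
  qed
  then show ?thesis by blast
qed (use bilinear_lzero[OF g] bilinear_lzero[OF ip(1)] in fastforce)

text \<open>The values at one point: \<open>ip\<close> is the metric, \<open>e\<close> the dual vector of the 1-form,
  \<open>dA u v w\<close> and \<open>dB u v\<close> are the derivatives of the metric and of the 1-form in the direction
  \<open>u\<close>, and \<open>Gam\<close> is the Levi-Civita connection.\<close>

locale metric_and_form_jet =
  fixes ip :: "'v::euclidean_space \<Rightarrow> 'v \<Rightarrow> real" and e :: 'v
    and dA :: "'v \<Rightarrow> 'v \<Rightarrow> 'v \<Rightarrow> real" and dB :: "'v \<Rightarrow> 'v \<Rightarrow> real"
    and Gam :: "'v \<Rightarrow> 'v \<Rightarrow> 'v"
  assumes ip_bilinear: "bilinear ip" and ip_sym: "ip u v = ip v u"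
    and ip_pos: "v \<noteq> 0 \<Longrightarrow> ip v v > 0"
    and e_nonzero: "e \<noteq> 0"
    and dA_linear: "linear (\<lambda>u. dA u v w)" and dA_bilinear: "bilinear (dA u)"
    and dA_sym: "dA u v w = dA u w v"
    and dB_bilinear: "bilinear dB"
    and Gam_bilinear: "bilinear Gam"
    and Gam: "2 * ip (Gam u v) w = dA u v w + dA v u w - dA w u v"
begin

lemmas ip_simps =
  bilinear_ladd[OF ip_bilinear] bilinear_radd[OF ip_bilinear]
  bilinear_lsub[OF ip_bilinear] bilinear_rsub[OF ip_bilinear]
  bilinear_lmul[OF ip_bilinear] bilinear_rmul[OF ip_bilinear]
  bilinear_lneg[OF ip_bilinear] bilinear_rneg[OF ip_bilinear]
  bilinear_lzero[OF ip_bilinear] bilinear_rzero[OF ip_bilinear]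

lemmas dB_simps =
  bilinear_ladd[OF dB_bilinear] bilinear_radd[OF dB_bilinear]
  bilinear_lsub[OF dB_bilinear] bilinear_rsub[OF dB_bilinear]
  bilinear_lmul[OF dB_bilinear] bilinear_rmul[OF dB_bilinear]
  bilinear_lneg[OF dB_bilinear] bilinear_rneg[OF dB_bilinear]

lemmas dA_simps =
  linear_add[OF dA_linear] linear_diff[OF dA_linear] linear_cmul[OF dA_linear] linear_neg[OF dA_linear]
  bilinear_ladd[OF dA_bilinear] bilinear_radd[OF dA_bilinear]
  bilinear_lsub[OF dA_bilinear] bilinear_rsub[OF dA_bilinear]
  bilinear_lmul[OF dA_bilinear] bilinear_rmul[OF dA_bilinear]
  bilinear_lneg[OF dA_bilinear] bilinear_rneg[OF dA_bilinear]

definition "N = ip e e"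
definition "al y = sqrt (ip y y)"

text \<open>The symmetrised covariant derivative of the 1-form, with the connection terms replaced
  by metric derivatives through the Koszul identity \<open>Gam\<close>. In \<open>s\<close> they
  cancel because the connection is symmetric.\<close>

definition "r u v = (dB u v + dB v u - dA u v e - dA v u e + dA e u v) / 2"
definition "s u v = (dB v u - dB u v) / 2"
text \<open>The differential of \<open>b^2\<close> in direction \<open>u\<close>; the minus sign is
  that of the derivative of an inverse matrix.\<close>

definition "dN u = 2 * dB u e - dA u e e"

lemma N_pos: "N > 0" by (simp add: N_def e_nonzero ip_pos)

definition "nb = sqrt N"

lemma nb_pos: "nb > 0" by (simp add: nb_def N_pos)

lemma N_eq: "N = nb * nb" using N_pos by (simp add: nb_def)

lemma al_pos: "y \<noteq> 0 \<Longrightarrow> al y > 0" by (simp add: al_def ip_pos)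

lemma ip_nonneg: "ip y y \<ge> 0" by (metis ip_pos ip_simps(9) less_imp_le order_refl)

lemma al_square: "(al y)\<^sup>2 = ip y y" by (simp add: al_def ip_nonneg)

lemma s_e_e: "s e e = 0" by (simp add: s_def)

lemma s_anti: "s u v = - s v u" by (simp add: s_def field_simps)

lemma r_sym: "r u v = r v u" by (simp add: r_def dA_sym[of e])

lemma s_bilinear: "bilinear s"
  unfolding bilinear_def s_def by (auto intro!: linearI simp: dB_simps field_simps)

lemma r_bilinear: "bilinear r"
  unfolding bilinear_def r_def by (auto intro!: linearI simp: dB_simps dA_simps field_simps)

lemmas rs_simps =
  bilinear_ladd[OF r_bilinear] bilinear_radd[OF r_bilinear]
  bilinear_lsub[OF r_bilinear] bilinear_rsub[OF r_bilinear]
  bilinear_lmul[OF r_bilinear] bilinear_rmul[OF r_bilinear]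
  bilinear_lneg[OF r_bilinear] bilinear_rneg[OF r_bilinear]
  bilinear_ladd[OF s_bilinear] bilinear_radd[OF s_bilinear]
  bilinear_lsub[OF s_bilinear] bilinear_rsub[OF s_bilinear]
  bilinear_lmul[OF s_bilinear] bilinear_rmul[OF s_bilinear]
  bilinear_lneg[OF s_bilinear] bilinear_rneg[OF s_bilinear]

lemma dN_eq: "dN u = 2 * (r e u + s e u)"
  by (simp add: dN_def r_def s_def field_simps dA_sym[of e u e])

text \<open>The derivatives of \<open>F\<close> with respect to \<open>\<alpha>\<^sup>2\<close>, \<open>b\<^sup>2\<close> and \<open>\<beta>\<close> are \<open>p\<close>, \<open>q\<close> and \<open>m\<close>; a final
  \<open>d\<close> marks the derivative at \<open>y\<close> in the direction \<open>w\<close>.\<close>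

definition "sg y = ip e y / al y"
definition "sgd y w = ip e w / al y - ip e y * ip y w / al y ^ 3"
definition "p y = (N - (sg y)\<^sup>2) / (2 * al y)"
definition "pd y w = - sg y * sgd y w / al y - (N - (sg y)\<^sup>2) * ip y w / (2 * al y ^ 3)"
definition "q y = al y + ip e y / nb"
definition "qd y w = ip y w / al y + ip e w / nb"
definition "m y = 2 * (nb + sg y)"
definition "md y w = 2 * sgd y w"

definition "Fn y = (nb * al y + ip e y)\<^sup>2 / al y"
definition "F1 y v = 2 * p y * ip y v + m y * ip e v"
definition "F2 y v w = 2 * pd y w * ip y v + 2 * p y * ip v w + md y w * ip e v"

definition "X y u = p y * dA u y y + q y * dN u + m y * dB u y"
definition "Xd y u w = pd y w * dA u y y + 2 * p y * dA u y w + qd y w * dN u + md y w * dB u y + m y * dB u w"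

text \<open>The \<open>w\<close>-component of the Euler-Lagrange equation of \<open>F\<close> for a spray which deviates from that of \<open>\<alpha>\<close>
  by \<open>h\<close>, with the terms in the connection of \<open>\<alpha>\<close> already cancelled.\<close>

definition "EL y h w \<longleftrightarrow>
  qd y w * dN y - q y * dN w + md y w * r y y + 2 * m y * s w y = 2 * F2 y h w"

definition "regular y \<longleftrightarrow> y \<noteq> 0 \<and> nb * al y + ip e y \<noteq> 0 \<and> nb * al y - ip e y \<noteq> 0"

lemma cauchy_schwarz: "(ip y u)\<^sup>2 \<le> ip y y * ip u u"
proof (cases "y = 0")
  case False
  have "0 \<le> ip (ip y y *\<^sub>R u - ip y u *\<^sub>R y) (ip y y *\<^sub>R u - ip y u *\<^sub>R y)" by (rule ip_nonneg)
  also have "\<dots> = ip y y * (ip y y * ip u u - (ip y u)\<^sup>2)"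
    by (simp add: ip_simps ip_sym[of u y] algebra_simps power2_eq_square)
  finally show ?thesis using ip_pos[OF False] by (simp add: zero_le_mult_iff)
qed (simp add: ip_simps)

lemma cauchy_schwarz_eq:
  assumes "(ip y u)\<^sup>2 = ip y y * ip u u"
  shows "ip y y *\<^sub>R u = ip y u *\<^sub>R y"
proof (rule ccontr)
  assume "ip y y *\<^sub>R u \<noteq> ip y u *\<^sub>R y"
  then have "0 < ip (ip y y *\<^sub>R u - ip y u *\<^sub>R y) (ip y y *\<^sub>R u - ip y u *\<^sub>R y)"
    by (intro ip_pos) simp
  also have "\<dots> = ip y y * (ip y y * ip u u - (ip y u)\<^sup>2)"
    by (simp add: ip_simps ip_sym[of u y] algebra_simps power2_eq_square)
  finally show False using assms by simp
qed

text \<open>The two factors that define \<open>regular\<close> multiply to the Gram determinant of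
  \<open>e\<close> and \<open>y\<close>, which is nonnegative by Cauchy-Schwarz.\<close>

lemma regular_gap:
  assumes "regular y"
  shows "N * ip y y - (ip e y)\<^sup>2 > 0"
proof -
  have "(nb * al y + ip e y) * (nb * al y - ip e y) = N * ip y y - (ip e y)\<^sup>2"
    by (simp add: N_eq algebra_simps power2_eq_square flip: al_square)
  then have "N * ip y y - (ip e y)\<^sup>2 \<noteq> 0" using assms by (metis mult_eq_0_iff regular_def)
  then show ?thesis using cauchy_schwarz[of e y] by (simp add: N_def)
qed

lemma gap_regular:
  assumes "N * ip y y - (ip e y)\<^sup>2 > 0"
  shows "regular y"
proof -
  have "(nb * al y + ip e y) * (nb * al y - ip e y) = N * ip y y - (ip e y)\<^sup>2"
    by (simp add: N_eq algebra_simps power2_eq_square flip: al_square)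
  then have "nb * al y + ip e y \<noteq> 0" "nb * al y - ip e y \<noteq> 0" using assms by auto
  moreover have "y \<noteq> 0" using assms by (auto simp: ip_simps)
  ultimately show ?thesis by (simp add: regular_def)
qed

lemma gap_orthogonal:
  "ip e z = 0 \<Longrightarrow> N * ip (z + t *\<^sub>R e) (z + t *\<^sub>R e) - (ip e (z + t *\<^sub>R e))\<^sup>2 = N * ip z z"
  by (simp add: ip_simps ip_sym[of z e] N_def power2_eq_square algebra_simps)

text \<open>The Gram determinant does not see the component along \<open>e\<close>, so the whole
  line \<open>z + t e\<close> consists of regular vectors. This is what permits comparing
  coefficients in \<open>t\<close>.\<close>

lemma regular_orthogonal: "ip e z = 0 \<Longrightarrow> z \<noteq> 0 \<Longrightarrow> regular (z + t *\<^sub>R e)"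
  by (rule gap_regular) (simp add: gap_orthogonal N_pos ip_pos)

lemma orthogonal_split:
  obtains z where "ip e z = 0" "y = z + (ip e y / N) *\<^sub>R e"
proof
  show "ip e (y - (ip e y / N) *\<^sub>R e) = 0" using N_pos by (simp add: ip_simps N_def)
qed simp

lemma regular_or_parallel:
  obtains "regular y" | t where "y = t *\<^sub>R e"
proof -
  obtain z where z: "ip e z = 0" "y = z + (ip e y / N) *\<^sub>R e" by (rule orthogonal_split)
  show thesis
  proof (cases "z = 0")
    case True
    then show ?thesis using that(2) z(2) by simp
  next
    case False
    then show ?thesis using that(1) z regular_orthogonal by metis
  qed
qed

lemma ip_al: "ip y y = al y * al y" by (metis al_square power2_eq_square)

text \<open>Euler's relation: the first y-derivatives of F have degree zero. The next two lemmas are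
  Euler's relations for \<open>Fn\<close> and for \<open>X\<close>, both of degree one in
  \<open>y\<close>.\<close>

lemma F2_y: "y \<noteq> 0 \<Longrightarrow> F2 y y w = 0"
  using al_pos[of y]
  by (simp add: F2_def pd_def p_def md_def sgd_def sg_def N_eq ip_al field_simps power2_eq_square power3_eq_cube)

lemma F1_y: "y \<noteq> 0 \<Longrightarrow> F1 y y = Fn y"
  using al_pos[of y] nb_pos
  by (simp add: F1_def p_def m_def sg_def Fn_def N_eq ip_al field_simps power2_eq_square power3_eq_cube)

lemma Xd_y: "y \<noteq> 0 \<Longrightarrow> Xd y u y = X y u"
  using al_pos[of y] nb_pos
  by (simp add: Xd_def X_def p_def pd_def qd_def q_def md_def m_def sgd_def sg_def N_eq ip_al
      field_simps power2_eq_square power3_eq_cube)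

lemma Fn_pos: "regular y \<Longrightarrow> Fn y > 0"
  using al_pos[of y] by (simp add: Fn_def regular_def)

lemma F2_sym: "F2 y v w = F2 y w v"
  by (simp add: F2_def pd_def p_def md_def sgd_def sg_def ip_sym[of v w] diff_divide_distrib algebra_simps power3_eq_cube)

text \<open>Completing the square: the Hessian of F becomes a combination of a Gram determinant and
  a square. At regular \<open>y\<close>, where \<open>(sg y)\<^sup>2 < N\<close>, it is therefore
  positive semidefinite with kernel spanned by \<open>y\<close>.\<close>

lemma F2_diag:
  assumes "y \<noteq> 0"
  shows "al y ^ 3 * F2 y u u =
    (N - (sg y)\<^sup>2) * (ip y y * ip u u - (ip y u)\<^sup>2) + 2 * (al y * ip e u - sg y * ip y u)\<^sup>2"
proof -
  have a: "al y > 0" "ip y y = (al y)\<^sup>2" "ip e y = sg y * al y"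
    using al_pos[OF assms] al_square[of y] by (auto simp: sg_def)
  show ?thesis
    using a(1) by (simp add: F2_def pd_def p_def md_def sgd_def a(2,3) field_simps power2_eq_square power3_eq_cube)
qed

text \<open>The left side is the fundamental tensor on the diagonal. Its Hessian term vanishes only
  along \<open>y\<close>, and there the square of \<open>F1 y y = Fn y > 0\<close> takes
  over.\<close>

lemma fundamental_form_definite:
  assumes "regular y" "u \<noteq> 0"
  shows "Fn y * F2 y u u + (F1 y u)\<^sup>2 > 0"
proof (rule ccontr)
  assume *: "\<not> ?thesis"
  have y: "y \<noteq> 0" "al y > 0" using assms al_pos by (auto simp: regular_def)
  have "(al y)\<^sup>2 * (N - (sg y)\<^sup>2) = N * ip y y - (ip e y)\<^sup>2"
    using y(2) by (simp add: sg_def field_simps power2_eq_square flip: al_square)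
  then have k: "N - (sg y)\<^sup>2 > 0"
    using regular_gap[OF assms(1)] y(2) by (metis zero_less_mult_pos zero_less_power)
  have cs: "ip y y * ip u u - (ip y u)\<^sup>2 \<ge> 0" using cauchy_schwarz by simp
  then have ge: "al y ^ 3 * F2 y u u \<ge> (N - (sg y)\<^sup>2) * (ip y y * ip u u - (ip y u)\<^sup>2)"
    by (simp add: F2_diag[OF y(1)])
  moreover have "(N - (sg y)\<^sup>2) * (ip y y * ip u u - (ip y u)\<^sup>2) \<ge> 0" using k cs by simp
  ultimately have F2: "F2 y u u \<ge> 0" using y(2)
    by (meson mult_pos_neg not_less order_trans zero_less_power)
  then have "Fn y * F2 y u u \<ge> 0" using Fn_pos[OF assms(1)] by simp
  moreover have "(F1 y u)\<^sup>2 \<ge> 0" by simp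
  ultimately have "Fn y * F2 y u u = 0" "(F1 y u)\<^sup>2 = 0" using * by linarith+
  then have 0: "Fn y * F2 y u u = 0" "F1 y u = 0" by simp_all
  then have "F2 y u u = 0" using Fn_pos[OF assms(1)] by simp
  then have "(N - (sg y)\<^sup>2) * (ip y y * ip u u - (ip y u)\<^sup>2) \<le> 0" using ge by simp
  then have "ip y y * ip u u - (ip y u)\<^sup>2 = 0" using k cs by (simp add: mult_le_0_iff)
  then have "ip y y *\<^sub>R u = ip y u *\<^sub>R y" by (intro cauchy_schwarz_eq) simp
  moreover have "ip y y > 0" using ip_pos[OF y(1)] .
  ultimately have u: "u = (ip y u / ip y y) *\<^sub>R y"
    by (metis divide_inverse_commute less_irrefl left_inverse scaleR_one scaleR_scaleR)
  have "F1 y (k *\<^sub>R y) = k * F1 y y" for k by (simp add: F1_def ip_simps algebra_simps)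
  then have "F1 y u = (ip y u / ip y y) * Fn y"
    using F1_y[OF y(1)] u by metis
  then have "ip y u / ip y y = 0" using 0 Fn_pos[OF assms(1)] by simp
  then show False using u assms(2) by (metis scaleR_zero_left)
qed

end

section \<open>The Douglas equation at a point\<close>

context metric_and_form_jet
begin

text \<open>Assumption \<open>G\<close> is the defining equation of the spray with the derivatives
  of F^2 expanded. Testing it with \<open>w = y\<close> gives \<open>2 * F1 y G = X y y\<close>; the
  terms with \<open>F1 y w\<close> then cancel, and after division by \<open>Fn y\<close> the
  Euler-Lagrange equation of F remains. In the converse the coefficient of \<open>y\<close> is
  chosen so that this relation holds, and nondegeneracy makes the solution unique.\<close>

lemma spray_of_F:
  assumes y: "y \<noteq> 0" and F: "Fn y > 0"
    and nondeg: "\<And>u. u \<noteq> 0 \<Longrightarrow> Fn y * F2 y u u + (F1 y u)\<^sup>2 \<noteq> 0"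
    and G: "\<And>w. 4 * (Fn y * F2 y G w + F1 y G * F1 y w)
          = 2 * (F1 y w * X y y + Fn y * Xd y y w) - 2 * Fn y * X y w"
  shows "(\<exists>P. G = Q + P *\<^sub>R y) \<longleftrightarrow> (\<forall>w. Xd y y w - X y w = 2 * F2 y Q w)"
    and "(\<forall>w. Xd y y w - X y w = 2 * F2 y Q w) \<Longrightarrow> G = Q + ((X y y / 2 - F1 y Q) / Fn y) *\<^sub>R y"
proof -
  have lin: "F2 y (u + k *\<^sub>R v) w = F2 y u w + k * F2 y v w" "F1 y (u + k *\<^sub>R v) = F1 y u + k * F1 y v" for u v w k
    by (simp_all add: F2_def F1_def ip_simps algebra_simps)
  note yy = F2_y[OF y] F1_y[OF y] Xd_y[OF y]
  show *: "G = Q + ((X y y / 2 - F1 y Q) / Fn y) *\<^sub>R y"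
    if "\<forall>w. Xd y y w - X y w = 2 * F2 y Q w"
  proof -
    define Z where "Z = Q + ((X y y / 2 - F1 y Q) / Fn y) *\<^sub>R y"
    have "4 * (Fn y * F2 y Z w + F1 y Z * F1 y w)
          = 2 * (F1 y w * X y y + Fn y * Xd y y w) - 2 * Fn y * X y w" for w
    proof -
      have "F2 y Z w = F2 y Q w" "F1 y Z = X y y / 2"
        using F unfolding Z_def by (simp_all add: lin yy)
      moreover have "Xd y y w = X y w + 2 * F2 y Q w" using that by (simp add: algebra_simps)
      ultimately show ?thesis by (simp add: algebra_simps)
    qed
    then have eq: "4 * (Fn y * F2 y Z w + F1 y Z * F1 y w) = 4 * (Fn y * F2 y G w + F1 y G * F1 y w)" for w
      using G by simp
    have "Fn y * F2 y (G + (-1) *\<^sub>R Z) w + F1 y (G + (-1) *\<^sub>R Z) * F1 y w = 0" for w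
      using eq[of w] unfolding lin by (simp add: algebra_simps)
    then have "G + (-1) *\<^sub>R Z = 0" using nondeg[of "G + (-1) *\<^sub>R Z"] by (metis power2_eq_square)
    then show "G = Z" by simp
  qed
  show "(\<exists>P. G = Q + P *\<^sub>R y) \<longleftrightarrow> (\<forall>w. Xd y y w - X y w = 2 * F2 y Q w)"
  proof
    assume "\<exists>P. G = Q + P *\<^sub>R y"
    then obtain P where "G = Q + P *\<^sub>R y" by blast
    then have GQ: "F2 y G w = F2 y Q w" for w by (simp add: lin yy)
    have "2 * F1 y G = X y y"
    proof -
      have "4 * (Fn y * F2 y G y + F1 y G * F1 y y) = 2 * (F1 y y * X y y)"
        using G[of y] by (simp add: yy)
      moreover have "F2 y G y = 0" using F2_sym yy(1) by metis
      ultimately show ?thesis using F by (simp add: yy)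
    qed
    from this[symmetric]
    have "2 * (Fn y * (2 * F2 y Q w)) = 2 * (Fn y * (Xd y y w - X y w))" for w
      using G[of w] by (simp add: GQ algebra_simps)
    then have "Fn y * (2 * F2 y Q w) = Fn y * (Xd y y w - X y w)" for w
      by (metis mult_cancel_left zero_neq_numeral)
    then show "\<forall>w. Xd y y w - X y w = 2 * F2 y Q w" using F by simp
  qed (use * in blast)
qed

lemma ip_Gam: "ip w (Gam u v) = (dA u v w + dA v u w - dA w u v) / 2"
  using Gam[of u v w] by (simp add: ip_sym)

text \<open>The derivatives of \<open>\<alpha>\<close> drop out: only the covariant derivatives of \<open>\<beta>\<close> are left.\<close>

lemma euler_lagrange_covariant:
  "Xd y y w - X y w - 2 * F2 y ((1/2) *\<^sub>R Gam y y) w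
    = qd y w * dN y - q y * dN w + md y w * r y y + 2 * m y * s w y"
  by (simp add: Xd_def X_def F2_def ip_simps ip_Gam ip_sym[of "Gam y y"] r_def s_def
      dA_sym[of _ y w] dA_sym[of _ y e] algebra_simps add_divide_distrib diff_divide_distrib)

lemma douglas_equation:
  "(\<forall>w. Xd y y w - X y w = 2 * F2 y Q w) \<longleftrightarrow> (\<forall>w. EL y (Q - (1/2) *\<^sub>R Gam y y) w)"
proof -
  have "F2 y (Q - (1/2) *\<^sub>R Gam y y) w = F2 y Q w - F2 y ((1/2) *\<^sub>R Gam y y) w" for w
    by (simp add: F2_def ip_simps algebra_simps)
  then show ?thesis
    unfolding EL_def euler_lagrange_covariant[symmetric] by (simp add: right_diff_distrib)
qed

text \<open>All ingredients except \<open>\<alpha>\<close> are polynomial in \<open>y\<close>, so comparing \<open>y\<close> with \<open>-y\<close> separates the part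
  of the equation that is odd in \<open>\<alpha>\<close> from the even one.\<close>

lemma EL_parity:
  assumes "y \<noteq> 0" "EL y h w" "EL (- y) h w"
  shows "ip e w * dN y - ip e y * dN w + 4 * N * s w y = 0"
    and "ip y w * dN y - ip y y * dN w + 2 * al y * sgd y w * r y y + 4 * ip e y * s w y
      = 2 * al y * F2 y h w"
proof -
  have a: "al (- y) = al y" "sg (- y) = - sg y" "sgd (- y) w = sgd y w"
    by (simp_all add: al_def sg_def sgd_def ip_simps)
  have f: "F2 (- y) h w = F2 y h w"
    by (simp add: F2_def pd_def p_def md_def a ip_simps algebra_simps)
  have dN: "dN (- y) = - dN y" by (simp add: dN_eq rs_simps)
  have 1: "qd y w * dN y - q y * dN w + md y w * r y y + 2 * m y * s w y = 2 * F2 y h w"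
    using assms(2) by (simp add: EL_def)
  have 2: "- (qd (- y) w * dN y) - q (- y) * dN w + md y w * r y y - 2 * m (- y) * s w y = 2 * F2 y h w"
    using assms(3) unfolding EL_def f dN by (simp add: rs_simps md_def a)
  have q: "qd y w = ip y w / al y + ip e w / nb" "qd (- y) w = - (ip y w / al y) + ip e w / nb"
    "q y = al y + ip e y / nb" "q (- y) = al y - ip e y / nb" "m y = 2 * nb + 2 * sg y"
    "m (- y) = 2 * nb - 2 * sg y"
    by (simp_all add: qd_def q_def m_def a ip_simps)
  have al: "al y > 0" using assms(1) by (rule al_pos)
  \<comment> \<open>The difference of the equations at \<open>y\<close> and \<open>- y\<close>: the
    terms with \<open>F2\<close> and \<open>r\<close> are unchanged by the reflection and drop out.
    The sum of the two equations is used further below.\<close>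
  have "2 * (ip e w / nb) * dN y - 2 * (ip e y / nb) * dN w + 8 * nb * s w y = 0"
    using 1 2 unfolding q by (simp add: algebra_simps, linarith)
  then show "ip e w * dN y - ip e y * dN w + 4 * N * s w y = 0"
    using nb_pos by (simp add: field_simps N_eq)
  have "2 * (ip y w / al y) * dN y - 2 * al y * dN w + 2 * md y w * r y y + 8 * sg y * s w y = 4 * F2 y h w"
    using 1 2 unfolding q by (simp add: algebra_simps, linarith)
  moreover have "al y * (2 * (ip y w / al y) * dN y - 2 * al y * dN w + 2 * md y w * r y y + 8 * sg y * s w y)
    = 2 * (ip y w * dN y - ip y y * dN w + 2 * al y * sgd y w * r y y + 4 * (al y * sg y) * s w y)"
    using al by (simp add: md_def ip_al[of y] field_simps)
  moreover have "al y * sg y = ip e y" using al by (simp add: sg_def)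
  ultimately show "ip y w * dN y - ip y y * dN w + 2 * al y * sgd y w * r y y + 4 * ip e y * s w y
      = 2 * al y * F2 y h w"
    by simp
qed

text \<open>The odd equation with \<open>w = e\<close> yields \<open>dN\<close>; putting this back
  for general \<open>w\<close> yields \<open>s\<close>. It is available at regular vectors only, but
  on multiples of \<open>e\<close> both claims are identities because
  \<open>s e e = 0\<close>.\<close>

lemma EL_odd_consequences:
  assumes H: "\<forall>y w. regular y \<longrightarrow> EL y (H y) w" "\<forall>y. H (- y) = H y"
  shows "dN y = 2 * (ip e y * (r e e / N) - 2 * s e y)"
    and "s u v = (ip e u * s e v - ip e v * s e u) / N"
proof -
  have reg: "regular (- y)" if "regular y" for y
    using that by (auto simp: regular_def al_def ip_simps)
  have O: "ip e w * dN y - ip e y * dN w + 4 * N * s w y = 0" if "regular y" for y w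
    using EL_parity(1)[of y "H y" w] H reg[OF that] that unfolding regular_def by metis
  have Ne: "ip e e = N" "dN e = 2 * r e e" by (simp_all add: N_def dN_eq s_e_e)
  have 1: "dN y = 2 * (ip e y * (r e e / N) - 2 * s e y)" for y
  proof (cases rule: regular_or_parallel[of y])
    case 1
    then show ?thesis using O[OF 1, of e] N_pos by (simp add: Ne field_simps)
  next
    case (2 t)
    then show ?thesis using N_pos by (simp add: dN_eq rs_simps ip_simps s_e_e Ne)
  qed
  show "dN y = 2 * (ip e y * (r e e / N) - 2 * s e y)" by (rule 1)
  show "s u v = (ip e u * s e v - ip e v * s e u) / N"
  proof (cases rule: regular_or_parallel[of v])
    case r: 1
    have "4 * (N * s u v) = 4 * (ip e u * s e v - ip e v * s e u)"
      using O[OF r, of u] unfolding 1 by (simp add: algebra_simps)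
    then show ?thesis using N_pos by (simp add: field_simps)
  next
    case (2 t)
    then show ?thesis using N_pos s_anti[of u e] by (simp add: rs_simps ip_simps s_e_e Ne)
  qed
qed

text \<open>The first claim tests the even equation with \<open>w = e\<close>, the second with
  \<open>w = v\<close>; in the latter case the derivatives of \<open>sg\<close> and \<open>p\<close>
  in direction \<open>v\<close> vanish. Both times the positive factor \<open>k\<close> can be
  divided out.\<close>

lemma EL_even_consequences:
  assumes H: "\<forall>y w. regular y \<longrightarrow> EL y (H y) w" "\<forall>y. H (- y) = H y" and y: "regular y"
  shows "ip y y * (r y y - r e e / N * ip y y) = 3 * (ip y y * ip e (H y) - ip e y * ip y (H y))"
    and "ip e v = 0 \<Longrightarrow> ip y v = 0 \<Longrightarrow> N * ip v (H y) = 2 * ip y y * s e v"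
proof -
  note odd = EL_odd_consequences[OF H]
  have "regular (- y)"
    using y by (auto simp: regular_def al_def ip_simps)
  have y0: "y \<noteq> 0" using y by (simp add: regular_def)
  have E: "ip y w * dN y - ip y y * dN w + 2 * al y * sgd y w * r y y + 4 * ip e y * s w y
      = 2 * al y * F2 y (H y) w" for w
    using EL_parity(2)[OF y0] H y \<open>regular (- y)\<close> by metis
  have al: "al y > 0" using y0 by (rule al_pos)
  define k where "k = N * ip y y - (ip e y)\<^sup>2"
  have k: "k > 0" using regular_gap[OF y] by (simp add: k_def)
  have ee: "ip e e = N" by (simp add: N_def)
  have sge: "al y ^ 3 * sgd y e = k" using al by (simp add: sgd_def k_def ip_al[of y] ee ip_sym[of y e] field_simps power2_eq_square power3_eq_cube)
  have gap: "N - (sg y)\<^sup>2 = k / al y ^ 2"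
    using al by (simp add: k_def sg_def ip_al field_simps eval_nat_numeral)
  have p: "p y = k / (2 * al y ^ 3)"
    unfolding p_def gap using al by (simp add: field_simps eval_nat_numeral)
  have S: "s e y = - s y e" "s e v = - s v e" by (rule s_anti)+
  show "ip y y * (r y y - r e e / N * ip y y) = 3 * (ip y y * ip e (H y) - ip e y * ip y (H y))"
  proof -
    have s: "sgd y e = k / al y ^ 3" using al sge by (simp add: field_simps)
    have pd: "pd y e = - 3 * k * ip e y / (2 * al y ^ 5)"
      unfolding pd_def gap s using al by (simp add: sg_def ip_sym[of y e] field_simps eval_nat_numeral)
    define W where "W = ip y y * (r y y - r e e / N * ip y y)"
    define Z where "Z = ip y y * ip e (H y) - ip e y * ip y (H y)"
    have "al y ^ 5 * F2 y (H y) e = 3 * k * Z"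
      unfolding F2_def md_def p s pd Z_def ip_al[of y] ip_sym[of "H y" e]
      using al by (simp add: field_simps eval_nat_numeral)
    moreover have "al y ^ 4 * (2 * al y * F2 y (H y) e) = 2 * (al y ^ 5 * F2 y (H y) e)"
      by (simp add: eval_nat_numeral)
    moreover have "al y ^ 4 * (2 * al y * F2 y (H y) e) = 2 * k * W"
    proof -
      have "N * (2 * al y * F2 y (H y) e) = 2 * (N * (k / al y ^ 2) * r y y) - 2 * (N * ip y y - (ip e y)\<^sup>2) * r e e"
        unfolding E[of e, symmetric] odd(1)[of y] odd(1)[of e]
        using al N_pos by (simp add: s s_e_e ee ip_sym[of y e] field_simps eval_nat_numeral)
      then have F2: "2 * al y * F2 y (H y) e = 2 * (k / al y ^ 2) * r y y - 2 * k * (r e e / N)"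
        using N_pos by (simp add: k_def field_simps)
      show ?thesis unfolding F2 W_def ip_al[of y] using al by (simp add: field_simps eval_nat_numeral)
    qed
    ultimately have "k * W = k * (3 * Z)" by simp
    then show ?thesis using k by (simp add: W_def Z_def)
  qed
  show "N * ip v (H y) = 2 * ip y y * s e v" if "ip e v = 0" "ip y v = 0"
  proof -
    have "sgd y v = 0" "pd y v = 0" using that by (simp_all add: sgd_def pd_def)
    then have "4 * ip y y * s e v + 4 * ip e y * s v y = 4 * al y * p y * ip v (H y)"
      using E[of v] odd(1)[of v] that by (simp add: F2_def md_def ip_sym[of _ v])
    moreover have "s v y = - ip e y * s e v / N" using odd(2)[of v y] that by simp
    moreover have "N * (4 * ip y y * s e v + 4 * ip e y * (- ip e y * s e v / N)) = 4 * k * s e v"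
      using N_pos by (simp add: k_def field_simps power2_eq_square)
    moreover have "ip y y * (4 * al y * p y * ip v (H y)) = 2 * k * ip v (H y)"
      using al by (simp add: p ip_al[of y] field_simps power3_eq_cube)
    ultimately have "k * (N * ip v (H y)) = k * (2 * ip y y * s e v)"
      by algebra
    then show ?thesis using k by simp
  qed
qed

lemma cubic_coeffs_eq_zero:
  fixes c0 c1 c2 c3 :: real
  assumes "\<And>t. c0 + c1 * t + c2 * t\<^sup>2 + c3 * t ^ 3 = 0"
  shows "c0 = 0" "c1 = 0" "c2 = 0" "c3 = 0"
  using assms[of 0] assms[of 1] assms[of "-1"] assms[of 2] by simp_all

theorem EL_imp_normal_form:
  assumes h: "bilinear h" and H: "\<And>y w. regular y \<Longrightarrow> EL y (h y y) w"
  obtains c d where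
    "\<And>u v. r u v = c * ip u v + d * ip e u * ip e v - 3 / N * (s e u * ip e v + s e v * ip e u)"
    "\<And>u v. s u v = 1 / N * (ip e u * s e v - ip e v * s e u)"
proof -
  note h_simps = bilinear_ladd[OF h] bilinear_radd[OF h] bilinear_lmul[OF h] bilinear_rmul[OF h]
  have neg: "h (- y) (- y) = h y y" for y by (simp add: bilinear_lneg[OF h] bilinear_rneg[OF h])
  have H': "\<forall>y w. regular y \<longrightarrow> EL y (h y y) w" "\<forall>y. h (- y) (- y) = h y y" using H neg by auto
  note odd = EL_odd_consequences[of "\<lambda>y. h y y", OF H'] and even = EL_even_consequences[of "\<lambda>y. h y y", OF H']
  have N: "N > 0" "ip e e = N" using N_pos by (simp_all add: N_def)
  have Se: "s e e = 0" by (rule s_e_e)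
  have rez: "r e z = ip e z * (r e e / N) - 3 * s e z" for z
    using odd(1)[of z] by (simp add: dN_eq)
  \<comment> \<open>The coefficient of \<open>t\<close> in \<open>ip v (h y y)\<close> for
    \<open>y = z + t e\<close>.\<close>
  define g where "g z v = ip v (h z e + h e z)" for z v
  have g: "bilinear g"
    unfolding bilinear_def g_def by (auto intro!: linearI simp: ip_simps h_simps algebra_simps)
  define \<rho> where "\<rho> = r e e / N"
  have expand: "h (z + t *\<^sub>R e) (z + t *\<^sub>R e) = h z z + t *\<^sub>R (h z e + h e z) + t\<^sup>2 *\<^sub>R h e e" for z t
    by (simp add: h_simps algebra_simps power2_eq_square)
  \<comment> \<open>On \<open>y = z + t e\<close> the right side \<open>2 * ip y y * s e v\<close>
    of the second even consequence has no term linear in \<open>t\<close>, so the linear coefficient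
    \<open>N * g z v\<close> of the left side vanishes.\<close>
  have g0: "g z v = 0" if "z \<in> {z. ip e z = 0}" "v \<in> {z. ip e z = 0}" "ip z v = 0" for z v
  proof (cases "z = 0")
    case True
    then show ?thesis by (simp add: bilinear_lzero[OF g])
  next
    case False
    have "(N * ip v (h z z) - 2 * ip z z * s e v) + (N * g z v) * t
        + (N * ip v (h e e) - 2 * N * s e v) * t\<^sup>2 + 0 * t ^ 3 = 0" for t
      using even(2)[OF regular_orthogonal[of z t], of v] that False
      by (simp add: expand ip_simps g_def ip_sym[of z e] N algebra_simps power2_eq_square)
    from cubic_coeffs_eq_zero(2)[OF this] show ?thesis using N by simp
  qed
  have W: "subspace {z. ip e z = 0}" by (auto intro!: subspaceI simp: ip_simps)
  have "\<exists>\<tau>. \<forall>z\<in>{z. ip e z = 0}. g z z = \<tau> * ip z z"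
    by (rule form_proportional_to_metric[where g = g and ip = ip])
      (use ip_bilinear ip_sym ip_pos g W g0 in blast)+
  then obtain \<tau> where \<tau>: "\<And>z. ip e z = 0 \<Longrightarrow> g z z = \<tau> * ip z z" by blast
  \<comment> \<open>The ratio of \<open>r z z\<close> to \<open>ip z z\<close> that the coefficient
    of \<open>t\<^sup>2\<close> in the first even consequence produces once
    \<open>g z z = \<tau> * ip z z\<close> is inserted.\<close>
  define c where "c = \<rho> + 3 * ip e (h e e) / N - 3 * \<tau>"
  have rzz: "r z z = c * ip z z" if "ip e z = 0" for z
  proof (cases "z = 0")
    case True
    then show ?thesis by (simp add: bilinear_lzero[OF r_bilinear] ip_simps)
  next
    case False
    have ez: "ip z e = 0" "r z e = - 3 * s e z" "r e z = - 3 * s e z"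
      using that rez[of z] by (simp_all add: ip_sym[of z e] r_sym[of z e])
    have ree: "r e e = \<rho> * N" using N by (simp add: \<rho>_def)
    have "(ip z z * (r z z - \<rho> * ip z z) - 3 * ip z z * ip e (h z z))
      + (- 6 * ip z z * s e z - 3 * (ip z z * ip e (h z e + h e z) - N * ip z (h z z))) * t
      + (N * (r z z - \<rho> * ip z z) - 3 * (ip z z * ip e (h e e) - N * g z z)) * t\<^sup>2
      + (- 6 * N * s e z + 3 * N * ip z (h e e)) * t ^ 3 = 0" for t
    proof -
      define y where "y = z + t *\<^sub>R e"
      have y: "ip y y = ip z z + N * t\<^sup>2" "ip e y = N * t" "ip y (h y y) = ip z (h y y) + t * ip e (h y y)"
        "r y y = r z z - 6 * t * s e z + \<rho> * N * t\<^sup>2"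
        by (simp_all add: y_def ip_simps rs_simps ez ree that N algebra_simps power2_eq_square)
      have "regular y" using regular_orthogonal[OF that False] by (simp add: y_def)
      then have "(ip z z + N * t\<^sup>2) * (r z z - 6 * t * s e z - \<rho> * ip z z)
          = 3 * (ip z z * ip e (h y y) - N * t * ip z (h y y))"
        using even(1)[of y] unfolding \<rho>_def[symmetric] y by (simp add: algebra_simps power2_eq_square)
      moreover have "h y y = h z z + t *\<^sub>R (h z e + h e z) + t\<^sup>2 *\<^sub>R h e e"
        unfolding y_def by (rule expand)
      ultimately show ?thesis
        by (simp add: ip_simps g_def algebra_simps power2_eq_square power3_eq_cube)
    qed
    from cubic_coeffs_eq_zero(3)[OF this]
    have "r z z = \<rho> * ip z z + 3 * ip z z * ip e (h e e) / N - 3 * g z z" using N by (simp add: field_simps)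
    then show ?thesis by (simp add: \<tau>[OF that] c_def algebra_simps)
  qed
  \<comment> \<open>Solves \<open>r e e = c * N + d * N\<^sup>2\<close>, where
    \<open>r e e = \<rho> * N\<close>.\<close>
  define d where "d = (\<rho> - c) / N"
  have ryy: "r y y = c * ip y y + d * (ip e y)\<^sup>2 - 6 / N * s e y * ip e y" for y
  proof -
    obtain z where z: "ip e z = 0" "y = z + (ip e y / N) *\<^sub>R e" by (rule orthogonal_split)
    define t where "t = ip e y / N"
    have "y = z + t *\<^sub>R e" "ip e y = t * N" using z(2) N by (simp_all add: t_def)
    moreover have "r (z + t *\<^sub>R e) (z + t *\<^sub>R e) = c * ip z z - 6 * t * s e z + t\<^sup>2 * (\<rho> * N)"
      using z(1) rez[of z] N by (simp add: rs_simps rzz r_sym[of z e] \<rho>_def power2_eq_square algebra_simps)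
    moreover have "ip (z + t *\<^sub>R e) (z + t *\<^sub>R e) = ip z z + t\<^sup>2 * N" "s e (z + t *\<^sub>R e) = s e z"
      using z(1) by (simp_all add: rs_simps ip_simps ip_sym[of z e] N Se power2_eq_square)
    ultimately show ?thesis using N by (simp add: d_def field_simps power2_eq_square)
  qed
  have "r u v = c * ip u v + d * ip e u * ip e v - 3 / N * (s e u * ip e v + s e v * ip e u)" for u v
  proof -
    have "2 * r u v = r (u + v) (u + v) - r u u - r v v"
      by (simp add: rs_simps r_sym[of v u])
    also have "\<dots> = 2 * (c * ip u v + d * ip e u * ip e v - 3 / N * (s e u * ip e v + s e v * ip e u))"
      unfolding ryy using N by (simp add: rs_simps ip_simps ip_sym[of v u] field_simps power2_eq_square)
    finally show ?thesis by (rule mult_left_cancel[THEN iffD1, rotated]) simp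
  qed
  moreover have "s u v = 1 / N * (ip e u * s e v - ip e v * s e u)" for u v
    using odd(2)[of u v] by (metis mult.commute mult.right_neutral times_divide_eq_right)
  ultimately show thesis by (rule that)
qed

theorem normal_form_imp_EL:
  assumes r: "\<And>u v. r u v = c * ip u v + d * ip e u * ip e v - 3 / N * (s e u * ip e v + s e v * ip e u)"
    and s: "\<And>u v. s u v = 1 / N * (ip e u * s e v - ip e v * s e u)"
    and s': "\<And>v. ip s' v = s e v"
    and y: "y \<noteq> 0"
  shows "EL y (ip y y *\<^sub>R ((2 / N) *\<^sub>R s' - (d / 3) *\<^sub>R e)) w"
proof -
  have N: "N > 0" "ip e e = N" using N_pos by (simp_all add: N_def)
  have Se: "s e e = 0" by (rule s_e_e)
  have dN: "dN v = 2 * ((c + d * N) * ip e v - 2 * s e v)" for v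
    using N(1) by (simp add: dN_eq r[of e v] N(2) Se field_simps)
  define h where "h = ip y y *\<^sub>R ((2 / N) *\<^sub>R s' - (d / 3) *\<^sub>R e)"
  have h: "ip y h = ip y y * (2 / N * s e y - d / 3 * ip e y)"
    "ip h w = ip y y * (2 / N * s e w - d / 3 * ip e w)" "ip e h = - ip y y * (d / 3) * N"
    by (simp_all add: h_def ip_simps s' N Se ip_sym[of y s'] ip_sym[of y e] ip_sym[of e s'])
  \<comment> \<open>With the length \<open>a\<close> of \<open>y\<close> scaled out, the remaining
    quantities have degree zero in \<open>y\<close>, and \<open>a\<close> enters both sides of the
    equation only through the common factor \<open>2 * a\<close>.\<close>
  define a \<sigma> \<omega> \<eta> ew sw where scalars: "a = al y" "\<sigma> = ip e y / a" "\<omega> = ip y w / a" "\<eta> = s e y / a"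
    "ew = ip e w" "sw = s e w"
  have a: "a > 0" using al_pos[OF y] by (simp add: scalars)
  have subst: "al y = a" "ip e y = \<sigma> * a" "ip y w = \<omega> * a" "s e y = \<eta> * a" "ip e w = ew" "s e w = sw"
    "ip y y = a * a"
    using a by (simp_all add: scalars ip_al[of y])
  \<comment> \<open>The terms odd in \<open>nb\<close>, which form the odd part of the equation,
    cancel by the formulas for \<open>dN\<close> and \<open>s\<close>; only \<open>nb * nb\<close>
    survives.\<close>
  have lhs: "qd y w * dN y - q y * dN w + md y w * r y y + 2 * m y * s w y
    = 2 * a * (((ew - \<sigma> * \<omega>) * (c + d * \<sigma>\<^sup>2 - 6 / (nb * nb) * \<eta> * \<sigma>))
      + \<omega> * ((c + d * (nb * nb)) * \<sigma> - 2 * \<eta>) - ((c + d * (nb * nb)) * ew - 2 * sw)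
      + 2 * \<sigma> * (ew * \<eta> - \<sigma> * sw) / (nb * nb))"
    unfolding dN r[of y y] s[of w y] qd_def q_def md_def m_def sgd_def sg_def subst N_eq
    using a nb_pos by (simp add: field_simps power2_eq_square power3_eq_cube)
  have pmd: "p y = (nb * nb - \<sigma>\<^sup>2) / (2 * a)" "pd y w = - (\<sigma> * (ew - \<sigma> * \<omega>) + (nb * nb - \<sigma>\<^sup>2) * \<omega> / 2) / a\<^sup>2"
    "md y w = 2 * (ew - \<sigma> * \<omega>) / a"
    unfolding p_def pd_def md_def sgd_def sg_def subst N_eq
    using a by (simp_all add: field_simps power2_eq_square power3_eq_cube)
  have rhs: "2 * F2 y h w = 2 * a * (
      - 2 * (\<sigma> * (ew - \<sigma> * \<omega>) + (nb * nb - \<sigma>\<^sup>2) * \<omega> / 2) * (2 / (nb * nb) * \<eta> - d / 3 * \<sigma>)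
      + (nb * nb - \<sigma>\<^sup>2) * (2 / (nb * nb) * sw - d / 3 * ew)
      - 2 * (ew - \<sigma> * \<omega>) * (d / 3) * (nb * nb))"
    unfolding F2_def h pmd subst N_eq
    using a nb_pos by (simp add: field_simps power2_eq_square power3_eq_cube)
  show ?thesis
    unfolding h_def[symmetric] EL_def lhs rhs
    using nb_pos by (simp add: field_simps power2_eq_square)
qed

end

section \<open>Derivatives with respect to the tangent vector\<close>

context metric_and_form_jet
begin

lemma has_derivative_ip_self: "((\<lambda>y. ip y y) has_derivative (\<lambda>w. 2 * ip y w)) (at y)"
  using bounded_bilinear.FDERIV[OF bilinear_conv_bounded_bilinear[THEN iffD1, OF ip_bilinear]
      has_derivative_ident has_derivative_ident, of y UNIV]
  by (simp add: ip_sym[of _ y])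

lemma has_derivative_dA_self: "((\<lambda>y. dA u y y) has_derivative (\<lambda>w. 2 * dA u y w)) (at y)"
  using bounded_bilinear.FDERIV[OF bilinear_conv_bounded_bilinear[THEN iffD1, OF dA_bilinear]
      has_derivative_ident has_derivative_ident, of u y UNIV]
  by (simp add: dA_sym[of u _ y])

lemma has_derivative_ip_left: "((\<lambda>y. ip y v) has_derivative (\<lambda>w. ip w v)) (at y)"
  and has_derivative_ip_right: "((\<lambda>y. ip v y) has_derivative (\<lambda>w. ip v w)) (at y)"
  and has_derivative_dB: "((\<lambda>y. dB u y) has_derivative (\<lambda>w. dB u w)) (at y)"
  using ip_bilinear dB_bilinear
  by (auto simp: bilinear_def linear_conv_bounded_linear intro: bounded_linear_imp_has_derivative)

lemma has_derivative_al:
  assumes "y \<noteq> 0"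
  shows "(al has_derivative (\<lambda>w. ip y w / al y)) (at y)"
  unfolding al_def[abs_def]
  using ip_pos[OF assms]
  by (auto intro!: derivative_eq_intros has_derivative_ip_self simp: fun_eq_iff field_simps)

lemma has_derivative_sg:
  assumes "y \<noteq> 0"
  shows "(sg has_derivative (\<lambda>w. sgd y w)) (at y)"
  unfolding sg_def[abs_def] sgd_def
  using al_pos[OF assms]
  by (auto intro!: derivative_eq_intros has_derivative_al[OF assms] has_derivative_ip_right
      simp: fun_eq_iff field_simps power3_eq_cube)

lemma has_derivative_p:
  assumes "y \<noteq> 0"
  shows "(p has_derivative (\<lambda>w. pd y w)) (at y)"
  unfolding p_def[abs_def] pd_def
  using al_pos[OF assms]
  by (auto intro!: derivative_eq_intros has_derivative_al[OF assms] has_derivative_sg[OF assms]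
      simp: fun_eq_iff field_simps power3_eq_cube power2_eq_square)

lemma has_derivative_q:
  assumes "y \<noteq> 0"
  shows "(q has_derivative (\<lambda>w. qd y w)) (at y)"
  unfolding q_def[abs_def] qd_def
  using nb_pos
  by (auto intro!: derivative_eq_intros has_derivative_al[OF assms] has_derivative_ip_right)

lemma has_derivative_m:
  assumes "y \<noteq> 0"
  shows "(m has_derivative (\<lambda>w. md y w)) (at y)"
  unfolding m_def[abs_def] md_def
  by (auto intro!: derivative_eq_intros has_derivative_sg[OF assms])

lemma has_derivative_Fn:
  assumes "y \<noteq> 0"
  shows "(Fn has_derivative (\<lambda>w. F1 y w)) (at y)"
  unfolding Fn_def[abs_def] F1_def p_def m_def sg_def N_eq
  using al_pos[OF assms]
  by (auto intro!: derivative_eq_intros has_derivative_al[OF assms] has_derivative_ip_right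
      simp: fun_eq_iff field_simps power3_eq_cube power2_eq_square)

lemma has_derivative_F1:
  assumes "y \<noteq> 0"
  shows "((\<lambda>y. F1 y v) has_derivative (\<lambda>w. F2 y v w)) (at y)"
  unfolding F1_def F2_def
  by (auto intro!: derivative_eq_intros has_derivative_p[OF assms] has_derivative_m[OF assms]
      has_derivative_ip_left simp: fun_eq_iff ip_sym[of v] algebra_simps)

lemma has_derivative_X:
  assumes "y \<noteq> 0"
  shows "((\<lambda>y. X y u) has_derivative (\<lambda>w. Xd y u w)) (at y)"
  unfolding X_def Xd_def
  by (auto intro!: derivative_eq_intros has_derivative_p[OF assms] has_derivative_m[OF assms]
      has_derivative_q[OF assms] has_derivative_dA_self has_derivative_dB simp: fun_eq_iff algebra_simps)

lemma linear_jets: "linear (F1 y)" "linear (F2 y v)" "linear (\<lambda>v. F2 y v w)" "linear (X y)"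
  "linear (\<lambda>u. Xd y u w)" "linear (Xd y u)"
  by (auto intro!: linearI simp: F1_def F2_def X_def Xd_def pd_def md_def qd_def sgd_def dN_def ip_simps
      dA_simps dB_simps add_divide_distrib diff_divide_distrib algebra_simps)

lemma r_eq_Gam: "r u v = (dB v u - ip e (Gam u v) + (dB u v - ip e (Gam v u))) / 2"
  by (simp add: r_def ip_Gam dA_sym[of e v u] field_simps)

lemma s_eq_Gam: "s u v = (dB v u - ip e (Gam u v) - (dB u v - ip e (Gam v u))) / 2"
  by (simp add: s_def ip_Gam dA_sym[of e v u] field_simps)

end

section \<open>From coordinate sums to linear and bilinear forms\<close>

lemma linear_sum_axis:
  fixes f :: "real^'n \<Rightarrow> real"
  assumes "linear f"
  shows "f w = (\<Sum>k\<in>UNIV. w $ k * f (axis k 1))"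
proof -
  have "(\<Sum>k\<in>UNIV. w $ k *\<^sub>R axis k 1) = w"
    using basis_expansion[of w] by (simp add: scalar_mult_eq_scaleR)
  then have "f w = f (\<Sum>k\<in>UNIV. w $ k *\<^sub>R axis k 1)" by simp
  also have "\<dots> = (\<Sum>k\<in>UNIV. w $ k * f (axis k 1))"
    by (simp add: linear_sum[OF assms] linear_cmul[OF assms])
  finally show ?thesis .
qed

lemma partial_eq: "(f has_derivative f') (at x) \<Longrightarrow> partial i f x = f' (axis i 1)"
  by (metis frechet_derivative_at partial_def)

lemma has_derivative_partial_sum:
  fixes f :: "real^'n \<Rightarrow> real"
  assumes "f differentiable (at x)"
  shows "(f has_derivative (\<lambda>u. \<Sum>k\<in>UNIV. u $ k * partial k f x)) (at x)"
proof -
  have D: "(f has_derivative frechet_derivative f (at x)) (at x)"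
    using assms by (simp add: frechet_derivative_works)
  have "frechet_derivative f (at x) = (\<lambda>u. \<Sum>k\<in>UNIV. u $ k * partial k f x)"
    unfolding partial_def by (rule ext) (rule linear_sum_axis[OF has_derivative_linear[OF D]])
  then show ?thesis using D by metis
qed

lemma bilinear_form_eq_inner:
  fixes A :: "real^'n^'n"
  shows "(\<Sum>i\<in>UNIV. \<Sum>j\<in>UNIV. A $ i $ j * u $ i * v $ j) = u \<bullet> (A *v v)"
  by (simp add: inner_vec_def matrix_vector_mult_def sum_distrib_left mult_ac)

lemma bilinear_matrix_form: "bilinear (\<lambda>u v. u \<bullet> ((A :: real^'n^'n) *v v))"
  unfolding bilinear_def
  by (auto intro!: linearI simp: inner_add_left inner_add_right matrix_vector_right_distrib matrix_vector_mult_scaleR)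

lemma invertible_if_definite:
  fixes A :: "real^'n^'n"
  assumes "\<And>u. u \<noteq> 0 \<Longrightarrow> u \<bullet> (A *v u) \<noteq> 0"
  shows "invertible A"
proof -
  have "A *v u = 0 \<Longrightarrow> u = 0" for u using assms[of u] by auto
  then show ?thesis by (metis invertible_left_inverse matrix_left_invertible_ker)
qed

section \<open>Jets of the metric and the 1-form in a chart\<close>

definition metric_at :: "'n::finite metric_coeffs \<Rightarrow> real^'n \<Rightarrow> real^'n \<Rightarrow> real^'n \<Rightarrow> real" where
  "metric_at a x u v = u \<bullet> (a x *v v)"

definition dual_vector :: "'n::finite metric_coeffs \<Rightarrow> 'n form_coeffs \<Rightarrow> real^'n \<Rightarrow> real^'n" where
  "dual_vector a b x = matrix_inv (a x) *v b x"

definition deriv_matrix :: "'n::finite metric_coeffs \<Rightarrow> real^'n \<Rightarrow> real^'n \<Rightarrow> real^'n^'n" where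
  "deriv_matrix a x u = (\<chi> i j. \<Sum>k\<in>UNIV. u $ k * partial k (\<lambda>x. a x $ i $ j) x)"

definition deriv_vector :: "'n::finite form_coeffs \<Rightarrow> real^'n \<Rightarrow> real^'n \<Rightarrow> real^'n" where
  "deriv_vector b x u = (\<chi> i. \<Sum>k\<in>UNIV. u $ k * partial k (\<lambda>x. b x $ i) x)"

definition dmetric_at :: "'n::finite metric_coeffs \<Rightarrow> real^'n \<Rightarrow> real^'n \<Rightarrow> real^'n \<Rightarrow> real^'n \<Rightarrow> real" where
  "dmetric_at a x u v w = v \<bullet> (deriv_matrix a x u *v w)"

definition dform_at :: "'n::finite form_coeffs \<Rightarrow> real^'n \<Rightarrow> real^'n \<Rightarrow> real^'n \<Rightarrow> real" where
  "dform_at b x u v = deriv_vector b x u \<bullet> v"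

definition connection_at :: "'n::finite metric_coeffs \<Rightarrow> real^'n \<Rightarrow> real^'n \<Rightarrow> real^'n \<Rightarrow> real^'n" where
  "connection_at a x u v = (\<chi> k. \<Sum>i\<in>UNIV. \<Sum>j\<in>UNIV. christoffel a x k i j * u $ i * v $ j)"

lemma linear_deriv_matrix: "linear (deriv_matrix a x)"
  unfolding deriv_matrix_def
  by (auto intro!: linearI simp: vec_eq_iff sum.distrib sum_distrib_left algebra_simps)

lemma linear_deriv_vector: "linear (deriv_vector b x)"
  unfolding deriv_vector_def
  by (auto intro!: linearI simp: vec_eq_iff sum.distrib sum_distrib_left algebra_simps)

lemma has_derivative_vec_lambda:
  fixes f :: "'a::real_normed_vector \<Rightarrow> 'n::finite \<Rightarrow> 'b::euclidean_space"
  assumes "\<And>i. ((\<lambda>x. f x i) has_derivative f' i) (at x)"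
  shows "((\<lambda>x. \<chi> i. f x i) has_derivative (\<lambda>u. \<chi> i. f' i u)) (at x)"
proof (subst has_derivative_componentwise_within, rule ballI)
  fix v :: "'b^'n" assume "v \<in> Basis"
  then obtain i w where v: "v = axis i w" by (auto simp: Basis_vec_def)
  show "((\<lambda>x. (\<chi> i. f x i) \<bullet> v) has_derivative (\<lambda>u. (\<chi> i. f' i u) \<bullet> v)) (at x)"
    using bounded_linear.has_derivative[OF bounded_linear_inner_left assms[of i], of w]
    by (simp add: v inner_axis)
qed

lemma has_derivative_deriv_vector:
  assumes "smooth_on U b" "open U" "x \<in> U"
  shows "(b has_derivative deriv_vector b x) (at x)"
proof -
  have "smooth_on U (\<lambda>x. b x $ i)" for i using assms by (intro smooth_intros)
  then have "(\<lambda>x. b x $ i) differentiable (at x)" for i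
    using smooth_on_has_derivative[OF _ assms(2,3)] differentiable_def by blast
  then have "((\<lambda>x. \<chi> i. b x $ i) has_derivative (\<lambda>u. \<chi> i. \<Sum>k\<in>UNIV. u $ k * partial k (\<lambda>x. b x $ i) x)) (at x)"
    by (intro has_derivative_vec_lambda has_derivative_partial_sum)
  then show ?thesis by (simp add: deriv_vector_def[abs_def])
qed

lemma has_derivative_deriv_matrix:
  assumes "smooth_on U a" "open U" "x \<in> U"
  shows "(a has_derivative deriv_matrix a x) (at x)"
proof -
  have "smooth_on U (\<lambda>x. a x $ i $ j)" for i j using assms by (intro smooth_intros)
  then have "(\<lambda>x. a x $ i $ j) differentiable (at x)" for i j
    using smooth_on_has_derivative[OF _ assms(2,3)] differentiable_def by blast
  then have "((\<lambda>x. \<chi> i j. a x $ i $ j) has_derivative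
      (\<lambda>u. \<chi> i j. \<Sum>k\<in>UNIV. u $ k * partial k (\<lambda>x. a x $ i $ j) x)) (at x)"
    by (intro has_derivative_vec_lambda has_derivative_partial_sum)
  then show ?thesis by (simp add: deriv_matrix_def[abs_def])
qed

lemma has_derivative_matrix_form:
  fixes a :: "'a::real_normed_vector \<Rightarrow> real^'n^'m"
  assumes "(a has_derivative a') (at x)" "(v has_derivative v') (at x)" "(w has_derivative w') (at x)"
  shows "((\<lambda>x. v x \<bullet> (a x *v w x)) has_derivative
    (\<lambda>u. v' u \<bullet> (a x *v w x) + v x \<bullet> (a' u *v w x) + v x \<bullet> (a x *v w' u))) (at x)"
proof -
  have "bounded_bilinear (\<lambda>(A::real^'n^'m) (x::real^'n). A *v x)"
    unfolding bilinear_conv_bounded_bilinear[symmetric] bilinear_def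
    by (auto intro!: linearI simp: matrix_vector_mult_add_rdistrib scaleR_matrix_vector_assoc
        matrix_vector_right_distrib matrix_vector_mult_scaleR)
  from has_derivative_inner[OF assms(2) bounded_bilinear.FDERIV[OF this assms(1,3)]]
  show ?thesis by (simp add: inner_add_right algebra_simps)
qed

locale chart_forms =
  fixes U :: "(real^'n::finite) set" and a :: "'n metric_coeffs" and b :: "'n form_coeffs"
  assumes open_U: "open U" and smooth_a: "smooth_on U a" and smooth_b: "smooth_on U b"
    and a_sym: "x \<in> U \<Longrightarrow> a x $ i $ j = a x $ j $ i"
    and a_pos: "x \<in> U \<Longrightarrow> y \<noteq> 0 \<Longrightarrow> (\<Sum>i\<in>UNIV. \<Sum>j\<in>UNIV. a x $ i $ j * y $ i * y $ j) > 0"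
    and b_nonzero: "x \<in> U \<Longrightarrow> b x \<noteq> 0"
begin

lemma a_invertible: "x \<in> U \<Longrightarrow> invertible (a x)"
  using a_pos unfolding bilinear_form_eq_inner by (intro invertible_if_definite) fastforce

lemma metric_at_sym: "x \<in> U \<Longrightarrow> metric_at a x u v = metric_at a x v u"
proof -
  assume x: "x \<in> U"
  have "transpose (a x) = a x" by (simp add: transpose_def vec_eq_iff a_sym[OF x])
  then show ?thesis by (metis dot_lmul_matrix inner_commute metric_at_def transpose_matrix_vector)
qed

lemma metric_at_dual_vector: "x \<in> U \<Longrightarrow> metric_at a x v (dual_vector a b x) = b x \<bullet> v"
  by (simp add: metric_at_def dual_vector_def matrix_vector_mul_assoc matrix_inv_right a_invertible inner_commute)

lemma smooth_dual_vector: "smooth_on U (dual_vector a b)"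
proof -
  have "smooth_on U (\<lambda>x. \<chi> i. \<Sum>j\<in>UNIV. matrix_inv (a x) $ i $ j * b x $ j)"
    by (intro smooth_intros open_U smooth_a smooth_b a_invertible)
  then show ?thesis by (simp add: dual_vector_def[abs_def] matrix_vector_mult_def)
qed

end

text \<open>Freezing the point separates the algebra of a single jet from the smooth dependence on
  the point, for which \<open>chart_forms\<close> leaves it free.\<close>

locale chart_point = chart_forms +
  fixes x :: "real^'n"
  assumes x: "x \<in> U"
begin

lemma deriv_matrix_sym: "deriv_matrix a x u $ i $ j = deriv_matrix a x u $ j $ i"
proof -
  have "smooth_on U (\<lambda>x. a x $ i $ j)" for i j using open_U smooth_a by (intro smooth_intros)
  then have D: "((\<lambda>x. a x $ i $ j) has_derivative frechet_derivative (\<lambda>x. a x $ i $ j) (at x)) (at x)" for i j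
    by (rule smooth_on_has_derivative[OF _ open_U x])
  have "frechet_derivative (\<lambda>x. a x $ i $ j) (at x) = frechet_derivative (\<lambda>x. a x $ j $ i) (at x)"
    by (rule frechet_derivative_at)
      (rule has_derivative_transform_within_open[OF D open_U x], simp add: a_sym)
  then show ?thesis by (simp add: deriv_matrix_def partial_def)
qed

text \<open>The Koszul identity for the Christoffel symbols. \<open>L\<close> is the bracket in
  their definition contracted with \<open>u\<close> and \<open>v\<close>; raising its index with the
  inverse matrix and pairing through \<open>a x\<close> cancel each other.\<close>

lemma metric_at_connection:
  "2 * metric_at a x w (connection_at a x u v) =
    dmetric_at a x u v w + dmetric_at a x v u w - dmetric_at a x w u v"
proof -
  define L where "L = (\<chi> l. (deriv_matrix a x u *v v) $ l + (deriv_matrix a x v *v u) $ l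
    - u \<bullet> (deriv_matrix a x (axis l 1) *v v))"
  have L: "L $ l = (\<Sum>i\<in>UNIV. \<Sum>j\<in>UNIV. (partial i (\<lambda>x. a x $ l $ j) x + partial j (\<lambda>x. a x $ l $ i) x
          - partial l (\<lambda>x. a x $ i $ j) x) * u $ i * v $ j)" for l
  proof -
    have "(deriv_matrix a x u *v v) $ l = (\<Sum>i\<in>UNIV. \<Sum>j\<in>UNIV. partial i (\<lambda>x. a x $ l $ j) x * u $ i * v $ j)"
      by (subst sum.swap) (simp add: matrix_vector_mult_def deriv_matrix_def sum_distrib_left mult_ac)
    moreover have "(deriv_matrix a x v *v u) $ l = (\<Sum>i\<in>UNIV. \<Sum>j\<in>UNIV. partial j (\<lambda>x. a x $ l $ i) x * u $ i * v $ j)"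
      by (simp add: matrix_vector_mult_def deriv_matrix_def sum_distrib_left mult_ac)
    moreover have "u \<bullet> (deriv_matrix a x (axis l 1) *v v) = (\<Sum>i\<in>UNIV. \<Sum>j\<in>UNIV. partial l (\<lambda>x. a x $ i $ j) x * u $ i * v $ j)"
      by (simp add: bilinear_form_eq_inner[symmetric] deriv_matrix_def axis_def if_distrib[of "\<lambda>z. z * _"] cong: if_cong)
    ultimately show ?thesis
      by (simp add: L_def ring_distribs sum.distrib sum_subtractf)
  qed
  have "connection_at a x u v $ k = ((1/2) *\<^sub>R (matrix_inv (a x) *v L)) $ k" for k
  proof -
    have "connection_at a x u v $ k = (\<Sum>i\<in>UNIV. \<Sum>j\<in>UNIV. \<Sum>l\<in>UNIV. 1/2 * (matrix_inv (a x) $ k $ l *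
       ((partial i (\<lambda>x. a x $ l $ j) x + partial j (\<lambda>x. a x $ l $ i) x
          - partial l (\<lambda>x. a x $ i $ j) x) * u $ i * v $ j)))"
      by (simp add: connection_at_def christoffel_def sum_distrib_left sum_distrib_right mult.assoc)
    also have "\<dots> = (\<Sum>i\<in>UNIV. \<Sum>l\<in>UNIV. \<Sum>j\<in>UNIV. 1/2 * (matrix_inv (a x) $ k $ l *
       ((partial i (\<lambda>x. a x $ l $ j) x + partial j (\<lambda>x. a x $ l $ i) x
          - partial l (\<lambda>x. a x $ i $ j) x) * u $ i * v $ j)))"
      by (intro sum.cong refl sum.swap)
    also have "\<dots> = (\<Sum>l\<in>UNIV. \<Sum>i\<in>UNIV. \<Sum>j\<in>UNIV. 1/2 * (matrix_inv (a x) $ k $ l *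
       ((partial i (\<lambda>x. a x $ l $ j) x + partial j (\<lambda>x. a x $ l $ i) x
          - partial l (\<lambda>x. a x $ i $ j) x) * u $ i * v $ j)))"
      by (rule sum.swap)
    also have "\<dots> = ((1/2) *\<^sub>R (matrix_inv (a x) *v L)) $ k"
      by (simp add: matrix_vector_mult_def L sum_distrib_left)
    finally show ?thesis .
  qed
  then have "connection_at a x u v = (1/2) *\<^sub>R (matrix_inv (a x) *v L)"
    by (simp add: vec_eq_iff)
  then have "2 * metric_at a x w (connection_at a x u v) = w \<bullet> L"
    by (simp add: metric_at_def matrix_vector_mult_scaleR matrix_vector_mul_assoc matrix_inv_right a_invertible x)
  also have "\<dots> = w \<bullet> (deriv_matrix a x u *v v) + w \<bullet> (deriv_matrix a x v *v u)
      - (\<Sum>l\<in>UNIV. w $ l * (u \<bullet> (deriv_matrix a x (axis l 1) *v v)))"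
    by (simp add: L_def inner_vec_def[of w] ring_distribs sum.distrib sum_subtractf)
  also have "(\<Sum>l\<in>UNIV. w $ l * (u \<bullet> (deriv_matrix a x (axis l 1) *v v))) = u \<bullet> (deriv_matrix a x w *v v)"
    by (rule linear_sum_axis[symmetric], rule linearI)
      (simp_all add: linear_add[OF linear_deriv_matrix] linear_cmul[OF linear_deriv_matrix]
        matrix_vector_mult_add_rdistrib scaleR_matrix_vector_assoc[symmetric] inner_add_right)
  finally have *: "2 * metric_at a x w (connection_at a x u v) = w \<bullet> (deriv_matrix a x u *v v)
    + w \<bullet> (deriv_matrix a x v *v u) - u \<bullet> (deriv_matrix a x w *v v)" .
  have "w \<bullet> (deriv_matrix a x z *v y) = y \<bullet> (deriv_matrix a x z *v w)" for y z
  proof -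
    have "transpose (deriv_matrix a x z) = deriv_matrix a x z"
      by (simp add: transpose_def vec_eq_iff deriv_matrix_sym)
    then show ?thesis by (metis dot_lmul_matrix inner_commute transpose_matrix_vector)
  qed
  then show ?thesis using * by (simp add: dmetric_at_def)
qed

sublocale metric_and_form_jet "metric_at a x" "dual_vector a b x" "dmetric_at a x" "dform_at b x" "connection_at a x"
proof (rule metric_and_form_jet.intro)
  show "bilinear (metric_at a x)" using bilinear_matrix_form by (simp add: metric_at_def[abs_def])
  show "metric_at a x u v = metric_at a x v u" for u v by (rule metric_at_sym[OF x])
  show "v \<noteq> 0 \<Longrightarrow> 0 < metric_at a x v v" for v
    using a_pos[OF x] by (simp add: metric_at_def bilinear_form_eq_inner)
  show "dual_vector a b x \<noteq> 0"
  proof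
    assume "dual_vector a b x = 0"
    then have "b x \<bullet> b x = 0" using metric_at_dual_vector[OF x, of "b x"] by (simp add: metric_at_def)
    then show False using b_nonzero[OF x] by simp
  qed
  show "linear (\<lambda>u. dmetric_at a x u v w)" for v w
    by (auto intro!: linearI simp: dmetric_at_def linear_add[OF linear_deriv_matrix] linear_cmul[OF linear_deriv_matrix]
        matrix_vector_mult_add_rdistrib scaleR_matrix_vector_assoc[symmetric] inner_add_right)
  show "bilinear (dmetric_at a x u)" for u using bilinear_matrix_form by (simp add: dmetric_at_def[abs_def])
  show "dmetric_at a x u v w = dmetric_at a x u w v" for u v w
  proof -
    have "transpose (deriv_matrix a x u) = deriv_matrix a x u"
      by (simp add: transpose_def vec_eq_iff deriv_matrix_sym)
    then show ?thesis by (metis dmetric_at_def dot_lmul_matrix inner_commute transpose_matrix_vector)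
  qed
  show "bilinear (dform_at b x)"
    unfolding bilinear_def dform_at_def
    by (auto intro!: linearI simp: linear_add[OF linear_deriv_vector] linear_cmul[OF linear_deriv_vector]
        inner_add_left inner_add_right)
  show "bilinear (connection_at a x)"
    unfolding bilinear_def connection_at_def
    by (auto intro!: linearI simp: vec_eq_iff sum.distrib sum_distrib_left algebra_simps)
  show "2 * metric_at a x (connection_at a x u v) w =
    dmetric_at a x u v w + dmetric_at a x v u w - dmetric_at a x w u v" for u v w
    using metric_at_connection metric_at_sym[OF x] by metis
qed

abbreviation e where "e \<equiv> dual_vector a b x"

lemma ip_e: "metric_at a x e v = b x \<bullet> v"
  by (metis metric_at_dual_vector metric_at_sym x)

lemma alpha_eq: "alpha a x y = al y"
  by (simp add: alpha_def al_def bilinear_form_eq_inner metric_at_def)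

lemma beta_eq: "beta b x y = metric_at a x e y"
  by (simp add: beta_def ip_e inner_vec_def)

lemma b_up_eq: "b_up a b x i = e $ i"
  by (simp add: b_up_def dual_vector_def matrix_vector_mult_def)

lemma b_sq_eq: "b_sq a b x = N"
  by (simp add: b_sq_def b_up_eq N_def ip_e inner_vec_def mult.commute)

lemma b_norm_eq: "b_norm a b x = nb"
  by (simp add: b_norm_def b_sq_eq nb_def)

lemma singular_square_eq: "singular_square a b x y = Fn y"
  by (simp add: singular_square_def b_norm_eq alpha_eq beta_eq Fn_def)

lemma regular_dirs_eq: "regular_dirs a b x = {y. regular y}"
  by (simp add: regular_dirs_def regular_def b_norm_eq alpha_eq beta_eq)

text \<open>\<open>dform_at\<close> takes the direction of differentiation first, whereas in
  \<open>cov_deriv\<close> it is the last index; hence the swapped axes.\<close>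

lemma cov_deriv_eq:
  "cov_deriv a b x i j = dform_at b x (axis j 1) (axis i 1) - metric_at a x e (connection_at a x (axis i 1) (axis j 1))"
proof -
  have "dform_at b x (axis j 1) (axis i 1) = partial j (\<lambda>x. b x $ i) x"
    unfolding dform_at_def deriv_vector_def inner_axis
    by (simp add: axis_def if_distrib[of "\<lambda>z. z * _"] cong: if_cong)
  moreover have "connection_at a x (axis i 1) (axis j 1) $ k = christoffel a x k i j" for k
    by (simp add: connection_at_def axis_def if_distrib[of "\<lambda>z. _ * z"] cong: if_cong)
  ultimately show ?thesis
    by (simp add: cov_deriv_def ip_e inner_vec_def mult.commute)
qed

lemma r_tensor_eq: "r_tensor a b x i j = r (axis i 1) (axis j 1)"
  by (simp add: r_tensor_def cov_deriv_eq r_eq_Gam)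

lemma s_tensor_eq: "s_tensor a b x i j = s (axis i 1) (axis j 1)"
  by (simp add: s_tensor_def cov_deriv_eq s_eq_Gam)

lemma s_form_eq: "s_form a b x i = s e (axis i 1)"
proof -
  have "linear (\<lambda>u. s u (axis i 1))" using s_bilinear by (simp add: bilinear_def)
  from linear_sum_axis[OF this, of e] show ?thesis by (simp add: s_form_def s_tensor_eq b_up_eq)
qed

end

section \<open>The spray of a singular square metric\<close>

lemma has_derivative_sqrt:
  assumes "(f has_derivative f') (at x)" "f x > 0"
  shows "((\<lambda>x. sqrt (f x)) has_derivative (\<lambda>u. f' u / (2 * sqrt (f x)))) (at x)"
  using assms by (auto intro!: derivative_eq_intros simp: fun_eq_iff field_simps)

context chart_point
begin

text \<open>Writing \<open>b^2\<close> as 2 b(e) - a(e, e) makes the dual vector a critical point of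
  the expression, so its derivative \<delta> cancels and only those of the metric and the 1-form
  remain.\<close>

lemma has_derivative_b_sq: "(b_sq a b has_derivative dN) (at x)"
proof -
  obtain \<delta> where \<delta>: "(dual_vector a b has_derivative \<delta>) (at x)"
    using smooth_on_has_derivative[OF smooth_dual_vector open_U x] by blast
  note D = has_derivative_matrix_form[OF has_derivative_deriv_matrix[OF smooth_a open_U x] \<delta> \<delta>]
  note B = has_derivative_inner[OF has_derivative_deriv_vector[OF smooth_b open_U x] \<delta>]
  have "((\<lambda>x. 2 * (b x \<bullet> dual_vector a b x) - dual_vector a b x \<bullet> (a x *v dual_vector a b x)) has_derivative
     (\<lambda>u. 2 * (b x \<bullet> \<delta> u + deriv_vector b x u \<bullet> e)
        - (\<delta> u \<bullet> (a x *v e) + e \<bullet> (deriv_matrix a x u *v e) + e \<bullet> (a x *v \<delta> u)))) (at x)"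
    by (intro has_derivative_diff has_derivative_mult_right B D)
  moreover have "2 * (b x \<bullet> \<delta> u + deriv_vector b x u \<bullet> e)
        - (\<delta> u \<bullet> (a x *v e) + e \<bullet> (deriv_matrix a x u *v e) + e \<bullet> (a x *v \<delta> u)) = dN u" for u
    using metric_at_dual_vector[OF x, of "\<delta> u"] ip_e[of "\<delta> u"]
    by (simp add: dN_def dmetric_at_def dform_at_def metric_at_def)
  ultimately have "((\<lambda>x. 2 * (b x \<bullet> dual_vector a b x) - dual_vector a b x \<bullet> (a x *v dual_vector a b x))
      has_derivative dN) (at x)" by simp
  then show ?thesis
  proof (rule has_derivative_transform_within_open[OF _ open_U x])
    fix z assume z: "z \<in> U"
    have "b_sq a b z = b z \<bullet> dual_vector a b z"
      by (simp add: b_sq_def b_up_def dual_vector_def matrix_vector_mult_def inner_vec_def mult.commute)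
    moreover have "dual_vector a b z \<bullet> (a z *v dual_vector a b z) = b z \<bullet> dual_vector a b z"
      using metric_at_dual_vector[OF z] by (simp add: metric_at_def)
    ultimately show "2 * (b z \<bullet> dual_vector a b z) - dual_vector a b z \<bullet> (a z *v dual_vector a b z) = b_sq a b z"
      by simp
  qed
qed

lemma has_derivative_singular_square:
  assumes "y \<noteq> 0"
  shows "((\<lambda>x. singular_square a b x y) has_derivative X y) (at x)"
proof -
  have al: "((\<lambda>x. alpha a x y) has_derivative (\<lambda>u. dmetric_at a x u y y / (2 * al y))) (at x)"
  proof -
    have "((\<lambda>x. y \<bullet> (a x *v y)) has_derivative (\<lambda>u. dmetric_at a x u y y)) (at x)"
      using has_derivative_matrix_form[OF has_derivative_deriv_matrix[OF smooth_a open_U x]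
          has_derivative_const has_derivative_const, of y y]
      by (simp add: dmetric_at_def)
    moreover have "y \<bullet> (a x *v y) > 0" using ip_pos[OF assms] by (simp add: metric_at_def)
    ultimately show ?thesis
      unfolding alpha_def bilinear_form_eq_inner al_def metric_at_def by (rule has_derivative_sqrt)
  qed
  have nb: "(b_norm a b has_derivative (\<lambda>u. dN u / (2 * nb))) (at x)"
    unfolding b_norm_def[abs_def] using N_pos
    by (auto intro!: derivative_eq_intros has_derivative_b_sq simp: b_sq_eq nb_def fun_eq_iff field_simps)
  have be: "((\<lambda>x. beta b x y) has_derivative (\<lambda>u. dform_at b x u y)) (at x)"
    using has_derivative_inner_left[OF has_derivative_deriv_vector[OF smooth_b open_U x], of y]
    by (simp add: beta_def inner_vec_def[symmetric] inner_real_def[symmetric] dform_at_def del: inner_real_def)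
  show ?thesis
    unfolding singular_square_def
    using al_pos[OF assms] nb_pos
    by (auto intro!: derivative_eq_intros al nb be simp: alpha_eq b_norm_eq beta_eq X_def p_def q_def m_def sg_def N_eq
        fun_eq_iff field_simps power2_eq_square power3_eq_cube)
qed

lemma fundamental_tensor_eq:
  assumes "y \<noteq> 0"
  shows "fundamental_tensor (singular_square a b) x y $ i $ j
    = Fn y * F2 y (axis i 1) (axis j 1) + F1 y (axis i 1) * F1 y (axis j 1)"
proof -
  have 1: "partial i (\<lambda>y. 1/2 * (singular_square a b x y)\<^sup>2) z = Fn z * F1 z (axis i 1)" if "z \<noteq> 0" for z
  proof -
    have "((\<lambda>y. 1/2 * (singular_square a b x y)\<^sup>2) has_derivative (\<lambda>w. Fn z * F1 z w)) (at z)"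
      unfolding singular_square_eq
      by (auto intro!: derivative_eq_intros has_derivative_Fn[OF that])
    then show ?thesis by (rule partial_eq)
  qed
  have "((\<lambda>z. Fn z * F1 z (axis i 1)) has_derivative (\<lambda>w. Fn y * F2 y (axis i 1) w + F1 y w * F1 y (axis i 1))) (at y)"
    by (intro has_derivative_mult has_derivative_Fn has_derivative_F1 assms)
  then have "((\<lambda>z. partial i (\<lambda>y. 1/2 * (singular_square a b x y)\<^sup>2) z) has_derivative
      (\<lambda>w. Fn y * F2 y (axis i 1) w + F1 y w * F1 y (axis i 1))) (at y)"
    by (rule has_derivative_transform_within_open[of _ _ _ _ "- {0}"]) (use assms 1 in auto)
  then show ?thesis by (simp add: fundamental_tensor_def partial_eq)
qed

text \<open>The x-derivative \<open>2 * Fn z * X z u\<close> of F^2 is known at every nonzero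
  \<open>z\<close>, an open set, so it can replace the inner partial derivative under the
  y-derivative. Linearity of \<open>X\<close> in the direction then contracts the sum with
  \<open>y\<close>.\<close>

lemma spray_bracket_eq:
  assumes "y \<noteq> 0"
  shows "(\<Sum>k\<in>UNIV. partial l (\<lambda>y. partial k (\<lambda>x. (singular_square a b x y)\<^sup>2) x) y * y $ k)
         - partial l (\<lambda>x. (singular_square a b x y)\<^sup>2) x
    = 2 * (F1 y (axis l 1) * X y y + Fn y * Xd y y (axis l 1)) - 2 * Fn y * X y (axis l 1)"
proof -
  have 1: "partial k (\<lambda>x. (singular_square a b x z)\<^sup>2) x = 2 * Fn z * X z (axis k 1)" if "z \<noteq> 0" for z k
  proof -
    have "((\<lambda>x. (singular_square a b x z)\<^sup>2) has_derivative (\<lambda>w. 2 * Fn z * X z w)) (at x)"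
      by (auto intro!: derivative_eq_intros has_derivative_singular_square[OF that] simp: singular_square_eq)
    then show ?thesis by (rule partial_eq)
  qed
  have 2: "partial l (\<lambda>y. partial k (\<lambda>x. (singular_square a b x y)\<^sup>2) x) y
      = 2 * (Fn y * Xd y (axis k 1) (axis l 1) + F1 y (axis l 1) * X y (axis k 1))" for k
  proof -
    have "((\<lambda>z. 2 * (Fn z * X z (axis k 1))) has_derivative
        (\<lambda>w. 2 * (Fn y * Xd y (axis k 1) w + F1 y w * X y (axis k 1)))) (at y)"
      by (intro has_derivative_mult_right has_derivative_mult has_derivative_Fn has_derivative_X assms)
    then have "((\<lambda>z. partial k (\<lambda>x. (singular_square a b x z)\<^sup>2) x) has_derivative
        (\<lambda>w. 2 * (Fn y * Xd y (axis k 1) w + F1 y w * X y (axis k 1)))) (at y)"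
      by (rule has_derivative_transform_within_open[of _ _ _ _ "- {0}"]) (use assms 1 in auto)
    then show ?thesis by (rule partial_eq)
  qed
  have "(\<Sum>k\<in>UNIV. 2 * (Fn y * Xd y (axis k 1) (axis l 1) + F1 y (axis l 1) * X y (axis k 1)) * y $ k)
    = 2 * (Fn y * (\<Sum>k\<in>UNIV. y $ k * Xd y (axis k 1) (axis l 1)) + F1 y (axis l 1) * (\<Sum>k\<in>UNIV. y $ k * X y (axis k 1)))"
    by (simp add: sum_distrib_left sum.distrib algebra_simps)
  also have "\<dots> = 2 * (Fn y * Xd y y (axis l 1) + F1 y (axis l 1) * X y y)"
    using linear_sum_axis[where f = "\<lambda>u. Xd y u (axis l 1)" and w = y, OF linear_jets(5)] linear_sum_axis[OF linear_jets(4), of y y] by simp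
  finally show ?thesis by (simp add: 1 2 assms algebra_simps)
qed

text \<open>Multiplying by the fundamental tensor, invertible at regular \<open>y\<close> by
  definiteness, removes the inverse from the definition of the spray. Both sides are linear in
  \<open>w\<close>, so the coordinate equations extend to all \<open>w\<close>.\<close>

lemma spray_equation:
  assumes "regular y"
  shows "4 * (Fn y * F2 y (\<chi> i. spray_coeff (singular_square a b) x y i) w
      + F1 y (\<chi> i. spray_coeff (singular_square a b) x y i) * F1 y w)
    = 2 * (F1 y w * X y y + Fn y * Xd y y w) - 2 * Fn y * X y w"
proof -
  have y: "y \<noteq> 0" using assms by (simp add: regular_def)
  define g where "g = fundamental_tensor (singular_square a b) x y"
  define V where "V = (\<chi> l. 2 * (F1 y (axis l 1) * X y y + Fn y * Xd y y (axis l 1)) - 2 * Fn y * X y (axis l 1))"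
  define G where "G = (\<chi> i. spray_coeff (singular_square a b) x y i)"
  have form: "u \<bullet> (g *v v) = Fn y * F2 y u v + F1 y u * F1 y v" for u v
  proof -
    have "bilinear (\<lambda>u v. Fn y * F2 y u v + F1 y u * F1 y v)"
      unfolding bilinear_def
      by (auto intro!: linearI simp: linear_add[OF linear_jets(1)] linear_cmul[OF linear_jets(1)]
          linear_add[OF linear_jets(2)] linear_cmul[OF linear_jets(2)]
          linear_add[OF linear_jets(3)] linear_cmul[OF linear_jets(3)] algebra_simps)
    then have "(\<lambda>u v. u \<bullet> (g *v v)) = (\<lambda>u v. Fn y * F2 y u v + F1 y u * F1 y v)"
    proof (rule bilinear_eq_stdbasis[OF bilinear_matrix_form])
      fix i j :: "real^'n" assume "i \<in> Basis" "j \<in> Basis"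
      then obtain k l where "i = axis k 1" "j = axis l 1" by (auto simp: Basis_vec_def)
      then show "i \<bullet> (g *v j) = Fn y * F2 y i j + F1 y i * F1 y j"
        using fundamental_tensor_eq[OF y, of k l]
        by (simp add: g_def inner_axis' matrix_vector_mult_basis column_def)
    qed
    then show ?thesis by meson
  qed
  have "u \<bullet> (g *v u) \<noteq> 0" if "u \<noteq> 0" for u
    using fundamental_form_definite[OF assms that] by (simp add: form power2_eq_square)
  then have inv: "invertible g" by (rule invertible_if_definite)
  have "G = (1/4) *\<^sub>R (matrix_inv g *v V)"
    using spray_bracket_eq[OF y]
    by (simp add: vec_eq_iff G_def spray_coeff_def g_def V_def matrix_vector_mult_def)
  then have "g *v G = (1/4) *\<^sub>R V"
    by (simp add: matrix_vector_mult_scaleR matrix_vector_mul_assoc matrix_inv_right inv)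
  then have "4 * (w \<bullet> (g *v G)) = w \<bullet> V" by simp
  also have "w \<bullet> V = (\<Sum>l\<in>UNIV. w $ l * (2 * (F1 y (axis l 1) * X y y + Fn y * Xd y y (axis l 1)) - 2 * Fn y * X y (axis l 1)))"
    by (simp add: V_def inner_vec_def)
  also have "\<dots> = 2 * (F1 y w * X y y + Fn y * Xd y y w) - 2 * Fn y * X y w"
  proof (rule linear_sum_axis[symmetric])
    show "linear (\<lambda>w. 2 * (F1 y w * X y y + Fn y * Xd y y w) - 2 * Fn y * X y w)"
      by (auto intro!: linearI simp: linear_add[OF linear_jets(1)] linear_cmul[OF linear_jets(1)]
          linear_add[OF linear_jets(4)] linear_cmul[OF linear_jets(4)]
          linear_add[OF linear_jets(6)] linear_cmul[OF linear_jets(6)] algebra_simps)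
  qed
  finally show ?thesis by (simp add: form F2_sym[of y w] G_def mult.commute)
qed

text \<open>The equivalence serves the direction from the Douglas condition, where \<open>P\<close>
  is an unknown number for each \<open>y\<close>; the second claim serves the converse, where
  \<open>P\<close> has to be an explicit function.\<close>

lemma spray_douglas_iff:
  assumes "regular y"
  shows "(\<exists>P. \<forall>i. spray_coeff (singular_square a b) x y i = Q $ i + P * y $ i)
      \<longleftrightarrow> (\<forall>w. EL y (Q - (1/2) *\<^sub>R connection_at a x y y) w)"
    and "(\<And>w. EL y (Q - (1/2) *\<^sub>R connection_at a x y y) w) \<Longrightarrow>
      spray_coeff (singular_square a b) x y i = Q $ i + (X y y / 2 - F1 y Q) / Fn y * y $ i"
proof -
  have y: "y \<noteq> 0" using assms by (simp add: regular_def)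
  have nondeg: "Fn y * F2 y u u + (F1 y u)\<^sup>2 \<noteq> 0" if "u \<noteq> 0" for u
    using fundamental_form_definite[OF assms that] by simp
  note * = spray_of_F[OF y Fn_pos[OF assms] nondeg spray_equation[OF assms], of Q]
  show "(\<exists>P. \<forall>i. spray_coeff (singular_square a b) x y i = Q $ i + P * y $ i)
      \<longleftrightarrow> (\<forall>w. EL y (Q - (1/2) *\<^sub>R connection_at a x y y) w)"
    using *(1) by (simp add: douglas_equation vec_eq_iff)
  show "spray_coeff (singular_square a b) x y i = Q $ i + (X y y / 2 - F1 y Q) / Fn y * y $ i"
    if "\<And>w. EL y (Q - (1/2) *\<^sub>R connection_at a x y y) w"
    using *(2) that by (simp add: douglas_equation vec_eq_iff)
qed

end

section \<open>The normal form in a chart\<close>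

definition normal_form :: "'n::finite metric_coeffs \<Rightarrow> 'n form_coeffs \<Rightarrow> real^'n \<Rightarrow> real \<Rightarrow> real \<Rightarrow> bool" where
  "normal_form a b x c d \<longleftrightarrow> (\<forall>i j.
     r_tensor a b x i j = c * a x $ i $ j + d * b x $ i * b x $ j
       - 3 / b_sq a b x * (s_form a b x i * b x $ j + s_form a b x j * b x $ i) \<and>
     s_tensor a b x i j = 1 / b_sq a b x * (b x $ i * s_form a b x j - b x $ j * s_form a b x i))"

definition connection_form :: "real^'n^'n^'n \<Rightarrow> real^'n \<Rightarrow> real^'n::finite \<Rightarrow> real^'n" where
  "connection_form \<Gamma> u v = (\<chi> i. \<Sum>j\<in>UNIV. \<Sum>k\<in>UNIV. \<Gamma> $ i $ j $ k * u $ j * v $ k)"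

lemma bilinear_connection_form: "bilinear (connection_form \<Gamma>)"
  unfolding bilinear_def connection_form_def
  by (auto intro!: linearI simp: vec_eq_iff sum.distrib sum_distrib_left algebra_simps)

text \<open>If \<open>r\<close> has the normal form, then its trace and its value on the dual vector determine the two
  coefficients.\<close>

definition r_trace :: "'n::finite metric_coeffs \<Rightarrow> 'n form_coeffs \<Rightarrow> real^'n \<Rightarrow> real" where
  "r_trace a b x = (\<Sum>i\<in>UNIV. \<Sum>j\<in>UNIV. matrix_inv (a x) $ i $ j * r_tensor a b x i j)"

definition r_radial :: "'n::finite metric_coeffs \<Rightarrow> 'n form_coeffs \<Rightarrow> real^'n \<Rightarrow> real" where
  "r_radial a b x = (\<Sum>i\<in>UNIV. \<Sum>j\<in>UNIV. b_up a b x i * b_up a b x j * r_tensor a b x i j)"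

definition c_coeff :: "'n::finite metric_coeffs \<Rightarrow> 'n form_coeffs \<Rightarrow> real^'n \<Rightarrow> real" where
  "c_coeff a b x = (r_trace a b x - r_radial a b x / b_sq a b x) / real (CARD('n) - 1)"

definition d_coeff :: "'n::finite metric_coeffs \<Rightarrow> 'n form_coeffs \<Rightarrow> real^'n \<Rightarrow> real" where
  "d_coeff a b x = (r_radial a b x / b_sq a b x - c_coeff a b x) / b_sq a b x"

context chart_forms
begin

lemma chart_pointI: "x \<in> U \<Longrightarrow> chart_point U a b x"
  using chart_forms_axioms by (simp add: chart_point_def chart_point_axioms_def)

lemma b_sq_pos:
  assumes "x \<in> U"
  shows "b_sq a b x > 0"
proof -
  interpret chart_point U a b x by (rule chart_pointI[OF assms])
  show ?thesis by (simp add: b_sq_eq N_pos)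
qed

lemma smooth_christoffel: "smooth_on U (\<lambda>x. christoffel a x k i j)"
  unfolding christoffel_def by (intro smooth_intros open_U smooth_a a_invertible)

lemma smooth_cov_deriv: "smooth_on U (\<lambda>x. cov_deriv a b x i j)"
  unfolding cov_deriv_def by (intro smooth_intros open_U smooth_b smooth_christoffel)

lemma smooth_b_up: "smooth_on U (\<lambda>x. b_up a b x i)"
  unfolding b_up_def by (intro smooth_intros open_U smooth_a smooth_b a_invertible)

lemma smooth_b_sq: "smooth_on U (\<lambda>x. b_sq a b x)"
  unfolding b_sq_def by (intro smooth_intros open_U smooth_b smooth_b_up)

lemma smooth_r_tensor: "smooth_on U (\<lambda>x. r_tensor a b x i j)"
  unfolding r_tensor_def by (intro smooth_intros open_U smooth_cov_deriv)

lemma smooth_s_form: "smooth_on U (\<lambda>x. s_form a b x i)"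
  unfolding s_form_def s_tensor_def by (intro smooth_intros open_U smooth_cov_deriv smooth_b_up)

lemma smooth_c_coeff:
  assumes "CARD('n) \<ge> 2"
  shows "smooth_on U (c_coeff a b)"
  unfolding c_coeff_def[abs_def] r_trace_def r_radial_def
  by (intro smooth_intros open_U smooth_a a_invertible smooth_r_tensor smooth_b_up smooth_b_sq)
    (use assms b_sq_pos in fastforce)+

lemma smooth_d_coeff:
  assumes "CARD('n) \<ge> 2"
  shows "smooth_on U (d_coeff a b)"
proof -
  have "smooth_on U (\<lambda>x. c_coeff a b x)" using smooth_c_coeff[OF assms] .
  then show ?thesis
    unfolding d_coeff_def[abs_def] r_radial_def
    by (intro smooth_intros open_U smooth_r_tensor smooth_b_up smooth_b_sq)
      (use b_sq_pos in fastforce)+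
qed

end

lemma bilinear_eq_axis:
  fixes f g :: "real^'n \<Rightarrow> real^'m \<Rightarrow> real"
  assumes "bilinear f" "bilinear g"
  shows "(\<forall>u v. f u v = g u v) \<longleftrightarrow> (\<forall>i j. f (axis i 1) (axis j 1) = g (axis i 1) (axis j 1))"
proof
  assume *: "\<forall>i j. f (axis i 1) (axis j 1) = g (axis i 1) (axis j 1)"
  have "f = g"
    by (rule bilinear_eq_stdbasis[OF assms]) (use * in \<open>auto simp: Basis_vec_def\<close>)
  then show "\<forall>u v. f u v = g u v" by simp
qed simp

context chart_point
begin

lemma metric_at_axis: "metric_at a x (axis i 1) (axis j 1) = a x $ i $ j"
  by (simp add: metric_at_def inner_axis' matrix_vector_mult_basis column_def)

lemma ip_e_axis: "metric_at a x e (axis i 1) = b x $ i"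
  by (simp add: ip_e inner_axis)

lemma normal_form_iff:
  "normal_form a b x c d \<longleftrightarrow>
    (\<forall>u v. r u v = c * metric_at a x u v + d * metric_at a x e u * metric_at a x e v
      - 3 / N * (s e u * metric_at a x e v + s e v * metric_at a x e u)) \<and>
    (\<forall>u v. s u v = 1 / N * (metric_at a x e u * s e v - metric_at a x e v * s e u))"
proof -
  have 1: "bilinear (\<lambda>u v. c * metric_at a x u v + d * metric_at a x e u * metric_at a x e v
      - 3 / N * (s e u * metric_at a x e v + s e v * metric_at a x e u))"
    unfolding bilinear_def by (auto intro!: linearI simp: ip_simps rs_simps algebra_simps add_divide_distrib)
  have 2: "bilinear (\<lambda>u v. 1 / N * (metric_at a x e u * s e v - metric_at a x e v * s e u))"
    unfolding bilinear_def by (auto intro!: linearI simp: ip_simps rs_simps algebra_simps add_divide_distrib diff_divide_distrib)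
  show ?thesis
    unfolding bilinear_eq_axis[OF r_bilinear 1] bilinear_eq_axis[OF s_bilinear 2] normal_form_def
      r_tensor_eq s_tensor_eq s_form_eq b_sq_eq metric_at_axis ip_e_axis
    by blast
qed

lemma douglas_imp_normal_form:
  assumes "\<And>y. y \<in> regular_dirs a b x \<Longrightarrow> \<exists>P. \<forall>i. spray_coeff (singular_square a b) x y i =
      1/2 * (\<Sum>j\<in>UNIV. \<Sum>k\<in>UNIV. \<Gamma> $ i $ j $ k * y $ j * y $ k) + P * y $ i"
  shows "\<exists>c d. normal_form a b x c d"
proof -
  \<comment> \<open>\<open>h y y\<close> is the deviation of the quadratic spray from that of
    \<alpha>. As \<Gamma> may be asymmetric in its lower indices, so may be
    \<open>h\<close>.\<close>
  define h where "h u v = (1/2) *\<^sub>R connection_form \<Gamma> u v - (1/2) *\<^sub>R connection_at a x u v" for u v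
  have h: "bilinear h"
    using bilinear_connection_form[of \<Gamma>] Gam_bilinear unfolding bilinear_def h_def
    by (auto intro!: linear_compose_sub linear_compose_scale_right)
  have "EL y (h y y) w" if "regular y" for y w
  proof -
    have "\<exists>P. \<forall>i. spray_coeff (singular_square a b) x y i = ((1/2) *\<^sub>R connection_form \<Gamma> y y) $ i + P * y $ i"
      using assms[of y] that by (simp add: regular_dirs_eq connection_form_def)
    from spray_douglas_iff(1)[OF that, THEN iffD1, OF this] show ?thesis by (simp add: h_def)
  qed
  then obtain c d where
    "\<And>u v. r u v = c * metric_at a x u v + d * metric_at a x e u * metric_at a x e v
      - 3 / N * (s e u * metric_at a x e v + s e v * metric_at a x e u)"
    "\<And>u v. s u v = 1 / N * (metric_at a x e u * s e v - metric_at a x e v * s e u)"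
    using EL_imp_normal_form[OF h] by metis
  then show ?thesis unfolding normal_form_iff by blast
qed

lemma r_radial_eq: "r_radial a b x = r e e"
proof -
  have "r e e = (\<Sum>i\<in>UNIV. e $ i * r (axis i 1) e)"
    by (rule linear_sum_axis) (use r_bilinear in \<open>simp add: bilinear_def\<close>)
  also have "\<dots> = (\<Sum>i\<in>UNIV. e $ i * (\<Sum>j\<in>UNIV. e $ j * r (axis i 1) (axis j 1)))"
    using linear_sum_axis[of "r (axis _ 1)" e] r_bilinear by (simp add: bilinear_def)
  finally show ?thesis by (simp add: r_radial_def r_tensor_eq b_up_eq sum_distrib_left mult.assoc)
qed

text \<open>Both mixed terms have trace a multiple of \<open>s e e = 0\<close>. Hence the trace of
  \<open>r\<close> is \<open>n c + d N\<close>, with \<open>n\<close> the dimension, while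
  \<open>r e e / N = c + d N\<close>; subtracting leaves \<open>(n - 1) c\<close>.\<close>

lemma normal_form_coeffs:
  assumes "CARD('n) \<ge> 2" "normal_form a b x c d"
  shows "c = c_coeff a b x" "d = d_coeff a b x"
proof -
  define g where "g i j = matrix_inv (a x) $ i $ j" for i j
  have inv: "matrix_inv (a x) ** a x = mat 1" by (simp add: matrix_inv_left a_invertible x)
  have tr_a: "(\<Sum>i\<in>UNIV. \<Sum>j\<in>UNIV. g i j * a x $ i $ j) = real (CARD('n))"
  proof -
    have "(\<Sum>j\<in>UNIV. g i j * a x $ i $ j) = 1" for i
    proof -
      have "(\<Sum>j\<in>UNIV. g i j * a x $ i $ j) = (matrix_inv (a x) ** a x) $ i $ i"
        using a_sym[OF x, of i] by (simp add: g_def matrix_matrix_mult_def)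
      then show ?thesis by (simp add: inv mat_def)
    qed
    then show ?thesis by simp
  qed
  have ge: "(\<Sum>j\<in>UNIV. g i j * b x $ j) = e $ i" for i
    by (simp add: g_def dual_vector_def matrix_vector_mult_def)
  have tr_bb: "(\<Sum>i\<in>UNIV. \<Sum>j\<in>UNIV. g i j * (b x $ i * b x $ j)) = N"
  proof -
    have "(\<Sum>j\<in>UNIV. g i j * (b x $ i * b x $ j)) = b x $ i * e $ i" for i
      by (simp add: ge[symmetric] sum_distrib_left mult_ac)
    then show ?thesis by (simp add: N_def ip_e inner_vec_def)
  qed
  have tr_sb: "(\<Sum>i\<in>UNIV. \<Sum>j\<in>UNIV. g i j * (s_form a b x i * b x $ j)) = 0"
  proof -
    have "(\<Sum>j\<in>UNIV. g i j * (s_form a b x i * b x $ j)) = e $ i * s e (axis i 1)" for i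
      by (simp add: ge[symmetric] sum_distrib_right s_form_eq mult_ac)
    moreover have "s e e = (\<Sum>i\<in>UNIV. e $ i * s e (axis i 1))"
      by (rule linear_sum_axis) (use s_bilinear in \<open>simp add: bilinear_def\<close>)
    ultimately show ?thesis by (simp add: s_e_e)
  qed
  have gsym: "g i j = g j i" for i j
  proof -
    have "transpose (a x) = a x" by (simp add: transpose_def vec_eq_iff a_sym[OF x])
    then have "a x ** transpose (matrix_inv (a x)) = mat 1"
      by (metis inv matrix_transpose_mul transpose_mat)
    then have "transpose (matrix_inv (a x)) = matrix_inv (a x)"
      by (metis inv matrix_mul_assoc matrix_mul_lid matrix_mul_rid)
    then have "transpose (matrix_inv (a x)) $ i $ j = matrix_inv (a x) $ i $ j" by simp
    then show ?thesis by (simp add: g_def transpose_def)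
  qed
  have tr_bs: "(\<Sum>i\<in>UNIV. \<Sum>j\<in>UNIV. g i j * (s_form a b x j * b x $ i)) = 0"
  proof -
    have "(\<Sum>i\<in>UNIV. \<Sum>j\<in>UNIV. g i j * (s_form a b x j * b x $ i))
      = (\<Sum>i\<in>UNIV. \<Sum>j\<in>UNIV. g j i * (s_form a b x j * b x $ i))"
      by (intro sum.cong refl) (metis gsym)
    then show ?thesis using tr_sb by (subst (asm) (2) sum.swap) simp
  qed
  have r: "r_tensor a b x i j = c * a x $ i $ j + d * (b x $ i * b x $ j)
       - 3 / N * (s_form a b x i * b x $ j) - 3 / N * (s_form a b x j * b x $ i)" for i j
  proof -
    have "r_tensor a b x i j = c * a x $ i $ j + d * b x $ i * b x $ j
       - 3 / N * (s_form a b x i * b x $ j + s_form a b x j * b x $ i)"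
      using assms(2) unfolding normal_form_def b_sq_eq by blast
    then show ?thesis by (simp add: algebra_simps add_divide_distrib)
  qed
  have "r_trace a b x = c * (\<Sum>i\<in>UNIV. \<Sum>j\<in>UNIV. g i j * a x $ i $ j) + d * (\<Sum>i\<in>UNIV. \<Sum>j\<in>UNIV. g i j * (b x $ i * b x $ j))
    - 3 / N * (\<Sum>i\<in>UNIV. \<Sum>j\<in>UNIV. g i j * (s_form a b x i * b x $ j))
    - 3 / N * (\<Sum>i\<in>UNIV. \<Sum>j\<in>UNIV. g i j * (s_form a b x j * b x $ i))"
    unfolding r_trace_def r g_def[symmetric]
    by (simp only: sum_distrib_left sum.distrib[symmetric] sum_subtractf[symmetric])
      (intro sum.cong refl, simp add: algebra_simps)
  then have tr: "r_trace a b x = c * real (CARD('n)) + d * N"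
    by (simp add: tr_a tr_bb tr_sb tr_bs)
  have "r e e = c * N + d * N * N"
  proof -
    have "r e e = c * metric_at a x e e + d * metric_at a x e e * metric_at a x e e
      - 3 / N * (s e e * metric_at a x e e + s e e * metric_at a x e e)"
      using assms(2) unfolding normal_form_iff by blast
    then show ?thesis by (simp add: s_e_e flip: N_def)
  qed
  then have rad: "r_radial a b x / N = c + d * N"
    using N_pos by (simp add: r_radial_eq field_simps)
  show "c = c_coeff a b x"
    using assms(1) by (simp add: c_coeff_def b_sq_eq rad tr field_simps of_nat_diff)
  then show "d = d_coeff a b x"
    using N_pos by (simp add: d_coeff_def b_sq_eq rad)
qed

end

section \<open>From the normal form to the Douglas condition\<close>

text \<open>The affine connection whose geodesics are those of a singular square metric in normal form.\<close>

definition douglas_connection ::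
    "'n::finite metric_coeffs \<Rightarrow> 'n form_coeffs \<Rightarrow> (real^'n \<Rightarrow> real) \<Rightarrow> real^'n \<Rightarrow> real^'n^'n^'n" where
  "douglas_connection a b d x = (\<chi> i j k. christoffel a x i j k + 2 * a x $ j $ k *
     (2 / b_sq a b x * (\<Sum>l\<in>UNIV. matrix_inv (a x) $ i $ l * s_form a b x l) - d x / 3 * b_up a b x i))"

definition geodesic_quadratic :: "real^'n^'n^'n \<Rightarrow> real^'n::finite \<Rightarrow> real^'n" where
  "geodesic_quadratic \<Gamma> y = (\<chi> i. 1/2 * (\<Sum>j\<in>UNIV. \<Sum>k\<in>UNIV. \<Gamma> $ i $ j $ k * y $ j * y $ k))"

text \<open>This is \<open>(X y y / 2 - F1 y Q) / Fn y\<close>, the coefficient found in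
  \<open>spray_of_F\<close>. It is spelled out without the constants of the jet, which belong to one
  fixed point, so that it can be treated as a function of point and vector jointly.\<close>

definition projective_factor ::
    "'n::finite metric_coeffs \<Rightarrow> 'n form_coeffs \<Rightarrow> (real^'n \<Rightarrow> real^'n^'n^'n) \<Rightarrow> real^'n \<Rightarrow> real^'n \<Rightarrow> real" where
  "projective_factor a b \<Gamma> x y =
    (let \<alpha> = alpha a x y; \<beta> = beta b x y; n = b_norm a b x; e = dual_vector a b x;
         Q = geodesic_quadratic (\<Gamma> x) y; p = (n * n - (\<beta> / \<alpha>)\<^sup>2) / (2 * \<alpha>)
     in ((p * dmetric_at a x y y y + (\<alpha> + \<beta> / n) * (2 * dform_at b x y e - dmetric_at a x y e e)
          + 2 * (n + \<beta> / \<alpha>) * dform_at b x y y) / 2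
         - (2 * p * metric_at a x y Q + 2 * (n + \<beta> / \<alpha>) * beta b x Q)) / singular_square a b x y)"

context chart_point
begin

lemma projective_factor_eq:
  "projective_factor a b \<Gamma> x y = (X y y / 2 - F1 y (geodesic_quadratic (\<Gamma> x) y)) / Fn y"
  unfolding projective_factor_def Let_def alpha_eq beta_eq b_norm_eq singular_square_eq
    X_def F1_def p_def q_def m_def dN_def sg_def N_eq ..

text \<open>In \<open>y\<close>, \<open>p\<close> has degree -1, \<open>m\<close> degree 0, and
  \<open>q\<close>, \<open>dN\<close>, \<open>Fn\<close> degree 1; with the quadratic argument of
  \<open>F1\<close> the numerator has degree 2 and the quotient degree 1.\<close>

lemma projective_factor_scale:
  assumes "y \<noteq> 0" "t > 0"
  shows "projective_factor a b \<Gamma> x (t *\<^sub>R y) = t * projective_factor a b \<Gamma> x y"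
proof -
  have Q: "geodesic_quadratic (\<Gamma> x) (t *\<^sub>R y) = t\<^sup>2 *\<^sub>R geodesic_quadratic (\<Gamma> x) y"
    by (simp add: geodesic_quadratic_def vec_eq_iff sum_distrib_left power2_eq_square mult_ac)
  have al: "al (t *\<^sub>R y) = t * al y"
    using assms(2) by (simp add: al_def ip_simps real_sqrt_mult)
  have sg: "sg (t *\<^sub>R y) = sg y" using assms(2) by (simp add: sg_def al ip_simps)
  have pqm: "p (t *\<^sub>R y) = p y / t" "q (t *\<^sub>R y) = t * q y" "m (t *\<^sub>R y) = m y"
    by (simp_all add: p_def q_def m_def sg al ip_simps algebra_simps)
  have dN: "dN (t *\<^sub>R y) = t * dN y" by (simp add: dN_def dB_simps dA_simps algebra_simps)
  have "X (t *\<^sub>R y) (t *\<^sub>R y) = t\<^sup>2 * X y y"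
    using assms(2) by (simp add: X_def pqm dN dA_simps dB_simps field_simps power2_eq_square)
  moreover have "F1 (t *\<^sub>R y) (t\<^sup>2 *\<^sub>R v) = t\<^sup>2 * F1 y v" for v
    using assms(2) by (simp add: F1_def pqm ip_simps field_simps power2_eq_square)
  moreover have "Fn (t *\<^sub>R y) = t * Fn y"
    using assms(2) al_pos[OF assms(1)] by (simp add: Fn_def al ip_simps field_simps power2_eq_square)
  ultimately have "projective_factor a b \<Gamma> x (t *\<^sub>R y)
      = (t * (t * (X y y / 2 - F1 y (geodesic_quadratic (\<Gamma> x) y)))) / (t * Fn y)"
    unfolding projective_factor_eq Q by (simp add: algebra_simps power2_eq_square)
  then show ?thesis using assms(2) by (simp add: projective_factor_eq)
qed

text \<open>The factor 2 in \<open>douglas_connection\<close> offsets the 1/2 in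
  \<open>geodesic_quadratic\<close>, so the difference from the spray of \<alpha> is exactly the
  vector in \<open>normal_form_imp_EL\<close>.\<close>

lemma douglas_connection_deviation:
  "geodesic_quadratic (douglas_connection a b d x) y - (1/2) *\<^sub>R connection_at a x y y =
    metric_at a x y y *\<^sub>R ((2 / N) *\<^sub>R (matrix_inv (a x) *v (\<chi> l. s_form a b x l)) - (d x / 3) *\<^sub>R e)"
proof -
  define Z where "Z = (2 / N) *\<^sub>R (matrix_inv (a x) *v (\<chi> l. s_form a b x l)) - (d x / 3) *\<^sub>R e"
  have \<Gamma>: "douglas_connection a b d x $ i $ j $ k = christoffel a x i j k + 2 * a x $ j $ k * Z $ i" for i j k
    by (simp add: douglas_connection_def Z_def b_sq_eq b_up_eq matrix_vector_mult_def)
  have "geodesic_quadratic (douglas_connection a b d x) y $ i - connection_at a x y y $ i / 2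
    = metric_at a x y y * Z $ i" for i
    by (simp add: geodesic_quadratic_def \<Gamma> connection_at_def metric_at_def bilinear_form_eq_inner[symmetric]
        ring_distribs sum.distrib sum_distrib_left sum_distrib_right sum_divide_distrib mult_ac)
  then show ?thesis unfolding Z_def[symmetric] by (simp add: vec_eq_iff)
qed

lemma normal_form_imp_douglas:
  assumes "normal_form a b x c (d x)" "y \<in> regular_dirs a b x"
  shows "spray_coeff (singular_square a b) x y i =
      1/2 * (\<Sum>j\<in>UNIV. \<Sum>k\<in>UNIV. douglas_connection a b d x $ i $ j $ k * y $ j * y $ k)
      + projective_factor a b (douglas_connection a b d) x y * y $ i"
proof -
  have reg: "regular y" "y \<noteq> 0" using assms(2) by (auto simp: regular_dirs_eq regular_def)
  have "metric_at a x (matrix_inv (a x) *v (\<chi> l. s_form a b x l)) v = s e v" for v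
  proof -
    have "metric_at a x v (matrix_inv (a x) *v (\<chi> l. s_form a b x l)) = (\<Sum>l\<in>UNIV. v $ l * s e (axis l 1))"
      by (simp add: metric_at_def matrix_vector_mul_assoc matrix_inv_right a_invertible x inner_vec_def s_form_eq)
    also have "\<dots> = s e v"
      by (rule linear_sum_axis[symmetric]) (use s_bilinear in \<open>simp add: bilinear_def\<close>)
    finally show ?thesis by (simp add: ip_sym)
  qed
  then have "EL y (geodesic_quadratic (douglas_connection a b d x) y - (1/2) *\<^sub>R connection_at a x y y) w" for w
    using normal_form_imp_EL[OF _ _ _ reg(2)] assms(1) unfolding normal_form_iff douglas_connection_deviation
    by blast
  from spray_douglas_iff(2)[OF reg(1) this] show ?thesis
    by (simp add: projective_factor_eq) (simp add: geodesic_quadratic_def)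
qed

end

section \<open>Joint smoothness in the point and the tangent vector\<close>

lemma smooth_on_fst:
  assumes "open S" "open U" "fst ` S \<subseteq> U" "smooth_on U f"
  shows "smooth_on S (\<lambda>z. f (fst z))"
  by (rule smooth_on_compose[OF assms(1-3) smooth_on_linear[OF bounded_linear_fst assms(1)] assms(4)])

lemma smooth_on_snd_nth:
  fixes S :: "('a::euclidean_space \<times> (real^'n)) set"
  shows "open S \<Longrightarrow> smooth_on S (\<lambda>z. snd z $ i)"
  by (intro smooth_on_nth smooth_on_linear bounded_linear_snd)

context chart_forms
begin

lemma smooth_douglas_connection:
  assumes "smooth_on U d"
  shows "smooth_on U (douglas_connection a b d)"
  unfolding douglas_connection_def[abs_def]
  by (intro smooth_intros open_U smooth_a a_invertible smooth_christoffel smooth_b_sq smooth_s_form smooth_b_up assms)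
    (use b_sq_pos in fastforce)+

lemma alpha_pos: "x \<in> U \<Longrightarrow> y \<noteq> 0 \<Longrightarrow> alpha a x y > 0"
  using a_pos by (simp add: alpha_def)

context
  fixes S :: "((real^'n) \<times> (real^'n)) set"
  assumes S: "open S" "fst ` S \<subseteq> U" "snd ` S \<subseteq> - {0}"
begin

lemma joint_domain: "z \<in> S \<Longrightarrow> fst z \<in> U" "z \<in> S \<Longrightarrow> snd z \<noteq> 0"
  using S by auto

lemmas smooth_fst = smooth_on_fst[OF S(1) open_U S(2)]

lemma smooth_joint_alpha: "smooth_on S (\<lambda>z. alpha a (fst z) (snd z))"
  unfolding alpha_def using a_pos joint_domain
  by (intro smooth_intros S(1) smooth_on_snd_nth smooth_fst open_U smooth_a) auto

lemma smooth_joint_beta: "smooth_on S (\<lambda>z. beta b (fst z) (snd z))"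
  unfolding beta_def
  by (intro smooth_intros S(1) smooth_on_snd_nth smooth_fst open_U smooth_b)

lemma smooth_joint_b_norm: "smooth_on S (\<lambda>z. b_norm a b (fst z))"
  unfolding b_norm_def
  by (intro smooth_fst[where f = "\<lambda>x. sqrt (b_sq a b x)"] smooth_intros open_U smooth_b_sq b_sq_pos)

end

text \<open>Smoothness is meaningful on open sets only, so openness has to come first. It follows
  from continuity of the two factors on the set of all nonzero vectors; therefore the preceding
  lemmas admit any open \<open>S\<close> and are applied there as well as on the regular
  vectors.\<close>

lemma open_regular: "open (SIGMA x:U. regular_dirs a b x)"
proof -
  let ?W = "U \<times> (- {0::real^'n})"
  have W: "open ?W" using open_U by (intro open_Times) auto
  have "fst ` ?W \<subseteq> U" "snd ` ?W \<subseteq> - {0}" by auto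
  note sm = smooth_joint_alpha[OF W this] smooth_joint_beta[OF W this] smooth_joint_b_norm[OF W this]
  have "smooth_on ?W (\<lambda>z. b_norm a b (fst z) * alpha a (fst z) (snd z) + beta b (fst z) (snd z))"
    "smooth_on ?W (\<lambda>z. b_norm a b (fst z) * alpha a (fst z) (snd z) - beta b (fst z) (snd z))"
    by (intro smooth_intros W sm)+
  then have o: "open (?W \<inter> (\<lambda>z. b_norm a b (fst z) * alpha a (fst z) (snd z) + beta b (fst z) (snd z)) -` (- {0}))"
    "open (?W \<inter> (\<lambda>z. b_norm a b (fst z) * alpha a (fst z) (snd z) - beta b (fst z) (snd z)) -` (- {0}))"
    using W by (auto intro!: continuous_open_preimage smooth_on_imp_continuous_on)
  have "(SIGMA x:U. regular_dirs a b x) =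
    (?W \<inter> (\<lambda>z. b_norm a b (fst z) * alpha a (fst z) (snd z) + beta b (fst z) (snd z)) -` (- {0})) \<inter>
    (?W \<inter> (\<lambda>z. b_norm a b (fst z) * alpha a (fst z) (snd z) - beta b (fst z) (snd z)) -` (- {0}))"
    by (auto simp: regular_dirs_def)
  then show ?thesis using o by (simp only: open_Int)
qed

lemma smooth_projective_factor:
  assumes \<Gamma>: "smooth_on U \<Gamma>"
  shows "smooth_on (SIGMA x:U. regular_dirs a b x) (\<lambda>(x, y). projective_factor a b \<Gamma> x y)"
proof -
  let ?S = "SIGMA x:U. regular_dirs a b x"
  note S = open_regular
  have f: "fst ` ?S \<subseteq> U" and s: "snd ` ?S \<subseteq> - {0}" by (auto simp: regular_dirs_def)
  note fst = smooth_on_fst[OF S open_U f]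
  note al = smooth_joint_alpha[OF S f s] and be = smooth_joint_beta[OF S f s] and bn = smooth_joint_b_norm[OF S f s]
  have y: "smooth_on ?S snd" by (rule smooth_on_linear[OF bounded_linear_snd S])
  have Q: "smooth_on ?S (\<lambda>z. geodesic_quadratic (\<Gamma> (fst z)) (snd z))"
    unfolding geodesic_quadratic_def by (intro smooth_intros S y fst[OF \<Gamma>]) auto
  have e: "smooth_on ?S (\<lambda>z. dual_vector a b (fst z))" by (rule fst[OF smooth_dual_vector])
  have da: "smooth_on ?S (\<lambda>z. deriv_matrix a (fst z) (snd z) $ i $ j)" for i j
  proof -
    have "smooth_on U (\<lambda>x. partial k (\<lambda>x. a x $ i $ j) x)" for k
      by (intro smooth_intros open_U smooth_a)
    then show ?thesis
      unfolding deriv_matrix_def vec_lambda_beta by (intro smooth_intros S y open_U smooth_a fst)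
  qed
  have db: "smooth_on ?S (\<lambda>z. deriv_vector b (fst z) (snd z) $ i)" for i
  proof -
    have "smooth_on U (\<lambda>x. partial k (\<lambda>x. b x $ i) x)" for k
      by (intro smooth_intros open_U smooth_b)
    then show ?thesis
      unfolding deriv_vector_def vec_lambda_beta by (intro smooth_intros S y open_U smooth_b fst)
  qed
  have mform: "smooth_on ?S (\<lambda>z. \<Sum>i\<in>UNIV. \<Sum>j\<in>UNIV. deriv_matrix a (fst z) (snd z) $ i $ j * v z $ i * v z $ j)"
    if "smooth_on ?S v" for v
    by (intro smooth_on_sum smooth_on_mult smooth_on_nth S da that)
  have vform: "smooth_on ?S (\<lambda>z. \<Sum>i\<in>UNIV. deriv_vector b (fst z) (snd z) $ i * v z $ i)"
    if "smooth_on ?S v" for v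
    by (intro smooth_on_sum smooth_on_mult smooth_on_nth S db that)
  have jets: "smooth_on ?S (\<lambda>z. dmetric_at a (fst z) (snd z) (snd z) (snd z))"
    "smooth_on ?S (\<lambda>z. dmetric_at a (fst z) (snd z) (dual_vector a b (fst z)) (dual_vector a b (fst z)))"
    "smooth_on ?S (\<lambda>z. dform_at b (fst z) (snd z) (dual_vector a b (fst z)))"
    "smooth_on ?S (\<lambda>z. dform_at b (fst z) (snd z) (snd z))"
    using mform[OF y] mform[OF e] vform[OF e] vform[OF y]
    by (simp_all add: dmetric_at_def bilinear_form_eq_inner dform_at_def inner_vec_def[of "deriv_vector _ _ _"])
  have forms: "smooth_on ?S (\<lambda>z. metric_at a (fst z) (snd z) (geodesic_quadratic (\<Gamma> (fst z)) (snd z)))"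
    "smooth_on ?S (\<lambda>z. beta b (fst z) (geodesic_quadratic (\<Gamma> (fst z)) (snd z)))"
    unfolding metric_at_def beta_def bilinear_form_eq_inner[symmetric]
    by (intro smooth_intros S y Q fst[OF smooth_a] fst[OF smooth_b])+
  have F: "smooth_on ?S (\<lambda>z. singular_square a b (fst z) (snd z))"
    unfolding singular_square_def
    by (intro smooth_intros S al be bn) (use alpha_pos in \<open>force simp: regular_dirs_def\<close>)
  have pos: "alpha a (fst z) (snd z) \<noteq> 0" "b_norm a b (fst z) \<noteq> 0" "singular_square a b (fst z) (snd z) \<noteq> 0"
    if z: "z \<in> ?S" for z
  proof -
    have z': "fst z \<in> U" "snd z \<in> regular_dirs a b (fst z)" using z by auto
    have "alpha a (fst z) (snd z) > 0" using z' alpha_pos by (auto simp: regular_dirs_def)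
    moreover have "b_norm a b (fst z) > 0" using b_sq_pos[OF z'(1)] by (simp add: b_norm_def)
    ultimately show "alpha a (fst z) (snd z) \<noteq> 0" "b_norm a b (fst z) \<noteq> 0" "singular_square a b (fst z) (snd z) \<noteq> 0"
      using z'(2) by (auto simp: singular_square_def regular_dirs_def)
  qed
  have "smooth_on ?S (\<lambda>z. projective_factor a b \<Gamma> (fst z) (snd z))"
    unfolding projective_factor_def Let_def
    by (intro smooth_intros S al be bn jets forms F) (use pos in auto)
  then show ?thesis by (simp add: case_prod_beta')
qed

end

section \<open>Change of charts\<close>

lemma smooth_on_directional_derivative:
  fixes f :: "real^'n \<Rightarrow> 'b::real_normed_vector"
  assumes "open V" "smooth_on V f"
  shows "smooth_on V (\<lambda>z. frechet_derivative f (at z) u)"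
proof (rule smooth_on_cong[OF assms(1)])
  show "smooth_on V (\<lambda>z. \<Sum>i\<in>UNIV. u $ i *\<^sub>R frechet_derivative f (at z) (axis i 1))"
    by (intro smooth_intros smooth_on_frechet_derivative assms) simp
  show "(\<Sum>i\<in>UNIV. u $ i *\<^sub>R frechet_derivative f (at z) (axis i 1)) = frechet_derivative f (at z) u"
    if "z \<in> V" for z
  proof -
    interpret linear "frechet_derivative f (at z)"
      by (rule has_derivative_linear[OF smooth_on_has_derivative[OF assms(2,1) that]])
    show ?thesis
      by (subst basis_expansion[of u, symmetric]) (simp add: sum scale scalar_mult_eq_scaleR)
  qed
qed

lemma exists_orthogonal:
  fixes v :: "real^'n"
  assumes "CARD('n) \<ge> 2"
  shows "\<exists>z. z \<noteq> 0 \<and> v \<bullet> z = 0"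
proof -
  obtain i j :: 'n where ij: "i \<noteq> j"
    using assms by (metis (full_types) card_2_iff' ex_card subset_UNIV)
  show ?thesis
  proof (cases "v $ j = 0")
    case True
    then have "axis j (1::real) \<noteq> 0 \<and> v \<bullet> axis j 1 = 0" by (simp add: inner_axis axis_eq_0_iff)
    then show ?thesis by blast
  next
    case False
    define z where "z = v $ j *\<^sub>R axis i 1 - v $ i *\<^sub>R axis j (1::real)"
    have "z $ i \<noteq> 0" using False ij by (simp add: z_def axis_def)
    moreover have "v \<bullet> z = 0" by (simp add: z_def inner_diff_right inner_axis)
    ultimately show ?thesis by (metis zero_index)
  qed
qed

locale chart_change =
  src: chart_point U a b x + tgt: chart_point U' a' b' "f x"
  for U U' :: "(real^'n::finite) set" and a a' :: "'n metric_coeffs" and b b' :: "'n form_coeffs"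
    and x :: "real^'n" and f :: "real^'n \<Rightarrow> real^'n" +
  fixes V :: "(real^'n) set"
  assumes open_V: "open V" and x_V: "x \<in> V" and V_U: "V \<subseteq> U" and f_V: "f ` V \<subseteq> U'"
    and smooth_f: "smooth_on V f"
    and a_law: "z \<in> V \<Longrightarrow> a z $ i $ j = (\<Sum>k\<in>UNIV. \<Sum>l\<in>UNIV. a' (f z) $ k $ l *
             partial i (\<lambda>x. f x $ k) z * partial j (\<lambda>x. f x $ l) z)"
    and b_law: "z \<in> V \<Longrightarrow> b z $ i = (\<Sum>k\<in>UNIV. b' (f z) $ k * partial i (\<lambda>x. f x $ k) z)"
begin

definition "J z = frechet_derivative f (at z)"

lemma has_derivative_f: "z \<in> V \<Longrightarrow> (f has_derivative J z) (at z)"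
  unfolding J_def by (rule smooth_on_has_derivative[OF smooth_f open_V])

lemma linear_J: "z \<in> V \<Longrightarrow> linear (J z)"
  using has_derivative_f has_derivative_linear by blast

lemma has_derivative_f_nth: "z \<in> V \<Longrightarrow> ((\<lambda>x. f x $ k) has_derivative (\<lambda>u. J z u $ k)) (at z)"
  by (rule bounded_linear.has_derivative[OF bounded_linear_vec_nth has_derivative_f])

lemma metric_pullback:
  assumes z: "z \<in> V"
  shows "metric_at a z u v = metric_at a' (f z) (J z u) (J z v)"
proof -
  have 1: "bilinear (\<lambda>u v. metric_at a z u v)" "bilinear (metric_at a' (f z))"
    unfolding metric_at_def by (rule bilinear_matrix_form)+
  have 2: "bilinear (\<lambda>u v. metric_at a' (f z) (J z u) (J z v))"
    using linear_J[OF z] 1(2) unfolding bilinear_def by (auto intro: linear_compose[unfolded o_def])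
  have "metric_at a z (axis i 1) (axis j 1) = metric_at a' (f z) (J z (axis i 1)) (J z (axis j 1))" for i j
    unfolding metric_at_def bilinear_form_eq_inner[of "a' (f z)", symmetric]
    by (simp add: inner_axis' matrix_vector_mult_basis column_def a_law[OF z] partial_eq[OF has_derivative_f_nth[OF z]])
  then show ?thesis using bilinear_eq_axis[OF 1(1) 2] by blast
qed

lemma form_pullback:
  assumes z: "z \<in> V"
  shows "b z \<bullet> u = b' (f z) \<bullet> J z u"
proof -
  have 1: "linear (\<lambda>u. b z \<bullet> u)" "linear (\<lambda>u. b' (f z) \<bullet> u)"
    by (auto intro!: linearI simp: inner_add_right)
  have 2: "linear (\<lambda>u. b' (f z) \<bullet> J z u)"
    using linear_compose[OF linear_J[OF z] 1(2)] by (simp add: o_def)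
  have "b z $ i = b' (f z) \<bullet> J z (axis i 1)" for i
    by (simp add: b_law[OF z] partial_eq[OF has_derivative_f_nth[OF z]] inner_vec_def)
  then have "b z \<bullet> axis i 1 = b' (f z) \<bullet> J z (axis i 1)" for i
    by (simp add: inner_axis)
  then show ?thesis
    by (subst linear_sum_axis[OF 1(1)], subst linear_sum_axis[OF 2]) simp
qed

definition "K u = frechet_derivative (\<lambda>z. J z u) (at x)"

lemma has_derivative_J: "((\<lambda>z. J z u) has_derivative K u) (at x)"
  unfolding K_def
  by (rule smooth_on_has_derivative[OF _ open_V x_V])
    (unfold J_def, rule smooth_on_directional_derivative[OF open_V smooth_f])

text \<open>Second derivatives of the transition map commute. They are the inhomogeneous terms in
  the transformation of first derivatives, and their symmetry makes \<open>r\<close> a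
  tensor.\<close>

lemma K_sym: "K u v = K v u"
proof -
  have "((\<lambda>z. J z u $ k) has_derivative (\<lambda>w. K u w $ k)) (at x)" for u k
    by (rule bounded_linear.has_derivative[OF bounded_linear_vec_nth has_derivative_J])
  then have "K u v $ k = K v u $ k" for k
    using second_derivative_symmetric[OF open_V x_V has_derivative_f_nth,
        where u = u and v = v and fu = "\<lambda>w. K u w $ k" and fv = "\<lambda>w. K v w $ k"]
    by blast
  then show ?thesis by (simp add: vec_eq_iff)
qed

lemma dmetric_pullback:
  "dmetric_at a x w u v = dmetric_at a' (f x) (J x w) (J x u) (J x v)
    + metric_at a' (f x) (K u w) (J x v) + metric_at a' (f x) (J x u) (K v w)"
proof -
  have "(a has_derivative deriv_matrix a x) (at x)"
    by (rule has_derivative_deriv_matrix[OF src.smooth_a src.open_U src.x])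
  from has_derivative_matrix_form[OF this has_derivative_const has_derivative_const, of u v]
  have 1: "((\<lambda>z. metric_at a z u v) has_derivative (\<lambda>w. dmetric_at a x w u v)) (at x)"
    by (simp add: metric_at_def dmetric_at_def)
  have "((\<lambda>z. a' (f z)) has_derivative (\<lambda>w. deriv_matrix a' (f x) (J x w))) (at x)"
    by (rule has_derivative_compose[OF has_derivative_f[OF x_V]
          has_derivative_deriv_matrix[OF tgt.smooth_a tgt.open_U tgt.x]])
  from has_derivative_matrix_form[OF this has_derivative_J has_derivative_J, of u v]
  have "((\<lambda>z. metric_at a' (f z) (J z u) (J z v)) has_derivative
      (\<lambda>w. metric_at a' (f x) (K u w) (J x v) + dmetric_at a' (f x) (J x w) (J x u) (J x v)
        + metric_at a' (f x) (J x u) (K v w))) (at x)"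
    by (simp add: metric_at_def dmetric_at_def)
  then have "((\<lambda>z. metric_at a z u v) has_derivative
      (\<lambda>w. metric_at a' (f x) (K u w) (J x v) + dmetric_at a' (f x) (J x w) (J x u) (J x v)
        + metric_at a' (f x) (J x u) (K v w))) (at x)"
    by (rule has_derivative_transform_within_open[OF _ open_V x_V]) (simp add: metric_pullback)
  from has_derivative_unique[OF 1 this] show ?thesis by (simp add: fun_eq_iff)
qed

lemma dform_pullback:
  "dform_at b x w u = dform_at b' (f x) (J x w) (J x u) + b' (f x) \<bullet> K u w"
proof -
  have 1: "((\<lambda>z. b z \<bullet> u) has_derivative (\<lambda>w. dform_at b x w u)) (at x)"
    unfolding dform_at_def
    by (rule has_derivative_inner_left[OF has_derivative_deriv_vector[OF src.smooth_b src.open_U src.x]])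
  have "((\<lambda>z. b' (f z)) has_derivative (\<lambda>w. deriv_vector b' (f x) (J x w))) (at x)"
    by (rule has_derivative_compose[OF has_derivative_f[OF x_V]
          has_derivative_deriv_vector[OF tgt.smooth_b tgt.open_U tgt.x]])
  from has_derivative_inner[OF this has_derivative_J, of u]
  have "((\<lambda>z. b' (f z) \<bullet> J z u) has_derivative
     (\<lambda>w. b' (f x) \<bullet> K u w + dform_at b' (f x) (J x w) (J x u))) (at x)"
    by (simp add: dform_at_def)
  then have "((\<lambda>z. b z \<bullet> u) has_derivative
     (\<lambda>w. b' (f x) \<bullet> K u w + dform_at b' (f x) (J x w) (J x u))) (at x)"
    by (rule has_derivative_transform_within_open[OF _ open_V x_V]) (simp add: form_pullback)
  from has_derivative_unique[OF 1 this] show ?thesis by (simp add: fun_eq_iff)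
qed

text \<open>\<open>J x\<close> is an isometry, hence injective and, in finite dimension, onto. It
  thus suffices to pair the difference with vectors \<open>J x v\<close>, where both terms reduce to
  the 1-form.\<close>

lemma J_dual_vector: "J x (dual_vector a b x) = dual_vector a' b' (f x)"
proof -
  define u where "u = J x (dual_vector a b x) - dual_vector a' b' (f x)"
  have "J x v = 0 \<Longrightarrow> v = 0" for v
    using metric_pullback[OF x_V, of v v] src.ip_pos[of v] by (auto simp: tgt.ip_simps)
  then have "inj (J x)" using linear_J[OF x_V] by (simp add: linear_injective_0)
  then have "surj (J x)" using linear_J[OF x_V] linear_injective_imp_surjective by blast
  then obtain v where v: "u = J x v" by (metis surjD)
  have "metric_at a' (f x) u (J x v) = 0"
    unfolding u_def tgt.ip_simps metric_pullback[OF x_V, symmetric] src.ip_e tgt.ip_e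
    by (simp add: form_pullback[OF x_V])
  then have "u = 0" using tgt.ip_pos[of u] v by force
  then show ?thesis by (simp add: u_def)
qed

text \<open>The terms pairing \<open>K\<close> with the dual vector cancel between the derivatives
  of the form and of the metric; those pairing \<open>K\<close> with \<open>J x u\<close> or
  \<open>J x v\<close> cancel by symmetry of \<open>K\<close>.\<close>

lemma r_pullback: "src.r u v = tgt.r (J x u) (J x v)"
  unfolding src.r_def tgt.r_def dmetric_pullback dform_pullback J_dual_vector
  by (simp add: tgt.ip_e tgt.ip_sym[of _ "dual_vector a' b' (f x)"] tgt.ip_sym[of "K _ _" "J x _"]
      K_sym[of v u] K_sym[of "dual_vector a b x" _] algebra_simps)

text \<open>Only \<open>r\<close> is compared across the charts. The terms with \<open>s\<close> are
  avoided by evaluating at a nonzero \<open>z\<close> orthogonal to the dual vector, which isolates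
  \<open>c\<close>, and then at the dual vector itself, where \<open>s e e = 0\<close>, which gives
  \<open>d\<close>.\<close>

lemma normal_form_coeffs_invariant:
  assumes "CARD('n) \<ge> 2" "normal_form a b x c d" "normal_form a' b' (f x) c' d'"
  shows "c = c'" "d = d'"
proof -
  let ?e = "dual_vector a b x" and ?e' = "dual_vector a' b' (f x)"
  have e: "metric_at a' (f x) ?e' (J x u) = metric_at a x ?e u" for u
    by (simp add: metric_pullback[OF x_V] J_dual_vector)
  have N: "tgt.N = src.N" using e[of ?e] by (simp add: tgt.N_def src.N_def J_dual_vector)
  have r: "src.r u u = c * metric_at a x u u + d * metric_at a x ?e u * metric_at a x ?e u
      - 6 / src.N * (src.s ?e u * metric_at a x ?e u)" for u
  proof -
    have "src.r u u = c * metric_at a x u u + d * metric_at a x ?e u * metric_at a x ?e u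
      - 3 / src.N * (src.s ?e u * metric_at a x ?e u + src.s ?e u * metric_at a x ?e u)"
      using assms(2) unfolding src.normal_form_iff by blast
    then show ?thesis by simp
  qed
  have r': "tgt.r (J x u) (J x u) = c' * metric_at a x u u + d' * metric_at a x ?e u * metric_at a x ?e u
      - 6 / src.N * (tgt.s ?e' (J x u) * metric_at a x ?e u)" for u
  proof -
    have "tgt.r (J x u) (J x u) = c' * metric_at a' (f x) (J x u) (J x u)
        + d' * metric_at a' (f x) ?e' (J x u) * metric_at a' (f x) ?e' (J x u)
      - 3 / tgt.N * (tgt.s ?e' (J x u) * metric_at a' (f x) ?e' (J x u) + tgt.s ?e' (J x u) * metric_at a' (f x) ?e' (J x u))"
      using assms(3) unfolding tgt.normal_form_iff by blast
    then show ?thesis by (simp add: e N metric_pullback[OF x_V, symmetric])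
  qed
  obtain z where z: "z \<noteq> 0" "b x \<bullet> z = 0"
    using exists_orthogonal[OF assms(1), of "b x"] by metis
  show "c = c'"
    using r[of z] r'[of z] r_pullback[of z z] z src.ip_pos[of z] by (simp add: src.ip_e)
  then show "d = d'"
    using r[of ?e] r'[of ?e] r_pullback[of ?e ?e] src.N_pos
    by (simp add: J_dual_vector src.s_e_e tgt.s_e_e src.N_def[symmetric])
qed

end

section \<open>Globalisation\<close>

locale metric_and_form_on_manifold =
  fixes M :: "'m topology" and A :: "('m, 'n::finite) chart set"
    and a :: "('m, 'n) chart \<Rightarrow> real^'n \<Rightarrow> real^'n^'n"
    and b :: "('m, 'n) chart \<Rightarrow> real^'n \<Rightarrow> real^'n"
  assumes manifold: "smooth_manifold M A" and metric: "riemannian_metric A a"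
    and form: "one_form A b" and nonvanishing: "nowhere_vanishing A b"
begin

lemma chart:
  assumes "\<kappa> \<in> A"
  shows "openin M (fst \<kappa>)" "open (coord_dom \<kappa>)"
    "homeomorphic_map (subtopology M (fst \<kappa>)) (top_of_set (coord_dom \<kappa>)) (snd \<kappa>)"
  using manifold assms by (auto simp: smooth_manifold_def)

lemma chart_inj: "\<kappa> \<in> A \<Longrightarrow> inj_on (snd \<kappa>) (fst \<kappa>)"
  using homeomorphic_imp_injective_map[OF chart(3)] openin_subset[OF chart(1)]
  by (metis inf.absorb2 topspace_subtopology)

lemma inv_chart: "\<kappa> \<in> A \<Longrightarrow> p \<in> fst \<kappa> \<Longrightarrow> inv_into (fst \<kappa>) (snd \<kappa>) (snd \<kappa> p) = p"
  by (simp add: chart_inj)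

lemma chart_forms: "\<kappa> \<in> A \<Longrightarrow> chart_forms (coord_dom \<kappa>) (a \<kappa>) (b \<kappa>)"
  using metric form nonvanishing chart(2)
  unfolding riemannian_metric_def one_form_def nowhere_vanishing_def
  by unfold_locales blast+

lemma open_overlap:
  assumes "\<kappa> \<in> A" "\<kappa>' \<in> A"
  shows "open (snd \<kappa> ` (fst \<kappa> \<inter> fst \<kappa>'))"
proof -
  have "openin (subtopology M (fst \<kappa>)) (fst \<kappa> \<inter> fst \<kappa>')"
    using chart(1)[OF assms(2)] by (metis inf_commute openin_subtopology_Int)
  then have "openin (top_of_set (coord_dom \<kappa>)) (snd \<kappa> ` (fst \<kappa> \<inter> fst \<kappa>'))"
    using homeomorphic_imp_open_map[OF chart(3)[OF assms(1)]] by (simp add: open_map_def)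
  then show ?thesis using chart(2)[OF assms(1)] openin_open_trans by blast
qed

lemma chart_change:
  assumes "\<kappa> \<in> A" "\<kappa>' \<in> A" "p \<in> fst \<kappa>" "p \<in> fst \<kappa>'"
  shows "chart_change (coord_dom \<kappa>) (coord_dom \<kappa>') (a \<kappa>) (a \<kappa>') (b \<kappa>) (b \<kappa>') (snd \<kappa> p)
    (transition \<kappa> \<kappa>') (snd \<kappa> ` (fst \<kappa> \<inter> fst \<kappa>'))"
proof -
  let ?V = "snd \<kappa> ` (fst \<kappa> \<inter> fst \<kappa>')"
  have t: "transition \<kappa> \<kappa>' (snd \<kappa> q) = snd \<kappa>' q" if "q \<in> fst \<kappa>" for q
    using that by (simp add: transition_def inv_chart assms)
  have 1: "chart_point (coord_dom \<kappa>) (a \<kappa>) (b \<kappa>) (snd \<kappa> p)"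
    "chart_point (coord_dom \<kappa>') (a \<kappa>') (b \<kappa>') (transition \<kappa> \<kappa>' (snd \<kappa> p))"
    unfolding t[OF assms(3)]
    by (rule chart_forms.chart_pointI[OF chart_forms]; use assms in \<open>simp add: coord_dom_def\<close>)+
  have 2: "smooth_on ?V (transition \<kappa> \<kappa>')"
    using manifold assms by (auto simp: smooth_manifold_def)
  have 3: "a \<kappa> z $ i $ j = (\<Sum>k\<in>UNIV. \<Sum>l\<in>UNIV. a \<kappa>' (transition \<kappa> \<kappa>' z) $ k $ l *
      partial i (\<lambda>x. transition \<kappa> \<kappa>' x $ k) z * partial j (\<lambda>x. transition \<kappa> \<kappa>' x $ l) z)"
    if z: "z \<in> ?V" for z i j
  proof -
    from z obtain q where q: "z = snd \<kappa> q" "q \<in> fst \<kappa> \<inter> fst \<kappa>'" by blast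
    then have tz: "transition \<kappa> \<kappa>' z = snd \<kappa>' q" using t by simp
    have "\<forall>i j. a \<kappa> (snd \<kappa> q) $ i $ j = (\<Sum>k\<in>UNIV. \<Sum>l\<in>UNIV. a \<kappa>' (snd \<kappa>' q) $ k $ l *
      partial i (\<lambda>x. transition \<kappa> \<kappa>' x $ k) (snd \<kappa> q) * partial j (\<lambda>x. transition \<kappa> \<kappa>' x $ l) (snd \<kappa> q))"
      using metric assms q(2) unfolding riemannian_metric_def by blast
    then show ?thesis unfolding tz unfolding q(1) by blast
  qed
  have 4: "b \<kappa> z $ i = (\<Sum>k\<in>UNIV. b \<kappa>' (transition \<kappa> \<kappa>' z) $ k *
      partial i (\<lambda>x. transition \<kappa> \<kappa>' x $ k) z)"
    if z: "z \<in> ?V" for z i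
  proof -
    from z obtain q where q: "z = snd \<kappa> q" "q \<in> fst \<kappa> \<inter> fst \<kappa>'" by blast
    then have tz: "transition \<kappa> \<kappa>' z = snd \<kappa>' q" using t by simp
    have "\<forall>i. b \<kappa> (snd \<kappa> q) $ i = (\<Sum>k\<in>UNIV. b \<kappa>' (snd \<kappa>' q) $ k *
      partial i (\<lambda>x. transition \<kappa> \<kappa>' x $ k) (snd \<kappa> q))"
      using form assms q(2) unfolding one_form_def by blast
    then show ?thesis unfolding tz unfolding q(1) by blast
  qed
  have 5: "transition \<kappa> \<kappa>' ` ?V \<subseteq> coord_dom \<kappa>'" by (auto simp: t coord_dom_def)
  show ?thesis
    unfolding chart_change_def chart_change_axioms_def
    using 1 2 3 4 5 open_overlap[OF assms(1,2)] assms(3,4) by (auto simp: coord_dom_def)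
qed

lemma smooth_scalar_glue:
  assumes "\<And>\<kappa>. \<kappa> \<in> A \<Longrightarrow> smooth_on (coord_dom \<kappa>) (f \<kappa>)"
    and "\<And>\<kappa> p. \<kappa> \<in> A \<Longrightarrow> p \<in> fst \<kappa> \<Longrightarrow> c p = f \<kappa> (snd \<kappa> p)"
  shows "smooth_scalar A c"
  unfolding smooth_scalar_def
proof
  fix \<kappa> assume \<kappa>: "\<kappa> \<in> A"
  show "smooth_on (coord_dom \<kappa>) (\<lambda>x. c (inv_into (fst \<kappa>) (snd \<kappa>) x))"
  proof (rule smooth_on_cong[OF chart(2)[OF \<kappa>] _ assms(1)[OF \<kappa>]])
    fix x assume "x \<in> coord_dom \<kappa>"
    then obtain p where "p \<in> fst \<kappa>" "x = snd \<kappa> p" by (auto simp: coord_dom_def)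
    then show "f \<kappa> x = c (inv_into (fst \<kappa>) (snd \<kappa>) x)" using \<kappa> by (simp add: inv_chart assms(2))
  qed
qed

lemma douglas_imp_global_normal_form:
  assumes n: "CARD('n) \<ge> 2"
    and D: "douglas_metric A (\<lambda>\<kappa>. singular_square (a \<kappa>) (b \<kappa>)) (\<lambda>\<kappa>. regular_dirs (a \<kappa>) (b \<kappa>))"
  shows "\<exists>c d. smooth_scalar A c \<and> smooth_scalar A d \<and>
    (\<forall>\<kappa>\<in>A. \<forall>p\<in>fst \<kappa>. normal_form (a \<kappa>) (b \<kappa>) (snd \<kappa> p) (c p) (d p))"
proof -
  have nf: "normal_form (a \<kappa>) (b \<kappa>) (snd \<kappa> p) (c_coeff (a \<kappa>) (b \<kappa>) (snd \<kappa> p)) (d_coeff (a \<kappa>) (b \<kappa>) (snd \<kappa> p))"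
    if \<kappa>: "\<kappa> \<in> A" and p: "p \<in> fst \<kappa>" for \<kappa> p
  proof -
    have x: "snd \<kappa> p \<in> coord_dom \<kappa>" using p by (simp add: coord_dom_def)
    interpret chart_point "coord_dom \<kappa>" "a \<kappa>" "b \<kappa>" "snd \<kappa> p"
      by (rule chart_forms.chart_pointI[OF chart_forms[OF \<kappa>] x])
    obtain \<Gamma> P where "\<forall>x\<in>coord_dom \<kappa>. \<forall>y\<in>regular_dirs (a \<kappa>) (b \<kappa>) x.
           (\<forall>t>0. P x (t *\<^sub>R y) = t * P x y) \<and>
           (\<forall>i. spray_coeff (singular_square (a \<kappa>) (b \<kappa>)) x y i =
              1/2 * (\<Sum>j\<in>UNIV. \<Sum>k\<in>UNIV. \<Gamma> x $ i $ j $ k * y $ j * y $ k) + P x y * y $ i)"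
      using D \<kappa> unfolding douglas_metric_def by blast
    then obtain c d where "normal_form (a \<kappa>) (b \<kappa>) (snd \<kappa> p) c d"
      using douglas_imp_normal_form[of "\<Gamma> (snd \<kappa> p)"] x by blast
    then show ?thesis using normal_form_coeffs[OF n] by metis
  qed
  \<comment> \<open>An arbitrary chart around each point; \<open>inv\<close> below shows that every
    other chart gives the same values, which also makes the resulting functions smooth.\<close>
  define ch where "ch p = (SOME \<kappa>. \<kappa> \<in> A \<and> p \<in> fst \<kappa>)" for p
  define c where "c p = c_coeff (a (ch p)) (b (ch p)) (snd (ch p) p)" for p
  define d where "d p = d_coeff (a (ch p)) (b (ch p)) (snd (ch p) p)" for p
  have inv: "c p = c_coeff (a \<kappa>) (b \<kappa>) (snd \<kappa> p)" "d p = d_coeff (a \<kappa>) (b \<kappa>) (snd \<kappa> p)"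
    if \<kappa>: "\<kappa> \<in> A" and p: "p \<in> fst \<kappa>" for \<kappa> p
  proof -
    have ch: "ch p \<in> A" "p \<in> fst (ch p)"
      using someI[of "\<lambda>\<kappa>. \<kappa> \<in> A \<and> p \<in> fst \<kappa>" \<kappa>] that by (auto simp: ch_def)
    have t: "transition \<kappa> (ch p) (snd \<kappa> p) = snd (ch p) p" by (simp add: transition_def inv_chart \<kappa> p)
    note inv = chart_change.normal_form_coeffs_invariant[OF chart_change[OF \<kappa> ch(1) p ch(2)] n, unfolded t,
        OF nf[OF \<kappa> p] nf[OF ch]]
    show "c p = c_coeff (a \<kappa>) (b \<kappa>) (snd \<kappa> p)" "d p = d_coeff (a \<kappa>) (b \<kappa>) (snd \<kappa> p)"
      using inv by (simp_all add: c_def d_def)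
  qed
  have "smooth_scalar A c"
    by (rule smooth_scalar_glue[where f = "\<lambda>\<kappa>. c_coeff (a \<kappa>) (b \<kappa>)", OF _ inv(1)]) (rule chart_forms.smooth_c_coeff[OF chart_forms n])
  moreover have "smooth_scalar A d"
    by (rule smooth_scalar_glue[where f = "\<lambda>\<kappa>. d_coeff (a \<kappa>) (b \<kappa>)", OF _ inv(2)]) (rule chart_forms.smooth_d_coeff[OF chart_forms n])
  ultimately show ?thesis using nf inv by metis
qed

lemma global_normal_form_imp_douglas:
  assumes d: "smooth_scalar A d"
    and nf: "\<forall>\<kappa>\<in>A. \<forall>p\<in>fst \<kappa>. normal_form (a \<kappa>) (b \<kappa>) (snd \<kappa> p) (c p) (d p)"
  shows "douglas_metric A (\<lambda>\<kappa>. singular_square (a \<kappa>) (b \<kappa>)) (\<lambda>\<kappa>. regular_dirs (a \<kappa>) (b \<kappa>))"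
  unfolding douglas_metric_def
proof
  fix \<kappa> assume \<kappa>: "\<kappa> \<in> A"
  interpret chart_forms "coord_dom \<kappa>" "a \<kappa>" "b \<kappa>" by (rule chart_forms[OF \<kappa>])
  define d' where "d' x = d (inv_into (fst \<kappa>) (snd \<kappa>) x)" for x
  \<comment> \<open>The conformal coefficient \<open>c\<close> cancels from the Euler-Lagrange
    equation, so the connection is built from \<open>d\<close> alone.\<close>
  define \<Gamma> where "\<Gamma> = douglas_connection (a \<kappa>) (b \<kappa>) d'"
  have d': "smooth_on (coord_dom \<kappa>) d'"
    using d \<kappa> unfolding smooth_scalar_def d'_def[abs_def] by blast
  have "(\<forall>t>0. projective_factor (a \<kappa>) (b \<kappa>) \<Gamma> x (t *\<^sub>R y) = t * projective_factor (a \<kappa>) (b \<kappa>) \<Gamma> x y) \<and>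
       (\<forall>i. spray_coeff (singular_square (a \<kappa>) (b \<kappa>)) x y i =
          1/2 * (\<Sum>j\<in>UNIV. \<Sum>k\<in>UNIV. \<Gamma> x $ i $ j $ k * y $ j * y $ k) + projective_factor (a \<kappa>) (b \<kappa>) \<Gamma> x y * y $ i)"
    if x: "x \<in> coord_dom \<kappa>" and y: "y \<in> regular_dirs (a \<kappa>) (b \<kappa>) x" for x y
  proof -
    interpret chart_point "coord_dom \<kappa>" "a \<kappa>" "b \<kappa>" x by (rule chart_pointI[OF x])
    obtain p where p: "p \<in> fst \<kappa>" "x = snd \<kappa> p" using x by (auto simp: coord_dom_def)
    then have "normal_form (a \<kappa>) (b \<kappa>) x (c p) (d' x)" using nf \<kappa> by (simp add: d'_def inv_chart)
    moreover have "y \<noteq> 0" using y by (simp add: regular_dirs_def)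
    ultimately show ?thesis
      unfolding \<Gamma>_def using normal_form_imp_douglas y projective_factor_scale by blast
  qed
  then show "\<exists>\<Gamma> P. smooth_on (coord_dom \<kappa>) \<Gamma> \<and>
        smooth_on (SIGMA x:coord_dom \<kappa>. regular_dirs (a \<kappa>) (b \<kappa>) x) (\<lambda>(x, y). P x y) \<and>
        (\<forall>x\<in>coord_dom \<kappa>. \<forall>y\<in>regular_dirs (a \<kappa>) (b \<kappa>) x.
           (\<forall>t>0. P x (t *\<^sub>R y) = t * P x y) \<and>
           (\<forall>i. spray_coeff (singular_square (a \<kappa>) (b \<kappa>)) x y i =
              1/2 * (\<Sum>j\<in>UNIV. \<Sum>k\<in>UNIV. \<Gamma> x $ i $ j $ k * y $ j * y $ k) + P x y * y $ i))"
    using smooth_douglas_connection[OF d'] smooth_projective_factor[OF smooth_douglas_connection[OF d']]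
    unfolding \<Gamma>_def by blast
qed

end

theorem theorem1p1:
  fixes M :: "'m topology"
    and A :: "('m, 'n::finite) chart set"
    and a :: "('m, 'n) chart \<Rightarrow> real^'n \<Rightarrow> real^'n^'n"
    and b :: "('m, 'n) chart \<Rightarrow> real^'n \<Rightarrow> real^'n"
  assumes "CARD('n) \<ge> 3"
    and "smooth_manifold M A"
    and "riemannian_metric A a"
    and "one_form A b"
    and "nowhere_vanishing A b"
  shows "douglas_metric A (\<lambda>\<kappa>. singular_square (a \<kappa>) (b \<kappa>)) (\<lambda>\<kappa>. regular_dirs (a \<kappa>) (b \<kappa>)) \<longleftrightarrow>
    (\<exists>c d :: 'm \<Rightarrow> real. smooth_scalar A c \<and> smooth_scalar A d \<and>
      (\<forall>\<kappa>\<in>A. \<forall>p\<in>fst \<kappa>. \<forall>i j.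
        (let x = snd \<kappa> p; a = a \<kappa>; b = b \<kappa> in
          r_tensor a b x i j =
            c p * a x $ i $ j + d p * b x $ i * b x $ j
              - 3 / b_sq a b x * (s_form a b x i * b x $ j + s_form a b x j * b x $ i) \<and>
          s_tensor a b x i j =
            1 / b_sq a b x * (b x $ i * s_form a b x j - b x $ j * s_form a b x i))))"
proof -
  interpret metric_and_form_on_manifold M A a b
    using assms(2-5) by unfold_locales
  have n: "CARD('n) \<ge> 2" using assms(1) by simp
  show ?thesis
    unfolding Let_def normal_form_def[symmetric]
    using douglas_imp_global_normal_form[OF n] global_normal_form_imp_douglas by blast
qed

end
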